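(* Let $G$ be a non-discrete locally compact group, and let $\rho \in P_1(G)$ be irreducible. Then for every $x \in C^*(G)$ we have $$\lim_{n\to\infty} \|\rho^n \cdot x\| = 0.$$
   Context: For a locally compact group $G$, $B(G)$ denotes the Fourier--Stieltjes algebra: the algebra (under pointwise operations) of all matrix coefficient functions $r \mapsto \langle \pi(r)\xi, \eta\rangle$ of continuous unitary representations $\pi$ of $G$. It is a Banach algebra with the norm coming from its identification with the dual Banach space of the universal group $C^*$-algebra $C^*(G)$, where the duality is determined by $\langle f, \rho\rangle = \int_G f(r)\rho(r)\,dr$ for $f \in L^1(G)$. $P_1(G)$ denotes the set of (continuous) positive definite functions on $G$ of norm one; thus $\rho \in P_1(G)$ means that there are a continuous unitary representation $\pi$ of $G$ on a Hilbert space $H_\pi$ and a unit vector $\xi_\rho \in H_\pi$ with $\rho(r) = \langle \pi(r)\xi_\rho, \xi_\rho\rangle$ for all $r \in G$. An element $\rho \in P_1(G)$ is called irreducible if for every non-zero positive $x \in C^*(G)$ there exists $n \in \mathbb{N} = \{1,2,\dots\}$ such that $\langle x, \rho^n\rangle \neq 0$, where $\rho^n$ is the pointwise $n$-th power. For $\rho \in B(G)$ and $x \in C^*(G)$, $\rho \cdot x \in C^*(G)$ denotes the canonical action, determined by $\langle \rho\cdot x, \sigma\rangle = \langle x, \rho\sigma\rangle$ for all $\sigma \in B(G)$ (so $\rho\cdot f$ is the pointwise product $\rho f$ for $f \in L^1(G)$). The norm is that of $C^*(G)$. *)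

theory Defs
  imports "HOL-Analysis.Analysis" "HOL-Library.Function_Algebras"
begin

text \<open>
  The group operation is written additively, as in the library class
  \<open>topological_group_add\<close>, which does not include commutativity: \<open>r + s\<close> stands for
  the product, \<open>- r\<close> for the inverse and \<open>0\<close> for the identity.
\<close>

definition left_haar_measure :: "'g::{topological_group_add,t2_space} measure \<Rightarrow> bool"
  where "left_haar_measure \<mu> \<longleftrightarrow>
    sets \<mu> = sets borel \<and>
    emeasure \<mu> UNIV \<noteq> 0 \<and>
    (\<forall>K. compact K \<longrightarrow> emeasure \<mu> K < \<infinity>) \<and>
    (\<forall>A\<in>sets borel. emeasure \<mu> A = (INF U\<in>{U. open U \<and> A \<subseteq> U}. emeasure \<mu> U)) \<and>
    (\<forall>U. open U \<longrightarrow> emeasure \<mu> U = (SUP K\<in>{K. compact K \<and> K \<subseteq> U}. emeasure \<mu> K)) \<and>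
    (\<forall>g. \<forall>A\<in>sets borel. emeasure \<mu> ((+) g ` A) = emeasure \<mu> A)"

text \<open>
  The vectors of a Hilbert space are complex functions on an index type \<open>'i\<close> with pointwise
  linear structure, but the inner product is arbitrary. Up to isomorphism these include all
  Hilbert spaces with an orthonormal basis indexed by a subset of \<open>'i\<close>, namely the
  spaces of square-summable families.
\<close>

definition fscale :: "complex \<Rightarrow> ('i \<Rightarrow> complex) \<Rightarrow> 'i \<Rightarrow> complex"
  where "fscale c v = (\<lambda>i. c * v i)"

interpretation fscale: vector_space fscale
  by unfold_locales (auto simp: fscale_def fun_eq_iff algebra_simps)

definition ip_norm :: "('v \<Rightarrow> 'v \<Rightarrow> complex) \<Rightarrow> 'v \<Rightarrow> real"
  where "ip_norm ip v = sqrt (Re (ip v v))"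

text \<open>The inner product is linear in the first argument.\<close>

definition hilbert_space ::
    "('i \<Rightarrow> complex) set \<Rightarrow> (('i \<Rightarrow> complex) \<Rightarrow> ('i \<Rightarrow> complex) \<Rightarrow> complex) \<Rightarrow> bool"
  where "hilbert_space H ip \<longleftrightarrow>
    fscale.subspace H \<and>
    (\<forall>u\<in>H. \<forall>v\<in>H. \<forall>w\<in>H. ip (u + v) w = ip u w + ip v w) \<and>
    (\<forall>c. \<forall>u\<in>H. \<forall>v\<in>H. ip (fscale c u) v = c * ip u v) \<and>
    (\<forall>u\<in>H. \<forall>v\<in>H. ip v u = cnj (ip u v)) \<and>
    (\<forall>v\<in>H. v \<noteq> 0 \<longrightarrow> Re (ip v v) > 0) \<and>
    (\<forall>X. (\<forall>n::nat. X n \<in> H) \<and>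
        (\<forall>e>0. \<exists>N. \<forall>m\<ge>N. \<forall>n\<ge>N. ip_norm ip (X m - X n) < e) \<longrightarrow>
      (\<exists>v\<in>H. (\<lambda>n. ip_norm ip (X n - v)) \<longlonglongrightarrow> 0))"

definition unitary_on ::
    "('i \<Rightarrow> complex) set \<Rightarrow> (('i \<Rightarrow> complex) \<Rightarrow> ('i \<Rightarrow> complex) \<Rightarrow> complex)
      \<Rightarrow> (('i \<Rightarrow> complex) \<Rightarrow> ('i \<Rightarrow> complex)) \<Rightarrow> bool"
  where "unitary_on H ip T \<longleftrightarrow>
    T ` H = H \<and>
    (\<forall>u\<in>H. \<forall>v\<in>H. T (u + v) = T u + T v) \<and>
    (\<forall>c. \<forall>v\<in>H. T (fscale c v) = fscale c (T v)) \<and>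
    (\<forall>u\<in>H. \<forall>v\<in>H. ip (T u) (T v) = ip u v)"

record ('g, 'i) unirep =
  hspace :: "('i \<Rightarrow> complex) set"
  hip :: "('i \<Rightarrow> complex) \<Rightarrow> ('i \<Rightarrow> complex) \<Rightarrow> complex"
  act :: "'g \<Rightarrow> ('i \<Rightarrow> complex) \<Rightarrow> ('i \<Rightarrow> complex)"

abbreviation hnorm :: "('g, 'i) unirep \<Rightarrow> ('i \<Rightarrow> complex) \<Rightarrow> real"
  where "hnorm R \<equiv> ip_norm (hip R)"

text \<open>Continuity of a representation is continuity in the strong operator topology.\<close>

definition unitary_rep :: "('g::topological_group_add, 'i) unirep \<Rightarrow> bool"
  where "unitary_rep R \<longleftrightarrow>
    hilbert_space (hspace R) (hip R) \<and>
    (\<forall>r. unitary_on (hspace R) (hip R) (act R r)) \<and>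
    (\<forall>v\<in>hspace R. act R 0 v = v) \<and>
    (\<forall>r s. \<forall>v\<in>hspace R. act R (r + s) v = act R r (act R s v)) \<and>
    (\<forall>v\<in>hspace R. \<forall>s. ((\<lambda>r. hnorm R (act R r v - act R s v)) \<longlongrightarrow> 0) (at s))"

definition matrix_coeff ::
    "('g, 'i) unirep \<Rightarrow> ('i \<Rightarrow> complex) \<Rightarrow> ('i \<Rightarrow> complex) \<Rightarrow> 'g \<Rightarrow> complex"
  where "matrix_coeff R \<xi> \<eta> = (\<lambda>r. hip R (act R r \<xi>) \<eta>)"

text \<open>
  HOL has no quantification over types inside a formula, so below the representations of \<open>'g\<close>
  range over those with index type \<open>'g\<close>. This loses nothing: the lemma
  \<open>cyclic_subrep_realization\<close> shows that every cyclic subrepresentation of a representation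
  over any index type is unitarily equivalent to one of these, and matrix coefficients and the
  norm of $C^*(G)$ depend only on the cyclic representations.
\<close>

context
  fixes H :: "('i \<Rightarrow> complex) set" and ip
  assumes H: "hilbert_space H ip"
begin

lemma hilbert_add: "u \<in> H \<Longrightarrow> v \<in> H \<Longrightarrow> u + v \<in> H"
  and hilbert_scale: "u \<in> H \<Longrightarrow> fscale c u \<in> H"
  and hilbert_zero: "0 \<in> H"
  and hilbert_diff: "u \<in> H \<Longrightarrow> v \<in> H \<Longrightarrow> u - v \<in> H"
  using H unfolding hilbert_space_def
  by (auto intro: fscale.subspace_add fscale.subspace_scale fscale.subspace_0 fscale.subspace_diff)

lemma ip_add_left: "u \<in> H \<Longrightarrow> v \<in> H \<Longrightarrow> w \<in> H \<Longrightarrow> ip (u + v) w = ip u w + ip v w"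
  and ip_scale_left: "u \<in> H \<Longrightarrow> v \<in> H \<Longrightarrow> ip (fscale c u) v = c * ip u v"
  and ip_commute: "u \<in> H \<Longrightarrow> v \<in> H \<Longrightarrow> ip v u = cnj (ip u v)"
  and ip_pos: "v \<in> H \<Longrightarrow> v \<noteq> 0 \<Longrightarrow> Re (ip v v) > 0"
  using H unfolding hilbert_space_def by blast+

lemma ip_zero_left: "v \<in> H \<Longrightarrow> ip 0 v = 0"
  using ip_scale_left[OF hilbert_zero, of v 0] by (simp add: fscale_def zero_fun_def)

lemma ip_diff_left:
  assumes "u \<in> H" "v \<in> H" "w \<in> H"
  shows "ip (u - v) w = ip u w - ip v w"
  using ip_add_left[of "u - v" v w] hilbert_diff assms by simp

lemma ip_diff_right:
  assumes "u \<in> H" "v \<in> H" "w \<in> H"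
  shows "ip w (u - v) = ip w u - ip w v"
  using ip_diff_left[OF assms] ip_commute hilbert_diff assms by (metis complex_cnj_diff)

lemma ip_scale_right:
  assumes "u \<in> H" "v \<in> H"
  shows "ip u (fscale c v) = cnj c * ip u v"
  using ip_scale_left[OF assms(2,1), of c] ip_commute hilbert_scale assms
  by (metis complex_cnj_mult)

lemma ip_nonneg: "v \<in> H \<Longrightarrow> Re (ip v v) \<ge> 0"
  using ip_pos[of v] ip_zero_left[of v] by (cases "v = 0") auto

lemma ip_self_real: "v \<in> H \<Longrightarrow> ip v v = of_real (Re (ip v v))"
  using ip_commute[of v v] by (simp add: complex_eq_iff)

lemma ip_norm_square: "v \<in> H \<Longrightarrow> (ip_norm ip v)\<^sup>2 = Re (ip v v)"
  using ip_nonneg by (simp add: ip_norm_def)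

lemma ip_norm_nonneg: "v \<in> H \<Longrightarrow> 0 \<le> ip_norm ip v"
  using ip_nonneg by (simp add: ip_norm_def)

lemma ip_Cauchy_Schwarz:
  assumes u: "u \<in> H" and v: "v \<in> H"
  shows "cmod (ip u v) \<le> ip_norm ip u * ip_norm ip v"
proof (cases "v = 0")
  case True
  then show ?thesis using ip_zero_left[OF u] ip_commute[OF v u] ip_norm_nonneg u v by simp
next
  case False
  define b where "b = Re (ip v v)"
  define c where "c = ip u v / of_real b"
  have b: "b > 0" using ip_pos[OF v False] by (simp add: b_def)
  have vv: "ip v v = of_real b" using ip_self_real[OF v] by (simp add: b_def)
  have cv: "fscale c v \<in> H" using v hilbert_scale by blast
  have "ip (u - fscale c v) (u - fscale c v)
      = ip u u - cnj c * ip u v - c * (ip v u - cnj c * ip v v)"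
    using u v cv by (simp add: ip_diff_left ip_diff_right hilbert_diff ip_scale_left ip_scale_right algebra_simps)
  also have "\<dots> = ip u u - cnj c * ip u v"
    using b by (simp add: vv ip_commute[OF u v] c_def)
  also have "\<dots> = ip u u - of_real ((cmod (ip u v))\<^sup>2 / b)"
    using complex_norm_square[of "ip u v"] by (simp add: c_def mult.commute)
  finally have "Re (ip u u) - (cmod (ip u v))\<^sup>2 / b \<ge> 0"
    using ip_nonneg[OF hilbert_diff[OF u cv]] by simp
  then have "(cmod (ip u v))\<^sup>2 \<le> Re (ip u u) * b"
    using b by (simp add: field_simps)
  also have "\<dots> = (ip_norm ip u * ip_norm ip v)\<^sup>2"
    using u v by (simp add: power_mult_distrib ip_norm_square b_def)
  finally show ?thesis
    using power2_le_imp_le ip_norm_nonneg u v by (meson mult_nonneg_nonneg)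
qed

lemma ip_norm_triangle:
  assumes u: "u \<in> H" and v: "v \<in> H"
  shows "ip_norm ip (u + v) \<le> ip_norm ip u + ip_norm ip v"
proof (rule power2_le_imp_le)
  have "ip u (u + v) = ip u u + ip u v" "ip v (u + v) = ip v u + ip v v"
    using ip_commute ip_add_left hilbert_add u v by (metis complex_cnj_add)+
  then have "Re (ip (u + v) (u + v)) = Re (ip u u) + 2 * Re (ip u v) + Re (ip v v)"
    using ip_add_left[OF u v hilbert_add[OF u v]] ip_commute[OF u v] by simp
  then show "(ip_norm ip (u + v))\<^sup>2 \<le> (ip_norm ip u + ip_norm ip v)\<^sup>2"
    using ip_Cauchy_Schwarz[OF u v] complex_Re_le_cmod[of "ip u v"] u v
    by (simp add: ip_norm_square hilbert_add power2_sum)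
qed (use ip_norm_nonneg u v in simp)

lemma ip_norm_minus_commute:
  assumes "u \<in> H" "v \<in> H"
  shows "ip_norm ip (u - v) = ip_norm ip (v - u)"
  using assms by (simp add: ip_norm_def ip_diff_left ip_diff_right hilbert_diff)

lemma hilbert_complete:
  assumes "\<And>n::nat. X n \<in> H"
    and "\<And>e. e > 0 \<Longrightarrow> \<exists>N. \<forall>m\<ge>N. \<forall>n\<ge>N. ip_norm ip (X m - X n) < e"
  shows "\<exists>v\<in>H. (\<lambda>n. ip_norm ip (X n - v)) \<longlonglongrightarrow> 0"
  using H assms unfolding hilbert_space_def by blast

end

lemma cyclic_subrep_realization:
  fixes R :: "('g::topological_group_add, 'i) unirep"
  assumes R: "unitary_rep R" and \<xi>: "\<xi> \<in> hspace R"
  obtains S :: "('g, 'g) unirep" and U where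
    "unitary_rep S"
    "U ` hspace S \<subseteq> hspace R" "\<xi> \<in> U ` hspace S"
    "\<And>u v. u \<in> hspace S \<Longrightarrow> v \<in> hspace S \<Longrightarrow> U (u + v) = U u + U v"
    "\<And>c v. v \<in> hspace S \<Longrightarrow> U (fscale c v) = fscale c (U v)"
    "\<And>u v. u \<in> hspace S \<Longrightarrow> v \<in> hspace S \<Longrightarrow> hip R (U u) (U v) = hip S u v"
    "\<And>r v. v \<in> hspace S \<Longrightarrow> U (act S r v) = act R r (U v)"
proof -
  define H where "H = hspace R"
  define ip where "ip = hip R"
  define \<pi> where "\<pi> = act R"
  have hs: "hilbert_space H ip"
    and img: "\<And>r. \<pi> r ` H = H"
    and padd: "\<And>r u v. u \<in> H \<Longrightarrow> v \<in> H \<Longrightarrow> \<pi> r (u + v) = \<pi> r u + \<pi> r v"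
    and pscale: "\<And>r c v. v \<in> H \<Longrightarrow> \<pi> r (fscale c v) = fscale c (\<pi> r v)"
    and pip: "\<And>r u v. u \<in> H \<Longrightarrow> v \<in> H \<Longrightarrow> ip (\<pi> r u) (\<pi> r v) = ip u v"
    and p0: "\<And>v. v \<in> H \<Longrightarrow> \<pi> 0 v = v"
    and pplus: "\<And>r s v. v \<in> H \<Longrightarrow> \<pi> (r + s) v = \<pi> r (\<pi> s v)"
    and pcont: "\<And>v s. v \<in> H \<Longrightarrow> ((\<lambda>r. ip_norm ip (\<pi> r v - \<pi> s v)) \<longlongrightarrow> 0) (at s)"
    using R unfolding unitary_rep_def unitary_on_def H_def ip_def \<pi>_def by auto
  note hfacts = hilbert_add[OF hs] hilbert_scale[OF hs] hilbert_zero[OF hs] hilbert_diff[OF hs]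
  have pH: "\<pi> r v \<in> H" if "v \<in> H" for r v using img that by blast
  have \<xi>H: "\<xi> \<in> H" using \<xi> by (simp add: H_def)
  have pdiff: "\<pi> r (u - v) = \<pi> r u - \<pi> r v" if "u \<in> H" "v \<in> H" for r u v
    using padd[of "u - v" v r] hfacts(4)[OF that] that by simp
  define good where "good L \<longleftrightarrow> L \<subseteq> H \<and> \<xi> \<in> L \<and> fscale.subspace L \<and> (\<forall>r. \<forall>v\<in>L. \<pi> r v \<in> L) \<and>
    (\<forall>X v. (\<forall>n::nat. X n \<in> L) \<and> v \<in> H \<and> (\<lambda>n. ip_norm ip (X n - v)) \<longlonglongrightarrow> 0 \<longrightarrow> v \<in> L)" for L
  define K where "K = \<Inter>{L. good L}"
  have goodH: "good H"
    using hs pH \<xi>H unfolding good_def hilbert_space_def by auto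
  have KH: "K \<subseteq> H" using goodH unfolding K_def by blast
  have \<xi>K: "\<xi> \<in> K" unfolding K_def good_def by blast
  have Ksub: "fscale.subspace K"
    unfolding K_def by (rule fscale.subspace_Inter) (auto simp: good_def)
  have Kadd: "u + v \<in> K" if "u \<in> K" "v \<in> K" for u v
    using Ksub that by (rule fscale.subspace_add)
  have Kscale: "fscale c v \<in> K" if "v \<in> K" for c v
    using Ksub that by (rule fscale.subspace_scale)
  have Kdiff: "u - v \<in> K" if "u \<in> K" "v \<in> K" for u v
    using Ksub that by (rule fscale.subspace_diff)
  have K0: "0 \<in> K" using Ksub by (rule fscale.subspace_0)
  have Kpi: "\<pi> r v \<in> K" if "v \<in> K" for r v
    using that unfolding K_def good_def by blast
  have Kclosed: "v \<in> K" if "\<And>n::nat. X n \<in> K" "v \<in> H" "(\<lambda>n. ip_norm ip (X n - v)) \<longlonglongrightarrow> 0" for X v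
    using that unfolding K_def good_def by blast
  define V where "V v = (\<lambda>r. ip v (\<pi> r \<xi>))" for v
  have Vadd: "V (u + v) = V u + V v" if "u \<in> H" "v \<in> H" for u v
    using that by (simp add: V_def fun_eq_iff ip_add_left[OF hs] pH \<xi>H)
  have Vscale: "V (fscale c v) = fscale c (V v)" if "v \<in> H" for c v
    using that by (simp add: V_def fun_eq_iff ip_scale_left[OF hs] pH \<xi>H) (simp add: fscale_def)
  have Vdiff: "V (u - v) = V u - V v" if "u \<in> H" "v \<in> H" for u v
    using that by (simp add: V_def fun_eq_iff ip_diff_left[OF hs] pH \<xi>H)
  have ker: "v = 0" if v: "v \<in> K" and Vv: "V v = 0" for v
  proof (rule ccontr)
    assume nz: "v \<noteq> 0"
    have vH: "v \<in> H" using v KH by blast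
    define N where "N = {w \<in> H. \<forall>r. ip (\<pi> r w) v = 0}"
    have "good N"
      unfolding good_def
    proof (intro conjI allI ballI impI)
      show "N \<subseteq> H" by (auto simp: N_def)
      have "ip (\<pi> r \<xi>) v = 0" for r
        using ip_commute[OF hs vH pH[OF \<xi>H]] fun_cong[OF Vv, of r] by (simp add: V_def)
      then show "\<xi> \<in> N" by (simp add: N_def \<xi>H)
      have "\<pi> r 0 = 0" for r using pdiff[of \<xi> \<xi> r] \<xi>H by simp
      then show "fscale.subspace N"
        unfolding fscale.subspace_def N_def
        by (auto simp: hfacts ip_zero_left[OF hs vH] padd pscale ip_add_left[OF hs] ip_scale_left[OF hs] pH vH)
      show "\<pi> r w \<in> N" if "w \<in> N" for r w
        using that by (auto simp: N_def pH pplus[symmetric])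
      fix X w
      assume *: "(\<forall>n::nat. X n \<in> N) \<and> w \<in> H \<and> (\<lambda>n. ip_norm ip (X n - w)) \<longlonglongrightarrow> 0"
      have "ip (\<pi> r w) v = 0" for r
      proof -
        have b: "cmod (ip (\<pi> r w) v) \<le> ip_norm ip (X n - w) * ip_norm ip v" for n
        proof -
          have X: "X n \<in> H" "ip (\<pi> r (X n)) v = 0" and w: "w \<in> H" using * by (auto simp: N_def)
          have "ip (\<pi> r (X n - w)) v = - ip (\<pi> r w) v"
            using X w by (simp add: pdiff ip_diff_left[OF hs] pH vH)
          moreover have "ip_norm ip (\<pi> r (X n - w)) = ip_norm ip (X n - w)"
            using X w by (simp add: ip_norm_def pip hfacts)
          ultimately show ?thesis
            using ip_Cauchy_Schwarz[OF hs pH[OF hfacts(4)[OF X(1) w]] vH, of r] by simp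
        qed
        have "(\<lambda>n. ip_norm ip (X n - w) * ip_norm ip v) \<longlonglongrightarrow> 0 * ip_norm ip v"
          using * by (intro tendsto_mult tendsto_const) auto
        then have "cmod (ip (\<pi> r w) v) \<le> 0"
          using LIMSEQ_le_const b by fastforce
        then show ?thesis by simp
      qed
      then show "w \<in> N" using * by (simp add: N_def)
    qed
    then have "v \<in> N" using v unfolding K_def by blast
    then have "ip (\<pi> 0 v) v = 0" unfolding N_def by blast
    then show False using ip_pos[OF hs vH nz] p0[OF vH] by simp
  qed
  have inj: "inj_on V K"
    by (rule inj_onI) (metis KH Kdiff Vdiff eq_iff_diff_eq_0 ker subsetD)
  define U where "U = inv_into K V"
  have UV: "U (V v) = v" if "v \<in> K" for v
    using inj that by (simp add: U_def)
  define S where "S = \<lparr>hspace = V ` K, hip = (\<lambda>f g. ip (U f) (U g)), act = (\<lambda>r f. V (\<pi> r (U f)))\<rparr>"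
  have Uadd: "U (V u + V v) = u + v" if "u \<in> K" "v \<in> K" for u v
    using UV[OF Kadd[OF that]] Vadd that KH by (metis subsetD)
  have Udiff: "U (V u - V v) = u - v" if "u \<in> K" "v \<in> K" for u v
    using UV[OF Kdiff[OF that]] Vdiff that KH by (metis subsetD)
  have Uscale: "U (fscale c (V v)) = fscale c v" if "v \<in> K" for c v
    using UV[OF Kscale[OF that]] Vscale that KH by (metis subsetD)
  have V0: "V 0 = 0" using Vdiff[OF \<xi>H \<xi>H] by simp
  have KinH: "v \<in> K \<Longrightarrow> v \<in> H" for v using KH by blast
  have sub: "fscale.subspace (V ` K)"
    unfolding fscale.subspace_def
  proof (intro conjI ballI allI)
    show "0 \<in> V ` K" using V0 K0 by (metis imageI)
    fix f assume "f \<in> V ` K"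
    then obtain u where u: "u \<in> K" "f = V u" by blast
    show "fscale c f \<in> V ` K" for c
      using u Vscale[OF KinH] Kscale by (metis imageI)
    fix g assume "g \<in> V ` K"
    then obtain v where v: "v \<in> K" "g = V v" by blast
    show "f + g \<in> V ` K"
      using u v Vadd[OF KinH KinH] Kadd by (metis imageI)
  qed
  have complete: "\<exists>f\<in>V ` K. (\<lambda>n. ip_norm (hip S) (X n - f)) \<longlonglongrightarrow> 0"
    if X: "\<And>n::nat. X n \<in> V ` K"
      and C: "\<And>e. e > 0 \<Longrightarrow> \<exists>N. \<forall>m\<ge>N. \<forall>n\<ge>N. ip_norm (hip S) (X m - X n) < e" for X
  proof -
    have "\<forall>n. \<exists>u. u \<in> K \<and> X n = V u" using X by blast
    then obtain Y where Y: "\<And>n. Y n \<in> K" "\<And>n. X n = V (Y n)" by metis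
    have "ip_norm (hip S) (X m - X n) = ip_norm ip (Y m - Y n)" for m n
      using Y by (simp add: ip_norm_def S_def Udiff)
    then obtain v where v: "v \<in> H" "(\<lambda>n. ip_norm ip (Y n - v)) \<longlonglongrightarrow> 0"
      using hilbert_complete[OF hs, of Y] C Y KinH by auto
    have vK: "v \<in> K" using Kclosed[OF Y(1) v] .
    have "ip_norm (hip S) (X n - V v) = ip_norm ip (Y n - v)" for n
      using Y vK by (simp add: ip_norm_def S_def Udiff)
    then show ?thesis using v vK by (intro bexI[of _ "V v"]) auto
  qed
  have pos: "Re (hip S f f) > 0" if "f \<in> V ` K" "f \<noteq> 0" for f
  proof -
    from that obtain v where v: "v \<in> K" "f = V v" by blast
    then have "v \<noteq> 0" using that V0 by metis
    then show ?thesis using v ip_pos[OF hs] KinH by (simp add: S_def UV)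
  qed
  have comm: "hip S g f = cnj (hip S f g)" if "f \<in> V ` K" "g \<in> V ` K" for f g
  proof -
    from that obtain u v where *: "u \<in> K" "f = V u" "v \<in> K" "g = V v" by blast
    show ?thesis using ip_commute[OF hs, of u v] * KinH by (simp only: S_def UV unirep.simps)
  qed
  have add: "hip S (f + g) h = hip S f h + hip S g h"
    if "f \<in> V ` K" "g \<in> V ` K" "h \<in> V ` K" for f g h
    using that by (auto simp: S_def UV Uadd ip_add_left[OF hs] KinH)
  have scale: "hip S (fscale c f) g = c * hip S f g" if "f \<in> V ` K" "g \<in> V ` K" for c f g
    using that by (auto simp: S_def UV Uscale ip_scale_left[OF hs] KinH)
  have space: "hspace S = V ` K" by (simp add: S_def)
  have "hilbert_space (hspace S) (hip S)"
    unfolding hilbert_space_def space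
  proof (intro conjI allI impI ballI)
    fix X :: "nat \<Rightarrow> 'g \<Rightarrow> complex"
    assume "(\<forall>n. X n \<in> V ` K) \<and>
      (\<forall>e>0. \<exists>N. \<forall>m\<ge>N. \<forall>n\<ge>N. ip_norm (hip S) (X m - X n) < e)"
    then show "\<exists>f\<in>V ` K. (\<lambda>n. ip_norm (hip S) (X n - f)) \<longlonglongrightarrow> 0"
      using complete[of X] by blast
  qed (fact sub add scale comm pos)+
  moreover have "unitary_on (hspace S) (hip S) (act S r)" for r
  proof -
    have "V u \<in> act S r ` V ` K" if "u \<in> K" for u
    proof -
      have "\<pi> r (\<pi> (- r) u) = u" using pplus[of u r "- r"] p0 that KinH by simp
      then have "act S r (V (\<pi> (- r) u)) = V u"
        using that by (simp add: S_def UV Kpi)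
      then show ?thesis using that Kpi by (metis imageI)
    qed
    moreover have "act S r (V u) \<in> V ` K" if "u \<in> K" for u
      using that by (simp add: S_def UV Kpi)
    ultimately have "act S r ` V ` K = V ` K" by blast
    then show ?thesis
      unfolding unitary_on_def
      by (auto simp: S_def UV Uadd Uscale Kpi pip padd pscale Vadd Vscale KinH pH)
  qed
  moreover have "((\<lambda>r. hnorm S (act S r f - act S s f)) \<longlongrightarrow> 0) (at s)" if "f \<in> V ` K" for f s
  proof -
    from that obtain u where u: "u \<in> K" "f = V u" by blast
    have "hnorm S (act S r f - act S s f) = ip_norm ip (\<pi> r u - \<pi> s u)" for r
      using u by (simp add: ip_norm_def S_def UV Udiff Kpi)
    then show ?thesis using pcont[of u s] u KinH by simp
  qed
  ultimately have "unitary_rep S"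
    unfolding unitary_rep_def
    by (auto simp: S_def UV Kpi p0 pplus KinH)
  moreover have "U ` hspace S \<subseteq> hspace R" "\<xi> \<in> U ` hspace S"
    using KH \<xi>K by (auto simp: S_def UV H_def image_image)
  ultimately show ?thesis
    by (rule that) (auto simp: S_def UV Uadd Uscale Kpi simp flip: ip_def \<pi>_def)
qed

definition fourier_stieltjes :: "('g::topological_group_add \<Rightarrow> complex) set"
  where "fourier_stieltjes =
    {matrix_coeff R \<xi> \<eta> | (R :: ('g, 'g) unirep) \<xi> \<eta>.
       unitary_rep R \<and> \<xi> \<in> hspace R \<and> \<eta> \<in> hspace R}"

definition P1 :: "('g::topological_group_add \<Rightarrow> complex) set"
  where "P1 =
    {matrix_coeff R \<xi> \<xi> | (R :: ('g, 'g) unirep) \<xi>.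
       unitary_rep R \<and> \<xi> \<in> hspace R \<and> hnorm R \<xi> = 1}"

text \<open>
  $C^*(G)$ is the norm closure of $L^1(G)$ in the direct sum of all representations. An operator
  on the direct sum that is diagonal with respect to the summands is given as the family of its
  components, normalised to be \<open>0\<close> outside the Hilbert spaces.
\<close>

type_synonym 'g op_family = "('g, 'g) unirep \<Rightarrow> ('g \<Rightarrow> complex) \<Rightarrow> ('g \<Rightarrow> complex)"

text \<open>The component at \<open>R\<close> is the weak integral of \<open>f r * act R r\<close>.\<close>

definition l1_embed :: "'g::topological_group_add measure \<Rightarrow> ('g \<Rightarrow> complex) \<Rightarrow> 'g op_family"
  where "l1_embed \<mu> f = (\<lambda>R v.
    if unitary_rep R \<and> v \<in> hspace R
    then THE w. w \<in> hspace R \<and>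
      (\<forall>u\<in>hspace R. hip R w u = (LINT r|\<mu>. f r * hip R (act R r v) u))
    else 0)"

definition cstar_norm :: "'g::topological_group_add op_family \<Rightarrow> real"
  where "cstar_norm x =
    Sup {hnorm R (x R v) | R v. unitary_rep R \<and> v \<in> hspace R \<and> hnorm R v \<le> 1}"

definition group_cstar :: "'g::topological_group_add measure \<Rightarrow> 'g op_family set"
  where "group_cstar \<mu> = {x.
    (\<forall>R v. unitary_rep R \<and> v \<in> hspace R \<longrightarrow> x R v \<in> hspace R) \<and>
    (\<forall>R v. \<not> (unitary_rep R \<and> v \<in> hspace R) \<longrightarrow> x R v = 0) \<and>
    (\<forall>e>0. \<exists>f. integrable \<mu> f \<and>
      (\<forall>R v. unitary_rep R \<and> v \<in> hspace R \<longrightarrow>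
        hnorm R (x R v - l1_embed \<mu> f R v) \<le> e * hnorm R v))}"

definition cstar_mult :: "'g op_family \<Rightarrow> 'g op_family \<Rightarrow> 'g op_family"
  where "cstar_mult x y = (\<lambda>R v. x R (y R v))"

definition cstar_adj :: "'g::topological_group_add op_family \<Rightarrow> 'g op_family"
  where "cstar_adj x = (\<lambda>R v.
    if unitary_rep R \<and> v \<in> hspace R
    then THE w. w \<in> hspace R \<and> (\<forall>u\<in>hspace R. hip R w u = hip R v (x R u))
    else 0)"

definition cstar_positive :: "'g::topological_group_add measure \<Rightarrow> 'g op_family \<Rightarrow> bool"
  where "cstar_positive \<mu> x \<longleftrightarrow> (\<exists>y\<in>group_cstar \<mu>. x = cstar_mult (cstar_adj y) y)"

text \<open>
  For \<open>\<phi>\<close> in the Fourier--Stieltjes algebra, \<open>\<lambda>x. cstar_pair \<mu> x \<phi>\<close> is the norm continuous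
  extension to $C^*(G)$ of the functional given on $L^1(G)$ by integration against \<open>\<phi>\<close>.
\<close>

definition cstar_pair ::
    "'g::topological_group_add measure \<Rightarrow> 'g op_family \<Rightarrow> ('g \<Rightarrow> complex) \<Rightarrow> complex"
  where "cstar_pair \<mu> x \<phi> = (THE c. \<forall>F.
    (\<forall>n. integrable \<mu> (F n)) \<and>
    (\<lambda>n. cstar_norm (x - l1_embed \<mu> (F n))) \<longlonglongrightarrow> 0 \<longrightarrow>
    (\<lambda>n. LINT r|\<mu>. F n r * \<phi> r) \<longlonglongrightarrow> c)"

definition cstar_act ::
    "'g::topological_group_add measure \<Rightarrow> ('g \<Rightarrow> complex) \<Rightarrow> 'g op_family \<Rightarrow> 'g op_family"
  where "cstar_act \<mu> \<rho> x = (THE y. y \<in> group_cstar \<mu> \<and>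
    (\<forall>\<sigma>\<in>fourier_stieltjes. cstar_pair \<mu> y \<sigma> = cstar_pair \<mu> x (\<lambda>r. \<rho> r * \<sigma> r)))"

definition pd_irreducible ::
    "'g::topological_group_add measure \<Rightarrow> ('g \<Rightarrow> complex) \<Rightarrow> bool"
  where "pd_irreducible \<mu> \<rho> \<longleftrightarrow>
    (\<forall>x\<in>group_cstar \<mu>. cstar_positive \<mu> x \<and> x \<noteq> 0 \<longrightarrow>
      (\<exists>n\<ge>1. cstar_pair \<mu> x (\<lambda>r. \<rho> r ^ n) \<noteq> 0))"

end

theory Submission
  imports Defs
begin

text \<open>
  Multiplication by \<open>\<rho>\<close> is contractive on $C^*(G)$, by tensor products of representations, and
  agrees with pointwise multiplication on $L^1(G)$. If $|\<rho>| < 1$ almost everywhere on the sets of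
  finite measure then \<open>\<rho> ^ n * f\<close> tends to \<open>0\<close> in $L^1$ for every integrable \<open>f\<close>, by dominated
  convergence, and the claim follows by density. Otherwise Steinhaus' theorem shows that the
  subgroup \<open>H = {r. cmod (\<rho> r) = 1}\<close>, on which \<open>\<rho>\<close> is a character, is open. There is then a
  nonzero \<open>f\<close> supported in \<open>H\<close> that is annihilated by all \<open>\<rho> ^ n\<close> with \<open>n \<ge> 1\<close>, and the positive
  element \<open>f\<^sup>* * f\<close> contradicts irreducibility. If \<open>\<rho> s = 1\<close> for some \<open>s \<noteq> 0\<close>, one takes the
  difference of the indicator of a small compact neighbourhood of \<open>0\<close> and of its translate by
  \<open>s\<close>. If there is no such \<open>s\<close> then \<open>H\<close> is a circle, because it is not discrete, and its
  indicator is orthogonal to all nontrivial characters.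
\<close>

section \<open>Hilbert spaces\<close>

text \<open>The definitions range over representations with index type \<open>'g\<close>, while
  tensor products and the regular representation live naturally over other types. They are built as
  reproducing kernel Hilbert spaces over a set on which the group acts, and
  \<open>coeff_realization\<close> carries their coefficients back to \<open>'g\<close>.

  Irreducibility is contradicted as follows. The pairing of \<open>f\<^sup>* * f\<close> with
  \<open>\<rho> ^ n\<close> is the squared norm of \<open>f\<close> applied to the unit vector that
  defines \<open>\<rho> ^ n\<close>. Where |\<rho>| = 1 this vector is an eigenvector of the group
  element, so \<open>f\<close> multiplies it by the integral of \<open>f r * \<rho> r ^ n\<close>,
  and annihilation of all powers is a linear condition on \<open>f\<close>. It remains to see that
  the product belongs to the group C*-algebra and that it is nonzero; the latter takes one
  representation in which \<open>f\<close> has a nonzero coefficient.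

  Non-discreteness supplies arbitrarily small nonzero elements of \<open>H\<close>. If
  \<open>{0}\<close> were open and equal to \<open>H\<close>, a function supported in
  \<open>H\<close> and annihilated by \<rho> would vanish.\<close>

lemma ip_add_right:
  assumes "hilbert_space H ip" "u \<in> H" "v \<in> H" "w \<in> H"
  shows "ip w (u + v) = ip w u + ip w v"
  using ip_add_left[OF assms] ip_commute[OF assms(1)] hilbert_add assms by (metis complex_cnj_add)

lemma ip_norm_add_scale_square:
  assumes H: "hilbert_space H ip" and u: "u \<in> H" and v: "v \<in> H"
  shows "(ip_norm ip (u + fscale c v))\<^sup>2
    = (ip_norm ip u)\<^sup>2 + 2 * Re (cnj c * ip u v) + (cmod c)\<^sup>2 * (ip_norm ip v)\<^sup>2"
proof -
  have cv: "fscale c v \<in> H" using hilbert_scale[OF H] v by blast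
  have "ip (u + fscale c v) (u + fscale c v)
      = ip u u + cnj c * ip u v + cnj (cnj c * ip u v) + c * cnj c * ip v v"
    using u v cv ip_commute[OF H u v]
    by (simp add: ip_add_left[OF H] ip_add_right[OF H] hilbert_add[OF H] ip_scale_left[OF H]
        ip_scale_right[OF H] algebra_simps)
  moreover have "c * cnj c * ip v v = of_real ((cmod c)\<^sup>2 * (ip_norm ip v)\<^sup>2)"
    using ip_self_real[OF H v] ip_norm_square[OF H v]
    by (simp only: of_real_mult complex_norm_square)
  ultimately show ?thesis
    using u cv by (simp add: ip_norm_square[OF H] hilbert_add[OF H])
qed

lemma ip_norm_scale:
  assumes "hilbert_space H ip" "v \<in> H"
  shows "ip_norm ip (fscale c v) = cmod c * ip_norm ip v"
proof -
  have "(ip_norm ip (0 + fscale c v))\<^sup>2 = (cmod c * ip_norm ip v)\<^sup>2"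
    unfolding ip_norm_add_scale_square[OF assms(1) hilbert_zero[OF assms(1)] assms(2)]
    using assms ip_zero_left[OF assms(1) hilbert_zero[OF assms(1)]]
    by (simp add: ip_norm_def ip_zero_left[OF assms(1)] power_mult_distrib)
  then show ?thesis
    using assms by (simp add: ip_norm_nonneg hilbert_scale power2_eq_iff_nonneg)
qed

lemma ip_norm_zero: "hilbert_space H ip \<Longrightarrow> ip_norm ip 0 = 0"
  by (simp add: ip_norm_def ip_zero_left hilbert_zero)

lemma ip_zero_right: "hilbert_space H ip \<Longrightarrow> v \<in> H \<Longrightarrow> ip v 0 = 0"
  using ip_zero_left ip_commute hilbert_zero by (metis complex_cnj_zero)

lemma ip_norm_eq_0_iff:
  assumes "hilbert_space H ip" "v \<in> H"
  shows "ip_norm ip v = 0 \<longleftrightarrow> v = 0"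
  using assms ip_pos[OF assms(1), of v] by (auto simp: ip_norm_zero) (auto simp: ip_norm_def)

text \<open>Weak integrals and adjoints are known only through their inner products. Testing such a
  vector against itself and dividing by its norm bounds it.\<close>

lemma ip_norm_le_if_ip_le:
  assumes H: "hilbert_space H ip" and w: "w \<in> H" and C: "0 \<le> C"
    and le: "cmod (ip w w) \<le> C * ip_norm ip w"
  shows "ip_norm ip w \<le> C"
proof (cases "ip_norm ip w = 0")
  case False
  then have pos: "ip_norm ip w > 0" using ip_norm_nonneg[OF H w] by simp
  have "ip_norm ip w * ip_norm ip w \<le> cmod (ip w w)"
    using ip_norm_square[OF H w] complex_Re_le_cmod[of "ip w w"] by (simp add: power2_eq_square)
  then have "ip_norm ip w * ip_norm ip w \<le> C * ip_norm ip w" using le by simp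
  then show ?thesis using pos by simp
qed (use C in simp)

lemma ip_extensionality:
  assumes H: "hilbert_space H ip" and "v \<in> H" "w \<in> H" and "\<And>u. u \<in> H \<Longrightarrow> ip v u = ip w u"
  shows "v = w"
proof -
  have d: "v - w \<in> H" using hilbert_diff assms by blast
  then have "ip (v - w) (v - w) = 0" using assms by (simp add: ip_diff_left[OF H])
  then show ?thesis using ip_norm_eq_0_iff[OF H d] by (simp add: ip_norm_def)
qed

lemma ip_tendsto_left:
  assumes H: "hilbert_space H ip" and X: "\<And>n. X n \<in> H" and w: "w \<in> H" and u: "u \<in> H"
    and lim: "((\<lambda>n. ip_norm ip (X n - w)) \<longlongrightarrow> 0) F"
  shows "((\<lambda>n. ip (X n) u) \<longlongrightarrow> ip w u) F"
proof -
  have "((\<lambda>n. ip_norm ip (X n - w) * ip_norm ip u) \<longlongrightarrow> 0) F"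
    using lim by (rule tendsto_mult_left_zero)
  then have "((\<lambda>n. ip (X n) u - ip w u) \<longlongrightarrow> 0) F"
    by (rule tendsto_0_le[where K=1])
       (use X w u ip_Cauchy_Schwarz[OF H hilbert_diff[OF H X w] u] in
        \<open>auto intro!: always_eventually order.trans[OF _ abs_ge_self] simp: ip_diff_left[OF H]\<close>)
  then show ?thesis using Lim_null by blast
qed

text \<open>The representing vector minimises the functional \<open>J\<close>: a minimising sequence
  converges by the parallelogram law, and the vanishing first variation at its limit is the claim.
  \<open>L\<close> is conjugate linear because it stands for the second argument of the inner
  product.\<close>

theorem hilbert_riesz:
  assumes H: "hilbert_space H ip"
    and add: "\<And>u v. u \<in> H \<Longrightarrow> v \<in> H \<Longrightarrow> L (u + v) = L u + L v"
    and scale: "\<And>c u. u \<in> H \<Longrightarrow> L (fscale c u) = cnj c * L u"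
    and bound: "\<And>u. u \<in> H \<Longrightarrow> cmod (L u) \<le> C * ip_norm ip u"
  obtains w where "w \<in> H" "\<And>u. u \<in> H \<Longrightarrow> ip w u = L u"
proof -
  define J where "J u = (ip_norm ip u)\<^sup>2 - 2 * Re (L u)" for u
  define m where "m = Inf (J ` H)"
  have H0: "0 \<in> H" by (rule hilbert_zero[OF H])
  have "- (C\<^sup>2) \<le> J u" if u: "u \<in> H" for u
  proof -
    have "Re (L u) \<le> C * ip_norm ip u"
      using bound[OF u] complex_Re_le_cmod order_trans by blast
    moreover have "0 \<le> (ip_norm ip u - C)\<^sup>2" by simp
    ultimately show ?thesis by (simp add: J_def power2_diff algebra_simps)
  qed
  then have bdd: "bdd_below (J ` H)" by (auto intro!: bdd_belowI)
  have m_le: "m \<le> J u" if "u \<in> H" for u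
    unfolding m_def using bdd that by (simp add: cInf_lower)
  have "\<exists>u\<in>H. J u < m + inverse (real (Suc n))" for n
    using cInf_lessD[of "J ` H" "m + inverse (real (Suc n))"] H0 unfolding m_def by auto
  then obtain X where XH: "\<And>n. X n \<in> H" and X: "\<And>n. J (X n) < m + inverse (real (Suc n))"
    by metis
  have Jexp: "J (u + fscale c v) = J u + 2 * Re (cnj c * (ip u v - L v)) + (cmod c)\<^sup>2 * (ip_norm ip v)\<^sup>2"
    if "u \<in> H" "v \<in> H" for u v c
    using that by (simp add: J_def ip_norm_add_scale_square[OF H] add scale hilbert_scale[OF H]
        right_diff_distrib)
  \<comment> \<open>The midpoint of \<open>u\<close> and \<open>v\<close> has value at least
    \<open>m\<close>, which bounds their distance as in the parallelogram law.\<close>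
  have par: "(ip_norm ip (u - v))\<^sup>2 \<le> 2 * (J u - m) + 2 * (J v - m)" if u: "u \<in> H" and v: "v \<in> H" for u v
  proof -
    have d: "u - v \<in> H" using hilbert_diff[OF H] u v by blast
    have e: "v + fscale 1 (u - v) = u" "v + fscale (1/2) (u - v) \<in> H"
      using hilbert_add[OF H v hilbert_scale[OF H d]] by (simp_all add: fun_eq_iff fscale_def[of 1])
    have "J u = J v + 2 * Re (ip v (u - v) - L (u - v)) + (ip_norm ip (u - v))\<^sup>2"
      using Jexp[OF v d, of 1] e by simp
    moreover have "m \<le> J v + Re (ip v (u - v) - L (u - v)) + (ip_norm ip (u - v))\<^sup>2 / 4"
      using m_le[OF e(2)] Jexp[OF v d, of "1/2"] by (simp add: power2_eq_square norm_divide diff_divide_distrib)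
    ultimately show ?thesis by simp
  qed
  have "\<exists>N. \<forall>m\<ge>N. \<forall>n\<ge>N. ip_norm ip (X m - X n) < e" if e: "e > 0" for e
  proof -
    obtain N where N: "4 * inverse (real (Suc N)) < e\<^sup>2"
      using reals_Archimedean[of "e\<^sup>2 / 4"] e by (auto simp: mult.commute)
    have "ip_norm ip (X i - X j) < e" if "i \<ge> N" "j \<ge> N" for i j
    proof -
      have "inverse (real (Suc i)) \<le> inverse (real (Suc N))" "inverse (real (Suc j)) \<le> inverse (real (Suc N))"
        using that by (auto intro!: le_imp_inverse_le)
      then have "(ip_norm ip (X i - X j))\<^sup>2 < e\<^sup>2"
        using par[OF XH XH, of i j] X[of i] X[of j] N by (smt (verit))
      then show ?thesis using e power2_less_imp_less by (meson less_imp_le)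
    qed
    then show ?thesis by blast
  qed
  from hilbert_complete[OF H XH this] obtain w
    where w: "w \<in> H" and lim: "(\<lambda>n. ip_norm ip (X n - w)) \<longlonglongrightarrow> 0" by auto
  have re: "Re (ip w u) = Re (L u)" if u: "u \<in> H" for u
  proof (rule ccontr)
    assume ne: "Re (ip w u) \<noteq> Re (L u)"
    define \<delta> where "\<delta> = Re (ip w u) - Re (L u)"
    have l: "(\<lambda>n. Re (ip (X n) u - L u)) \<longlonglongrightarrow> \<delta>"
      unfolding \<delta>_def by (auto intro!: tendsto_intros ip_tendsto_left[OF H XH w u lim])
    \<comment> \<open>\<open>X n\<close> minimises \<open>J\<close> up to
      \<open>inverse (real (Suc n))\<close>, so it satisfies the variational inequality up to this
      error, which vanishes in the limit.\<close>
    have ineq: "0 \<le> 2 * t * \<delta> + t\<^sup>2 * (ip_norm ip u)\<^sup>2" for t :: real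
    proof (rule LIMSEQ_le_const)
      show "(\<lambda>n. inverse (real (Suc n)) + 2 * t * Re (ip (X n) u - L u) + t\<^sup>2 * (ip_norm ip u)\<^sup>2)
          \<longlonglongrightarrow> 2 * t * \<delta> + t\<^sup>2 * (ip_norm ip u)\<^sup>2"
        using tendsto_add[OF tendsto_add[OF LIMSEQ_inverse_real_of_nat
            tendsto_mult[OF tendsto_const[of "2 * t"] l]] tendsto_const] by simp
      have "0 \<le> inverse (real (Suc n)) + 2 * t * Re (ip (X n) u - L u) + t\<^sup>2 * (ip_norm ip u)\<^sup>2" for n
        using m_le[OF hilbert_add[OF H XH[of n] hilbert_scale[OF H u, of "of_real t"]]] X[of n]
          Jexp[OF XH[of n] u, of "of_real t"] by (simp add: algebra_simps)
      then show "\<exists>N. \<forall>n\<ge>N. 0 \<le> inverse (real (Suc n)) + 2 * t * Re (ip (X n) u - L u)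
          + t\<^sup>2 * (ip_norm ip u)\<^sup>2" by blast
    qed
    \<comment> \<open>Up to the added 1, which keeps \<open>b\<close> positive for
      \<open>u = 0\<close>, the value \<open>- \<delta> / b\<close> minimises the quadratic in
      \<open>ineq\<close>.\<close>
    define b where "b = (ip_norm ip u)\<^sup>2 + 1"
    have b: "b > 0" by (simp add: b_def add_nonneg_pos)
    have "0 \<le> 2 * (- \<delta> / b) * \<delta> + (- \<delta> / b)\<^sup>2 * b"
      using ineq[of "- \<delta> / b"] by (simp add: b_def algebra_simps) (smt (verit) zero_le_power2)
    also have "\<dots> = - (\<delta>\<^sup>2 / b)" using b by (simp add: power2_eq_square field_simps)
    finally show False using b ne by (simp add: \<delta>_def divide_le_0_iff)
  qed
  have "ip w u = L u" if u: "u \<in> H" for u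
  proof (rule complex_eqI)
    show "Re (ip w u) = Re (L u)" by (rule re[OF u])
    \<comment> \<open>Multiplying \<open>u\<close> by \<i> turns the imaginary part into a real
      part.\<close>
    show "Im (ip w u) = Im (L u)"
      using re[OF hilbert_scale[OF H u, of \<i>]] u w by (simp add: ip_scale_right[OF H] scale)
  qed
  with w show ?thesis by (rule that)
qed

section \<open>Reproducing kernel Hilbert spaces\<close>

text \<open>Lists of coefficients and points serve as formal linear combinations of points.\<close>

definition kform :: "('x \<Rightarrow> 'x \<Rightarrow> complex) \<Rightarrow> (complex \<times> 'x) list \<Rightarrow> (complex \<times> 'x) list \<Rightarrow> complex"
  where "kform k xs ys = (\<Sum>(c, x)\<leftarrow>xs. \<Sum>(d, y)\<leftarrow>ys. c * cnj d * k x y)"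

definition psd_kernel :: "('x \<Rightarrow> 'x \<Rightarrow> complex) \<Rightarrow> bool"
  where "psd_kernel k \<longleftrightarrow> (\<forall>x y. k y x = cnj (k x y)) \<and> (\<forall>xs. 0 \<le> Re (kform k xs xs))"

definition kscale :: "complex \<Rightarrow> (complex \<times> 'x) list \<Rightarrow> (complex \<times> 'x) list"
  where "kscale c = map (\<lambda>(d, x). (c * d, x))"

definition kdiff :: "(complex \<times> 'x) list \<Rightarrow> (complex \<times> 'x) list \<Rightarrow> (complex \<times> 'x) list"
  where "kdiff xs ys = xs @ kscale (- 1) ys"

lemma kform_Nil [simp]: "kform k [] ys = 0" "kform k xs [] = 0"
  by (simp_all add: kform_def case_prod_unfold)

lemma kform_append_left [simp]: "kform k (xs @ ys) zs = kform k xs zs + kform k ys zs"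
  by (simp add: kform_def)

lemma kform_append_right [simp]: "kform k zs (xs @ ys) = kform k zs xs + kform k zs ys"
  by (simp add: kform_def case_prod_unfold sum_list_addf)

lemma kform_singleton: "kform k [(c, x)] [(d, y)] = c * cnj d * k x y"
  by (simp add: kform_def)

lemma kform_Cons_left: "kform k (p # xs) zs = kform k [p] zs + kform k xs zs"
  using kform_append_left[of k "[p]" xs zs] by simp

lemma kform_Cons_right: "kform k zs (p # xs) = kform k zs [p] + kform k zs xs"
  using kform_append_right[of k zs "[p]" xs] by simp

lemma kform_scale_left [simp]: "kform k (kscale c xs) ys = c * kform k xs ys"
  by (simp add: kform_def kscale_def case_prod_unfold o_def mult.assoc flip: sum_list_const_mult)

lemma kform_scale_right [simp]: "kform k xs (kscale c ys) = cnj c * kform k xs ys"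
  by (simp add: kform_def kscale_def case_prod_unfold o_def ac_simps flip: sum_list_const_mult)

lemma kform_diff_left [simp]: "kform k (kdiff xs ys) zs = kform k xs zs - kform k ys zs"
  by (simp add: kdiff_def)

lemma kform_diff_right [simp]: "kform k zs (kdiff xs ys) = kform k zs xs - kform k zs ys"
  by (simp add: kdiff_def)

lemma kform_Cons_right_expand:
  "kform k xs (p # ys) = cnj (fst p) * kform k xs [(1, snd p)] + kform k xs ys"
  using kform_scale_right[of k xs "fst p" "[(1, snd p)]", unfolded kscale_def]
  by (simp add: kform_Cons_right[of k xs p ys])

locale psd_kernel_space =
  fixes k :: "'x \<Rightarrow> 'x \<Rightarrow> complex"
  assumes psd: "psd_kernel k"
begin

text \<open>Only a seminorm on lists. Null combinations disappear when a list is replaced by the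
  function that it defines, see \<open>ev\<close>.\<close>

definition knorm :: "(complex \<times> 'x) list \<Rightarrow> real"
  where "knorm xs = sqrt (Re (kform k xs xs))"

lemma kernel_commute: "k y x = cnj (k x y)"
  using psd unfolding psd_kernel_def by blast

lemma kform_commute: "kform k ys xs = cnj (kform k xs ys)"
proof (induction xs arbitrary: ys)
  case (Cons p xs)
  have *: "kform k ys [p] = cnj (kform k [p] ys)"
  proof (induction ys)
    case (Cons q ys)
    have "kform k [q] [p] = cnj (kform k [p] [q])"
      using kernel_commute[of "snd q" "snd p"]
      by (cases p; cases q) (simp add: kform_singleton)
    then show ?case
      by (simp only: kform_Cons_right[of k "[p]" q ys] kform_Cons_left[of k q ys] Cons complex_cnj_add)
  qed simp
  show ?case
    by (simp only: kform_Cons_right[of k ys p xs] kform_Cons_left[of k p xs] * Cons[of ys] complex_cnj_add)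
qed simp

lemma kform_nonneg: "0 \<le> Re (kform k xs xs)"
  using psd by (simp add: psd_kernel_def)

lemma knorm_nonneg [simp]: "0 \<le> knorm xs"
  by (simp add: knorm_def kform_nonneg)

lemma knorm_square: "(knorm xs)\<^sup>2 = Re (kform k xs xs)"
  by (simp add: knorm_def kform_nonneg)

lemma knorm_add_scale_square:
  "(knorm (xs @ kscale c ys))\<^sup>2
    = (knorm xs)\<^sup>2 + 2 * Re (cnj c * kform k xs ys) + (cmod c)\<^sup>2 * (knorm ys)\<^sup>2"
proof -
  have "kform k (xs @ kscale c ys) (xs @ kscale c ys)
      = kform k xs xs + cnj c * kform k xs ys + cnj (cnj c * kform k xs ys) + c * cnj c * kform k ys ys"
    using kform_commute[of ys xs] by (simp add: algebra_simps)
  moreover have "Re (c * cnj c * kform k ys ys) = (cmod c)\<^sup>2 * (knorm ys)\<^sup>2"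
    unfolding complex_norm_square[symmetric] Re_complex_of_real by (simp add: knorm_square)
  ultimately show ?thesis
    unfolding knorm_square by (simp only: plus_complex.sel cnj.sel mult_2 add.assoc)
qed

lemma kform_Cauchy_Schwarz: "cmod (kform k xs ys) \<le> knorm xs * knorm ys"
proof -
  define z where "z = kform k xs ys"
  define A where "A = (knorm xs)\<^sup>2"
  define B where "B = (knorm ys)\<^sup>2"
  have AB: "A \<ge> 0" "B \<ge> 0" by (simp_all add: A_def B_def)
  \<comment> \<open>Moving in the direction \<open>- t * z\<close> makes the cross term real and
    leaves a quadratic in \<open>t\<close>.\<close>
  have *: "0 \<le> A - 2 * t * (cmod z)\<^sup>2 + t\<^sup>2 * (cmod z)\<^sup>2 * B" for t :: real
  proof -
    have "cnj (of_real (- t) * z) * z = of_real (- t * (cmod z)\<^sup>2)"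
      unfolding of_real_mult complex_norm_square by simp
    then have "Re (cnj (of_real (- t) * z) * z) = - t * (cmod z)\<^sup>2"
      by (simp only: Re_complex_of_real)
    then show ?thesis
      using zero_le_power2[of "knorm (xs @ kscale (of_real (- t) * z) ys)"]
      unfolding knorm_add_scale_square z_def[symmetric] A_def[symmetric] B_def[symmetric]
      by (simp add: norm_mult power_mult_distrib)
  qed
  have "(cmod z)\<^sup>2 \<le> A * B"
  proof (cases "B = 0")
    case True
    \<comment> \<open>With \<open>B = 0\<close> the bound is linear in \<open>t\<close>, and at
      \<open>t = (A + 1) / (cmod z)\<^sup>2\<close> its right side would be
      \<open>A - 2 * (A + 1)\<close>, which is negative.\<close>
    have "z = 0"
    proof (rule ccontr)
      assume "z \<noteq> 0"
      then have "2 * ((A + 1) / (cmod z)\<^sup>2) * (cmod z)\<^sup>2 = 2 * (A + 1)" by simp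
      then show False
        using *[of "(A + 1) / (cmod z)\<^sup>2"] AB True by simp
    qed
    then show ?thesis using True by simp
  next
    case False
    then have "B > 0" using AB by simp
    \<comment> \<open>\<open>1 / B\<close> minimises the quadratic.\<close>
    then show ?thesis using *[of "1 / B"] by (simp add: field_simps power2_eq_square)
  qed
  then have "(cmod z)\<^sup>2 \<le> (knorm xs * knorm ys)\<^sup>2" by (simp add: A_def B_def power_mult_distrib)
  then show ?thesis unfolding z_def by (rule power2_le_imp_le) simp
qed

lemma knorm_triangle: "knorm (xs @ ys) \<le> knorm xs + knorm ys"
proof (rule power2_le_imp_le)
  have "(knorm (xs @ ys))\<^sup>2 = (knorm xs)\<^sup>2 + 2 * Re (kform k xs ys) + (knorm ys)\<^sup>2"
    using kform_commute[of ys xs] by (simp add: knorm_square)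
  also have "\<dots> \<le> (knorm xs + knorm ys)\<^sup>2"
    using kform_Cauchy_Schwarz[of xs ys] complex_Re_le_cmod[of "kform k xs ys"]
    by (simp add: power2_sum)
  finally show "(knorm (xs @ ys))\<^sup>2 \<le> (knorm xs + knorm ys)\<^sup>2" .
qed simp

text \<open>Lists are never reduced; for instance \<open>kdiff xs xs\<close> is not
  \<open>[]\<close>. Combinations are therefore compared through their forms against all
  lists.\<close>

lemma knorm_cong: "(\<And>zs. kform k xs zs = kform k ys zs) \<Longrightarrow> knorm xs = knorm ys"
  unfolding knorm_def by (metis kform_commute)

lemma knorm_scale [simp]: "knorm (kscale c xs) = cmod c * knorm xs"
proof -
  have "kform k (kscale c xs) (kscale c xs) = (cmod c)\<^sup>2 *\<^sub>R kform k xs xs"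
    unfolding scaleR_conv_of_real complex_norm_square by simp
  then have "Re (kform k (kscale c xs) (kscale c xs)) = (cmod c * knorm xs)\<^sup>2"
    unfolding power_mult_distrib knorm_square by (simp only: scaleR_complex.sel)
  then show ?thesis by (simp add: knorm_def[of "kscale c xs"])
qed

lemma knorm_diff_triangle: "knorm (kdiff xs zs) \<le> knorm (kdiff xs ys) + knorm (kdiff ys zs)"
proof -
  have "knorm (kdiff xs zs) = knorm (kdiff xs ys @ kdiff ys zs)" by (rule knorm_cong) simp
  then show ?thesis using knorm_triangle by metis
qed

lemma knorm_reverse_triangle: "\<bar>knorm xs - knorm ys\<bar> \<le> knorm (kdiff xs ys)"
proof -
  have "knorm xs = knorm (kdiff xs ys @ ys)" "knorm ys = knorm (kscale (- 1) (kdiff xs ys) @ xs)"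
    by (rule knorm_cong; simp)+
  then show ?thesis
    using knorm_triangle[of "kdiff xs ys" ys] knorm_triangle[of "kscale (- 1) (kdiff xs ys)" xs]
    by simp
qed

definition kcauchy :: "(nat \<Rightarrow> (complex \<times> 'x) list) \<Rightarrow> bool"
  where "kcauchy X \<longleftrightarrow> (\<forall>e>0. \<exists>N. \<forall>m\<ge>N. \<forall>n\<ge>N. knorm (kdiff (X m) (X n)) < e)"

lemma kcauchyD: "kcauchy X \<Longrightarrow> e > 0 \<Longrightarrow> \<exists>N. \<forall>m\<ge>N. \<forall>n\<ge>N. knorm (kdiff (X m) (X n)) < e"
  by (simp add: kcauchy_def)

lemma kcauchy_bounded:
  assumes "kcauchy X" obtains B where "B > 0" "\<And>n. knorm (X n) \<le> B"
proof -
  have "Cauchy (\<lambda>n. knorm (X n))"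
    unfolding Cauchy_def dist_real_def
    using kcauchyD[OF assms] knorm_reverse_triangle by (meson order_le_less_trans)
  then obtain B where "B > 0" "\<And>n. norm (knorm (X n)) \<le> B"
    using Cauchy_Bseq BseqE by blast
  then show ?thesis using that by auto
qed

lemma kcauchy_const: "kcauchy (\<lambda>_. xs)"
proof -
  have "knorm (kdiff xs xs) = knorm []" by (rule knorm_cong) simp
  then have "knorm (kdiff xs xs) = 0" by (simp add: knorm_def)
  then show ?thesis by (simp add: kcauchy_def)
qed

lemma kcauchy_append:
  assumes "kcauchy X" "kcauchy Y" shows "kcauchy (\<lambda>n. X n @ Y n)"
  unfolding kcauchy_def
proof (intro allI impI)
  fix e :: real assume "e > 0"
  then obtain N1 N2 where N: "\<forall>m\<ge>N1. \<forall>n\<ge>N1. knorm (kdiff (X m) (X n)) < e / 2"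
      "\<forall>m\<ge>N2. \<forall>n\<ge>N2. knorm (kdiff (Y m) (Y n)) < e / 2"
    using kcauchyD[OF assms(1), of "e/2"] kcauchyD[OF assms(2), of "e/2"] by auto
  have "knorm (kdiff (X m @ Y m) (X n @ Y n)) < e" if "m \<ge> max N1 N2" "n \<ge> max N1 N2" for m n
  proof -
    have "knorm (kdiff (X m @ Y m) (X n @ Y n)) = knorm (kdiff (X m) (X n) @ kdiff (Y m) (Y n))"
      by (rule knorm_cong) simp
    also have "\<dots> \<le> knorm (kdiff (X m) (X n)) + knorm (kdiff (Y m) (Y n))"
      by (rule knorm_triangle)
    also have "\<dots> < e / 2 + e / 2" using N that by (intro add_strict_mono) auto
    finally show ?thesis by simp
  qed
  then show "\<exists>N. \<forall>m\<ge>N. \<forall>n\<ge>N. knorm (kdiff (X m @ Y m) (X n @ Y n)) < e" by blast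
qed

lemma kcauchy_scale:
  assumes "kcauchy X" shows "kcauchy (\<lambda>n. kscale c (X n))"
  unfolding kcauchy_def
proof (intro allI impI)
  fix e :: real assume e: "e > 0"
  have pos: "cmod c + 1 > 0" by (simp add: add_nonneg_pos)
  obtain N where N: "\<forall>m\<ge>N. \<forall>n\<ge>N. knorm (kdiff (X m) (X n)) < e / (cmod c + 1)"
    using kcauchyD[OF assms divide_pos_pos[OF e pos]] by blast
  have "knorm (kdiff (kscale c (X m)) (kscale c (X n))) < e" if "m \<ge> N" "n \<ge> N" for m n
  proof -
    have "knorm (kdiff (kscale c (X m)) (kscale c (X n))) = knorm (kscale c (kdiff (X m) (X n)))"
      by (rule knorm_cong) (simp add: algebra_simps)
    also have "\<dots> \<le> (cmod c + 1) * knorm (kdiff (X m) (X n))" by (simp add: algebra_simps)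
    finally have le: "knorm (kdiff (kscale c (X m)) (kscale c (X n))) \<le> (cmod c + 1) * knorm (kdiff (X m) (X n))" .
    have "knorm (kdiff (X m) (X n)) < e / (cmod c + 1)" using N that by blast
    then have "(cmod c + 1) * knorm (kdiff (X m) (X n)) < e"
      by (simp only: pos_less_divide_eq[OF pos] mult.commute)
    with le show ?thesis by simp
  qed
  then show "\<exists>N. \<forall>m\<ge>N. \<forall>n\<ge>N. knorm (kdiff (kscale c (X m)) (kscale c (X n))) < e" by blast
qed

lemma kcauchy_diff: "kcauchy X \<Longrightarrow> kcauchy Y \<Longrightarrow> kcauchy (\<lambda>n. kdiff (X n) (Y n))"
  unfolding kdiff_def by (intro kcauchy_append kcauchy_scale)

lemma kform_convergent:
  assumes X: "kcauchy X" and Y: "kcauchy Y"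
  shows "convergent (\<lambda>n. kform k (X n) (Y n))"
proof (rule Cauchy_convergent)
  obtain B where B: "B > 0" "\<And>n. knorm (X n) \<le> B" using kcauchy_bounded[OF X] by blast
  obtain C where C: "C > 0" "\<And>n. knorm (Y n) \<le> C" using kcauchy_bounded[OF Y] by blast
  show "Cauchy (\<lambda>n. kform k (X n) (Y n))"
    unfolding Cauchy_def
  proof (intro allI impI)
    fix e :: real assume "e > 0"
    then obtain N1 N2 where N: "\<forall>m\<ge>N1. \<forall>n\<ge>N1. knorm (kdiff (X m) (X n)) < e / (2 * C)"
      "\<forall>m\<ge>N2. \<forall>n\<ge>N2. knorm (kdiff (Y m) (Y n)) < e / (2 * B)"
      using kcauchyD[OF X, of "e/(2 * C)"] kcauchyD[OF Y, of "e/(2 * B)"] B C by auto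
    have "dist (kform k (X m) (Y m)) (kform k (X n) (Y n)) < e"
      if "m \<ge> max N1 N2" "n \<ge> max N1 N2" for m n
    proof -
      have "dist (kform k (X m) (Y m)) (kform k (X n) (Y n))
        = cmod (kform k (kdiff (X m) (X n)) (Y m) + kform k (X n) (kdiff (Y m) (Y n)))"
        by (simp add: dist_norm)
      also have "\<dots> \<le> knorm (kdiff (X m) (X n)) * knorm (Y m) + knorm (X n) * knorm (kdiff (Y m) (Y n))"
        by (rule order_trans[OF norm_triangle_ineq]) (intro add_mono kform_Cauchy_Schwarz)
      also have "\<dots> \<le> knorm (kdiff (X m) (X n)) * C + B * knorm (kdiff (Y m) (Y n))"
        using B C by (intro add_mono mult_left_mono mult_right_mono) auto
      also have "\<dots> < e / (2 * C) * C + B * (e / (2 * B))"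
        using N that B C by (intro add_strict_mono mult_strict_left_mono mult_strict_right_mono) auto
      also have "\<dots> = e" using B C by simp
      finally show ?thesis .
    qed
    then show "\<exists>M. \<forall>m\<ge>M. \<forall>n\<ge>M. dist (kform k (X m) (Y m)) (kform k (X n) (Y n)) < e" by blast
  qed
qed

text \<open>An element of the completion is encoded by its inner products with the points, not as a
  class of Cauchy sequences. The completion thus consists of functions, as \<open>unirep\<close>
  demands.\<close>

definition represents :: "(nat \<Rightarrow> (complex \<times> 'x) list) \<Rightarrow> ('x \<Rightarrow> complex) \<Rightarrow> bool"
  where "represents X F \<longleftrightarrow> kcauchy X \<and> (\<forall>y. (\<lambda>n. kform k (X n) [(1, y)]) \<longlonglongrightarrow> F y)"

definition rkhs :: "('x \<Rightarrow> complex) set"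
  where "rkhs = {F. \<exists>X. represents X F}"

text \<open>Independence of the chosen representatives is \<open>represents_ip\<close>.\<close>

definition rkhs_ip :: "('x \<Rightarrow> complex) \<Rightarrow> ('x \<Rightarrow> complex) \<Rightarrow> complex"
  where "rkhs_ip F G = lim (\<lambda>n. kform k ((SOME X. represents X F) n) ((SOME X. represents X G) n))"

abbreviation rkhs_norm :: "('x \<Rightarrow> complex) \<Rightarrow> real"
  where "rkhs_norm \<equiv> ip_norm rkhs_ip"

definition ev :: "(complex \<times> 'x) list \<Rightarrow> 'x \<Rightarrow> complex"
  where "ev xs = (\<lambda>y. kform k xs [(1, y)])"

lemma represents_cauchy: "represents X F \<Longrightarrow> kcauchy X"
  by (simp add: represents_def)

lemma represents_ev: "represents (\<lambda>_. xs) (ev xs)"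
  by (simp add: represents_def kcauchy_const ev_def)

lemma represents_add: "represents X F \<Longrightarrow> represents Y G \<Longrightarrow> represents (\<lambda>n. X n @ Y n) (F + G)"
  by (auto simp: represents_def kcauchy_append intro!: tendsto_intros)

lemma represents_scale: "represents X F \<Longrightarrow> represents (\<lambda>n. kscale c (X n)) (fscale c F)"
  by (auto simp: represents_def kcauchy_scale fscale_def intro!: tendsto_intros)

lemma represents_diff:
  "represents X F \<Longrightarrow> represents Y G \<Longrightarrow> represents (\<lambda>n. kdiff (X n) (Y n)) (F - G)"
  by (auto simp: represents_def kcauchy_diff intro!: tendsto_intros)

lemma represents_tendsto:
  assumes "represents X F"
  shows "(\<lambda>n. kform k (X n) ys) \<longlonglongrightarrow> (\<Sum>(d, y)\<leftarrow>ys. cnj d * F y)"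
proof (induction ys)
  case (Cons p ys)
  have "(\<lambda>n. cnj (fst p) * kform k (X n) [(1, snd p)]) \<longlonglongrightarrow> cnj (fst p) * F (snd p)"
    using assms by (auto simp: represents_def intro!: tendsto_intros)
  from tendsto_add[OF this Cons] show ?case
    by (simp add: kform_Cons_right_expand[of _ _ p ys] case_prod_unfold)
qed simp

text \<open>Freeze \<open>Y\<close> at a late index \<open>N\<close>: the form against the fixed
  list \<open>Y N\<close> is a finite sum of point evaluations, which tend to 0, and the rest is
  small by Cauchy-Schwarz because \<open>X\<close> is bounded. The completion inherits a
  well-defined inner product from this.\<close>

lemma represents_zero_tendsto:
  assumes X: "represents X 0" and Y: "kcauchy Y"
  shows "(\<lambda>n. kform k (X n) (Y n)) \<longlonglongrightarrow> 0"
proof (rule LIMSEQ_I)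
  fix e :: real assume e: "e > 0"
  obtain B where B: "B > 0" "\<And>n. knorm (X n) \<le> B"
    using kcauchy_bounded[OF represents_cauchy[OF X]] by blast
  obtain N where N: "\<forall>m\<ge>N. \<forall>n\<ge>N. knorm (kdiff (Y m) (Y n)) < e / (2 * B)"
    using kcauchyD[OF Y, of "e / (2 * B)"] B e by auto
  have "(\<Sum>(d, y)\<leftarrow>Y N. cnj d * (0 :: 'x \<Rightarrow> complex) y) = 0"
    by (simp add: case_prod_unfold)
  then have "(\<lambda>n. kform k (X n) (Y N)) \<longlonglongrightarrow> 0" using represents_tendsto[OF X, of "Y N"] by simp
  then obtain M where M: "\<And>n. n \<ge> M \<Longrightarrow> cmod (kform k (X n) (Y N)) < e / 2"
    using LIMSEQ_D[of _ 0 "e/2"] e by fastforce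
  have "cmod (kform k (X n) (Y n) - 0) < e" if n: "n \<ge> max M N" for n
  proof -
    have "cmod (kform k (X n) (kdiff (Y n) (Y N))) \<le> B * (e / (2 * B))"
      by (rule order_trans[OF kform_Cauchy_Schwarz mult_mono])
         (use N n B e in \<open>auto intro: less_imp_le\<close>)
    moreover have "B * (e / (2 * B)) = e / 2" using B by simp
    moreover have "kform k (X n) (Y n) = kform k (X n) (kdiff (Y n) (Y N)) + kform k (X n) (Y N)"
      by simp
    then have "cmod (kform k (X n) (Y n))
        \<le> cmod (kform k (X n) (kdiff (Y n) (Y N))) + cmod (kform k (X n) (Y N))"
      by (simp only: norm_triangle_ineq)
    moreover have "cmod (kform k (X n) (Y N)) < e / 2" using M[of n] n by simp
    ultimately show ?thesis by (simp only: diff_zero)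
  qed
  then show "\<exists>no. \<forall>n\<ge>no. cmod (kform k (X n) (Y n) - 0) < e" by blast
qed

text \<open>The difference of two representatives of one function represents 0, so exchanging them
  one argument at a time adds only terms that vanish by
  \<open>represents_zero_tendsto\<close>.\<close>

lemma represents_ip:
  assumes X: "represents X F" and Y: "represents Y G"
  shows "(\<lambda>n. kform k (X n) (Y n)) \<longlonglongrightarrow> rkhs_ip F G"
proof -
  define X' where "X' = (SOME X. represents X F)"
  define Y' where "Y' = (SOME X. represents X G)"
  have X': "represents X' F" unfolding X'_def by (rule someI[of "\<lambda>X. represents X F", OF X])
  have Y': "represents Y' G" unfolding Y'_def by (rule someI[of "\<lambda>X. represents X G", OF Y])
  have "(\<lambda>n. kform k (X' n) (Y' n)) \<longlonglongrightarrow> rkhs_ip F G"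
    unfolding rkhs_ip_def X'_def[symmetric] Y'_def[symmetric]
    using kform_convergent represents_cauchy X' Y' convergent_LIMSEQ_iff by blast
  moreover have "(\<lambda>n. kform k (kdiff (X n) (X' n)) (Y n)) \<longlonglongrightarrow> 0"
    using represents_diff[OF X X'] by (intro represents_zero_tendsto represents_cauchy[OF Y]) simp
  moreover have "(\<lambda>n. cnj (kform k (kdiff (Y n) (Y' n)) (X' n))) \<longlonglongrightarrow> cnj 0"
    using represents_diff[OF Y Y']
    by (intro tendsto_cnj represents_zero_tendsto represents_cauchy[OF X']) simp
  ultimately have "(\<lambda>n. kform k (X' n) (Y' n) + kform k (kdiff (X n) (X' n)) (Y n)
      + cnj (kform k (kdiff (Y n) (Y' n)) (X' n))) \<longlonglongrightarrow> rkhs_ip F G + 0 + cnj 0"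
    by (intro tendsto_add)
  moreover have "kform k (X' n) (Y' n) + kform k (kdiff (X n) (X' n)) (Y n)
      + cnj (kform k (kdiff (Y n) (Y' n)) (X' n)) = kform k (X n) (Y n)" for n
    unfolding kform_commute[symmetric] by simp
  ultimately show ?thesis by (simp only: add_0_right complex_cnj_zero)
qed

lemma represents_norm:
  assumes "represents X F" shows "(\<lambda>n. knorm (X n)) \<longlonglongrightarrow> rkhs_norm F"
  unfolding knorm_def ip_norm_def using represents_ip[OF assms assms] by (intro tendsto_intros)

lemma rkhs_ip_ev: "rkhs_ip (ev xs) (ev ys) = kform k xs ys"
  using represents_ip[OF represents_ev represents_ev] LIMSEQ_unique tendsto_const by blast

lemma rkhs_representative: "F \<in> rkhs \<Longrightarrow> \<exists>X. represents X F"
  by (simp add: rkhs_def)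

lemma ev_in_rkhs: "ev xs \<in> rkhs"
  using represents_ev by (auto simp: rkhs_def)

lemma rkhs_norm_triangle:
  assumes "F \<in> rkhs" "G \<in> rkhs" "K \<in> rkhs"
  shows "rkhs_norm (F - K) \<le> rkhs_norm (F - G) + rkhs_norm (G - K)"
proof -
  obtain X Y Z where "represents X F" "represents Y G" "represents Z K"
    using assms rkhs_representative by metis
  then show ?thesis
    using knorm_diff_triangle
    by (intro LIMSEQ_le[OF represents_norm[OF represents_diff] tendsto_add[OF
          represents_norm[OF represents_diff] represents_norm[OF represents_diff]]]) blast+
qed

lemma kcauchy_represents:
  assumes "kcauchy X" obtains F where "represents X F"
proof -
  have "\<forall>y. \<exists>z. (\<lambda>n. kform k (X n) [(1, y)]) \<longlonglongrightarrow> z"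
    using kform_convergent[OF assms kcauchy_const] by (simp add: convergent_def)
  then obtain F where "\<And>y. (\<lambda>n. kform k (X n) [(1, y)]) \<longlonglongrightarrow> F y" by metis
  then show ?thesis using that assms by (auto simp: represents_def)
qed

lemma represents_approx:
  assumes X: "represents X F" and e: "e > 0"
  shows "\<exists>N. \<forall>n\<ge>N. rkhs_norm (F - ev (X n)) \<le> e"
proof -
  obtain N where N: "\<forall>m\<ge>N. \<forall>n\<ge>N. knorm (kdiff (X m) (X n)) < e"
    using kcauchyD[OF represents_cauchy[OF X] e] by blast
  have "rkhs_norm (F - ev (X n)) \<le> e" if "n \<ge> N" for n
    by (rule LIMSEQ_le_const2[OF represents_norm[OF represents_diff[OF X represents_ev]]])
       (use N that in \<open>auto intro!: exI[of _ N] less_imp_le\<close>)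
  then show ?thesis by blast
qed

lemma rkhs_norm_minus_commute:
  assumes "F \<in> rkhs" "G \<in> rkhs"
  shows "rkhs_norm (F - G) = rkhs_norm (G - F)"
proof -
  obtain X Y where XY: "represents X F" "represents Y G"
    using assms rkhs_representative by metis
  have "knorm (kdiff (X n) (Y n)) = knorm (kscale (- 1) (kdiff (Y n) (X n)))" for n
    by (rule knorm_cong) simp
  then have "knorm (kdiff (X n) (Y n)) = knorm (kdiff (Y n) (X n))" for n by simp
  then show ?thesis
    using represents_norm[OF represents_diff[OF XY]] represents_norm[OF represents_diff[OF XY(2,1)]]
      LIMSEQ_unique by auto
qed

lemma hilbert_space_rkhs: "hilbert_space rkhs rkhs_ip"
  unfolding hilbert_space_def
proof (intro conjI allI ballI impI)
  have "represents (\<lambda>_. []) 0"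
    using represents_ev[of "[]"] by (simp add: ev_def zero_fun_def)
  then show "fscale.subspace rkhs"
    unfolding fscale.subspace_def rkhs_def
    using represents_add represents_scale by blast
next
  fix F G K assume "F \<in> rkhs" "G \<in> rkhs" "K \<in> rkhs"
  then obtain X Y Z where XYZ: "represents X F" "represents Y G" "represents Z K"
    using rkhs_representative by metis
  show "rkhs_ip (F + G) K = rkhs_ip F K + rkhs_ip G K"
    using represents_ip[OF represents_add[OF XYZ(1,2)] XYZ(3)]
      tendsto_add[OF represents_ip[OF XYZ(1,3)] represents_ip[OF XYZ(2,3)]]
    by (simp add: LIMSEQ_unique)
next
  fix c F G assume "F \<in> rkhs" "G \<in> rkhs"
  then obtain X Y where XY: "represents X F" "represents Y G"
    using rkhs_representative by metis
  show "rkhs_ip (fscale c F) G = c * rkhs_ip F G"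
    using represents_ip[OF represents_scale[OF XY(1)] XY(2), of c]
      tendsto_mult_left[OF represents_ip[OF XY], of c]
    by (simp add: LIMSEQ_unique)
next
  fix F G assume "F \<in> rkhs" "G \<in> rkhs"
  then obtain X Y where XY: "represents X F" "represents Y G"
    using rkhs_representative by metis
  show "rkhs_ip G F = cnj (rkhs_ip F G)"
    using represents_ip[OF XY(2,1)] tendsto_cnj[OF represents_ip[OF XY]]
    unfolding kform_commute[symmetric] by (rule LIMSEQ_unique)
next
  fix F assume "F \<in> rkhs" and nz: "F \<noteq> 0"
  then obtain X where X: "represents X F" using rkhs_representative by metis
  have nonneg: "Re (rkhs_ip F F) \<ge> 0"
    by (rule LIMSEQ_le_const[OF tendsto_Re[OF represents_ip[OF X X]]]) (simp add: kform_nonneg)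
  have "Re (rkhs_ip F F) \<noteq> 0"
  proof
    assume "Re (rkhs_ip F F) = 0"
    then have lim: "(\<lambda>n. knorm (X n)) \<longlonglongrightarrow> 0" using represents_norm[OF X] by (simp add: ip_norm_def)
    \<comment> \<open>Evaluation at \<open>y\<close> is pairing with the point \<open>y\<close>,
      hence bounded by the norm.\<close>
    have "F y = 0" for y
    proof -
      have "(\<lambda>n. kform k (X n) [(1, y)]) \<longlonglongrightarrow> 0"
        by (rule tendsto_0_le[OF lim, where K="knorm [(1, y)]"])
           (auto intro!: always_eventually kform_Cauchy_Schwarz)
      then show ?thesis using X LIMSEQ_unique unfolding represents_def by blast
    qed
    then show False using nz by (simp add: fun_eq_iff)
  qed
  then show "Re (rkhs_ip F F) > 0" using nonneg by simp
next
  fix W :: "nat \<Rightarrow> 'x \<Rightarrow> complex"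
  assume W: "(\<forall>n. W n \<in> rkhs) \<and>
    (\<forall>e>0. \<exists>N. \<forall>m\<ge>N. \<forall>n\<ge>N. rkhs_norm (W m - W n) < e)"
  \<comment> \<open>Finite combinations ever closer to \<open>W n\<close> form a Cauchy sequence of
    lists, and the function that it represents is the limit.\<close>
  have "\<exists>zs. rkhs_norm (W n - ev zs) \<le> inverse (real (Suc n))" for n
  proof -
    obtain X where "represents X (W n)" using W rkhs_representative by metis
    then show ?thesis using represents_approx[of X "W n" "inverse (real (Suc n))"] by auto
  qed
  then obtain zs where zs: "\<And>n. rkhs_norm (W n - ev (zs n)) \<le> inverse (real (Suc n))"
    by metis
  have norm_ev: "rkhs_norm (ev xs - ev ys) = knorm (kdiff xs ys)" for xs ys
  proof -
    have "ev xs - ev ys = ev (kdiff xs ys)" by (auto simp: ev_def)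
    then show ?thesis by (simp add: ip_norm_def knorm_def rkhs_ip_ev)
  qed
  have WH: "W n \<in> rkhs" for n using W by blast
  have small: "\<exists>N. \<forall>n\<ge>N. inverse (real (Suc n)) < e" if "e > 0" for e :: real
    using LIMSEQ_D[OF LIMSEQ_inverse_real_of_nat that] by auto
  have "kcauchy zs"
    unfolding kcauchy_def
  proof (intro allI impI)
    fix e :: real assume "e > 0"
    then obtain N1 N2 where N1: "\<forall>n\<ge>N1. inverse (real (Suc n)) < e / 3"
      and N2: "\<forall>m\<ge>N2. \<forall>n\<ge>N2. rkhs_norm (W m - W n) < e / 3"
      using small[of "e / 3"] W by (metis divide_pos_pos zero_less_numeral)
    have "knorm (kdiff (zs m) (zs n)) < e" if "m \<ge> max N1 N2" "n \<ge> max N1 N2" for m n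
    proof -
      have "knorm (kdiff (zs m) (zs n)) \<le> rkhs_norm (ev (zs m) - W m)
          + (rkhs_norm (W m - W n) + rkhs_norm (W n - ev (zs n)))"
        unfolding norm_ev[symmetric]
        using rkhs_norm_triangle[OF ev_in_rkhs WH ev_in_rkhs, of "zs m" "zs n" m]
          rkhs_norm_triangle[OF WH WH ev_in_rkhs, of m "zs n" n] by simp
      also have "\<dots> < e / 3 + (e / 3 + e / 3)"
        using zs[of m] zs[of n] N1 N2 that rkhs_norm_minus_commute[OF ev_in_rkhs WH, of "zs m" m]
        by (intro add_strict_mono) (auto intro: order_le_less_trans)
      finally show ?thesis by simp
    qed
    then show "\<exists>N. \<forall>m\<ge>N. \<forall>n\<ge>N. knorm (kdiff (zs m) (zs n)) < e" by blast
  qed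
  then obtain F where F: "represents zs F" by (rule kcauchy_represents)
  then have FH: "F \<in> rkhs" by (auto simp: rkhs_def)
  have "(\<lambda>n. rkhs_norm (W n - F)) \<longlonglongrightarrow> 0"
  proof (rule LIMSEQ_I)
    fix e :: real assume "e > 0"
    then obtain N1 N2 where N1: "\<forall>n\<ge>N1. inverse (real (Suc n)) < e / 2"
      and N2: "\<forall>n\<ge>N2. rkhs_norm (F - ev (zs n)) \<le> e / 2"
      using small[of "e / 2"] represents_approx[OF F, of "e / 2"] by auto
    have "rkhs_norm (W n - F) < e" if "n \<ge> max N1 N2" for n
    proof -
      have "rkhs_norm (W n - F) \<le> rkhs_norm (W n - ev (zs n)) + rkhs_norm (F - ev (zs n))"
        using rkhs_norm_triangle[OF WH ev_in_rkhs FH, of n "zs n"]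
          rkhs_norm_minus_commute[OF ev_in_rkhs FH, of "zs n"] by simp
      moreover have "rkhs_norm (W n - ev (zs n)) < e / 2"
        using zs[of n] N1 that by (auto intro: order_le_less_trans)
      ultimately show ?thesis using N2 that by fastforce
    qed
    moreover have "0 \<le> rkhs_norm (W n - F)" for n
    proof -
      obtain X where "represents X (W n)" using WH rkhs_representative by metis
      then show ?thesis by (rule LIMSEQ_le_const[OF represents_norm[OF represents_diff[OF _ F]]]) simp
    qed
    ultimately show "\<exists>no. \<forall>n\<ge>no. norm (rkhs_norm (W n - F) - 0) < e"
      by (intro exI[of _ "max N1 N2"]) auto
  qed
  then show "\<exists>v\<in>rkhs. (\<lambda>n. rkhs_norm (W n - v)) \<longlonglongrightarrow> 0" using FH by blast
qed

lemma rkhs_dense: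
  assumes "F \<in> rkhs" "e > 0" shows "\<exists>xs. rkhs_norm (F - ev xs) \<le> e"
proof -
  obtain X where "represents X F" using assms rkhs_representative by metis
  then show ?thesis using represents_approx[of X F e] assms(2) by auto
qed

end

section \<open>Representations from kernels\<close>

lemma unitary_repD:
  assumes "unitary_rep R"
  shows unitary_rep_hilbert: "hilbert_space (hspace R) (hip R)"
    and act_in: "v \<in> hspace R \<Longrightarrow> act R r v \<in> hspace R"
    and act_add: "u \<in> hspace R \<Longrightarrow> v \<in> hspace R \<Longrightarrow> act R r (u + v) = act R r u + act R r v"
    and act_scale: "v \<in> hspace R \<Longrightarrow> act R r (fscale c v) = fscale c (act R r v)"
    and act_ip: "u \<in> hspace R \<Longrightarrow> v \<in> hspace R \<Longrightarrow> hip R (act R r u) (act R r v) = hip R u v"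
    and act_0: "v \<in> hspace R \<Longrightarrow> act R 0 v = v"
    and act_plus: "v \<in> hspace R \<Longrightarrow> act R (r + s) v = act R r (act R s v)"
    and act_cont: "v \<in> hspace R \<Longrightarrow> ((\<lambda>r. hnorm R (act R r v - act R s v)) \<longlongrightarrow> 0) (at s)"
  using assms unfolding unitary_rep_def unitary_on_def by blast+

lemma act_norm:
  "unitary_rep R \<Longrightarrow> v \<in> hspace R \<Longrightarrow> hnorm R (act R r v) = hnorm R v"
  by (simp add: ip_norm_def act_ip)

lemma act_adjoint:
  assumes R: "unitary_rep R" and u: "u \<in> hspace R" and v: "v \<in> hspace R"
  shows "hip R (act R r u) v = hip R u (act R (- r) v)"
  using act_ip[OF R u act_in[OF R v], of r "- r"] act_plus[OF R v, of r "- r"] act_0[OF R v] by simp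

text \<open>Continuity is asked only at 0 and against the same point: the squared distance by which
  \<open>r\<close> moves the vector of \<open>x\<close> is 2 k(x, x) - 2 Re k(r x, x), and finite
  combinations of such vectors are dense.\<close>

locale kernel_action = psd_kernel_space k
  for k :: "'x \<Rightarrow> 'x \<Rightarrow> complex" +
  fixes \<alpha> :: "'g::topological_group_add \<Rightarrow> 'x \<Rightarrow> 'x"
  assumes action_0: "\<alpha> 0 x = x"
    and action_plus: "\<alpha> (r + s) x = \<alpha> r (\<alpha> s x)"
    and action_kernel: "k (\<alpha> r x) (\<alpha> r y) = k x y"
    and action_cont: "((\<lambda>r. k (\<alpha> r x) x) \<longlongrightarrow> k x x) (nhds 0)"
begin

definition shift :: "'g \<Rightarrow> (complex \<times> 'x) list \<Rightarrow> (complex \<times> 'x) list"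
  where "shift r = map (\<lambda>(c, x). (c, \<alpha> r x))"

text \<open>The inverse \<open>- r\<close> gives a left action, and invariance of the kernel turns
  it into moving the points by \<open>r\<close>, see \<open>ev_shift\<close>.\<close>

definition kernel_rep :: "('g, 'x) unirep"
  where "kernel_rep = \<lparr>hspace = rkhs, hip = rkhs_ip, act = (\<lambda>r F y. F (\<alpha> (- r) y))\<rparr>"

lemma kernel_rep_simps [simp]:
  "hspace kernel_rep = rkhs" "hip kernel_rep = rkhs_ip" "act kernel_rep r F = (\<lambda>y. F (\<alpha> (- r) y))"
  by (simp_all add: kernel_rep_def)

lemma kform_shift: "kform k (shift r xs) (shift r ys) = kform k xs ys"
  by (simp add: kform_def shift_def case_prod_unfold o_def action_kernel)

lemma action_inverse: "\<alpha> r (\<alpha> (- r) x) = x"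
  using action_plus[of r "- r" x] by (simp add: action_0)

lemma kform_shift_left: "kform k (shift r xs) [(1, y)] = kform k xs [(1, \<alpha> (- r) y)]"
  using kform_shift[of r xs "[(1, \<alpha> (- r) y)]"] by (simp add: shift_def action_inverse)

lemma ev_shift: "ev (shift r xs) = act kernel_rep r (ev xs)"
  by (simp add: ev_def kform_shift_left)

lemma shift_kdiff: "shift r (kdiff xs ys) = kdiff (shift r xs) (shift r ys)"
  by (simp add: shift_def kdiff_def kscale_def case_prod_unfold)

lemma represents_shift:
  assumes "represents X F" shows "represents (\<lambda>n. shift r (X n)) (act kernel_rep r F)"
proof -
  have "knorm (kdiff (shift r xs) (shift r ys)) = knorm (kdiff xs ys)" for xs ys
    unfolding knorm_def shift_kdiff[symmetric] by (simp add: kform_shift)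
  then show ?thesis using assms by (simp add: represents_def kcauchy_def kform_shift_left)
qed

lemma act_in_rkhs: "F \<in> rkhs \<Longrightarrow> act kernel_rep r F \<in> rkhs"
  using represents_shift unfolding rkhs_def by blast

lemma act_rkhs_ip:
  assumes "F \<in> rkhs" "G \<in> rkhs"
  shows "rkhs_ip (act kernel_rep r F) (act kernel_rep r G) = rkhs_ip F G"
proof -
  obtain X Y where XY: "represents X F" "represents Y G"
    using assms rkhs_representative by metis
  show ?thesis
    by (rule LIMSEQ_unique[OF represents_ip[OF represents_shift[OF XY(1), of r] represents_shift[OF XY(2), of r],
            unfolded kform_shift] represents_ip[OF XY]])
qed

lemma act_rkhs_norm: "F \<in> rkhs \<Longrightarrow> rkhs_norm (act kernel_rep r F) = rkhs_norm F"
  by (simp only: ip_norm_def act_rkhs_ip)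

lemmas rkhs_facts = hilbert_add[OF hilbert_space_rkhs] hilbert_scale[OF hilbert_space_rkhs]
  hilbert_zero[OF hilbert_space_rkhs] hilbert_diff[OF hilbert_space_rkhs] ev_in_rkhs

lemma act_ev_cont: "((\<lambda>r. rkhs_norm (act kernel_rep r (ev xs) - ev xs)) \<longlongrightarrow> 0) (nhds 0)"
proof (induction xs)
  case Nil
  have "act kernel_rep r (ev []) - ev [] = 0" for r by (auto simp: ev_def)
  then show ?case by (simp only: ip_norm_zero[OF hilbert_space_rkhs] tendsto_const)
next
  case (Cons p xs)
  define x where "x = snd p"
  have evp: "ev (p # xs) = fscale (fst p) (ev [(1, x)]) + ev xs"
    using kform_singleton[of k 1 x] by (cases p) (auto simp: ev_def x_def fscale_def kform_Cons_left[of k _ xs] kform_singleton)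
  have sq: "rkhs_norm (act kernel_rep r (ev [(1, x)]) - ev [(1, x)])
      = sqrt (2 * Re (k x x) - 2 * Re (k (\<alpha> r x) x))" for r
  proof -
    have "act kernel_rep r (ev [(1, x)]) - ev [(1, x)] = ev (kdiff [(1, \<alpha> r x)] [(1, x)])"
      unfolding ev_shift[symmetric] by (auto simp: shift_def ev_def)
    moreover have "Re (k x (\<alpha> r x)) = Re (k (\<alpha> r x) x)"
      using kernel_commute[of x "\<alpha> r x"] by simp
    ultimately show ?thesis
      by (simp add: ip_norm_def rkhs_ip_ev kform_singleton action_kernel)
  qed
  have "((\<lambda>r. sqrt (2 * Re (k x x) - 2 * Re (k (\<alpha> r x) x))) \<longlongrightarrow> sqrt (2 * Re (k x x) - 2 * Re (k x x))) (nhds 0)"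
    by (intro tendsto_intros action_cont)
  then have single: "((\<lambda>r. rkhs_norm (act kernel_rep r (ev [(1, x)]) - ev [(1, x)])) \<longlongrightarrow> 0) (nhds 0)"
    by (simp only: sq) simp
  have le: "rkhs_norm (act kernel_rep r (ev (p # xs)) - ev (p # xs))
      \<le> cmod (fst p) * rkhs_norm (act kernel_rep r (ev [(1, x)]) - ev [(1, x)])
        + rkhs_norm (act kernel_rep r (ev xs) - ev xs)" for r
  proof -
    have "act kernel_rep r (ev (p # xs)) - ev (p # xs)
        = fscale (fst p) (act kernel_rep r (ev [(1, x)]) - ev [(1, x)]) + (act kernel_rep r (ev xs) - ev xs)"
      unfolding evp by (auto simp: fscale_def algebra_simps)
    moreover have "act kernel_rep r (ev [(1, x)]) - ev [(1, x)] \<in> rkhs" "act kernel_rep r (ev xs) - ev xs \<in> rkhs"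
      by (intro rkhs_facts act_in_rkhs)+
    ultimately show ?thesis
      using ip_norm_triangle[OF hilbert_space_rkhs rkhs_facts(2)] ip_norm_scale[OF hilbert_space_rkhs]
      by metis
  qed
  show ?case
  proof (rule tendsto_sandwich[OF _ _ tendsto_const])
    show "((\<lambda>r. cmod (fst p) * rkhs_norm (act kernel_rep r (ev [(1, x)]) - ev [(1, x)])
        + rkhs_norm (act kernel_rep r (ev xs) - ev xs)) \<longlongrightarrow> 0) (nhds 0)"
      using tendsto_add[OF tendsto_mult[OF tendsto_const single] Cons, of "cmod (fst p)"]
      by (simp only: mult_zero_right add_0_right)
  qed (intro always_eventually allI le ip_norm_nonneg[OF hilbert_space_rkhs] rkhs_facts act_in_rkhs)+
qed

lemma act_rkhs_cont:
  assumes F: "F \<in> rkhs"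
  shows "((\<lambda>r. rkhs_norm (act kernel_rep r F - F)) \<longlongrightarrow> 0) (nhds 0)"
proof (rule tendstoI)
  fix e :: real assume e: "e > 0"
  obtain xs where xs: "rkhs_norm (F - ev xs) \<le> e / 3"
    using rkhs_dense[OF F, of "e / 3"] e by auto
  have "eventually (\<lambda>r. rkhs_norm (act kernel_rep r (ev xs) - ev xs) < e / 3) (nhds 0)"
    using order_tendstoD(2)[OF act_ev_cont, of "e / 3"] e by simp
  then show "eventually (\<lambda>r. dist (rkhs_norm (act kernel_rep r F - F)) 0 < e) (nhds 0)"
  proof (rule eventually_mono)
    fix r assume r: "rkhs_norm (act kernel_rep r (ev xs) - ev xs) < e / 3"
    have "act kernel_rep r F - act kernel_rep r (ev xs) = act kernel_rep r (F - ev xs)"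
      by auto
    then have "rkhs_norm (act kernel_rep r F - act kernel_rep r (ev xs)) \<le> e / 3"
      using xs act_rkhs_norm[OF rkhs_facts(4)[OF F ev_in_rkhs]] by metis
    moreover have "rkhs_norm (ev xs - F) \<le> e / 3"
      using xs rkhs_norm_minus_commute[OF F ev_in_rkhs] by metis
    ultimately have "rkhs_norm (act kernel_rep r F - F) < e"
      using r rkhs_norm_triangle[OF act_in_rkhs[OF F] act_in_rkhs[OF ev_in_rkhs] F, of r r xs]
        rkhs_norm_triangle[OF act_in_rkhs[OF ev_in_rkhs] ev_in_rkhs F, of r xs xs] by linarith
    moreover have "0 \<le> rkhs_norm (act kernel_rep r F - F)"
      by (intro ip_norm_nonneg[OF hilbert_space_rkhs] rkhs_facts act_in_rkhs F)
    ultimately show "dist (rkhs_norm (act kernel_rep r F - F)) 0 < e"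
      by (simp only: dist_real_def diff_zero abs_of_nonneg)
  qed
qed

theorem unitary_kernel_rep: "unitary_rep kernel_rep"
  unfolding unitary_rep_def unitary_on_def
proof (intro conjI allI ballI)
  show "hilbert_space (hspace kernel_rep) (hip kernel_rep)" by (simp add: hilbert_space_rkhs)
  fix r s :: 'g
  have inv: "act kernel_rep r (act kernel_rep (- r) F) = F" for F
    using action_inverse[of r] by simp
  show "act kernel_rep r ` hspace kernel_rep = hspace kernel_rep"
    using act_in_rkhs inv by (auto simp del: kernel_rep_simps(3) simp: image_iff) (metis act_in_rkhs inv)
  show "hip kernel_rep (act kernel_rep r F) (act kernel_rep r G) = hip kernel_rep F G"
    if "F \<in> hspace kernel_rep" "G \<in> hspace kernel_rep" for F G
    using that act_rkhs_ip by simp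
  show "act kernel_rep (r + s) F = act kernel_rep r (act kernel_rep s F)" for F
    using action_plus[of "- s" "- r"] by (simp add: minus_add)
  show "((\<lambda>r. hnorm kernel_rep (act kernel_rep r F - act kernel_rep s F)) \<longlongrightarrow> 0) (at s)"
    if "F \<in> hspace kernel_rep" for F
  proof -
    have FH: "F \<in> rkhs" using that by simp
    \<comment> \<open>Since \<open>act s\<close> is isometric, continuity at \<open>s\<close>
      reduces to continuity at 0.\<close>
    have eq: "hnorm kernel_rep (act kernel_rep r F - act kernel_rep s F)
        = rkhs_norm (act kernel_rep (- s + r) F - F)" for r
    proof -
      have "act kernel_rep r F - act kernel_rep s F = act kernel_rep s (act kernel_rep (- s + r) F - F)"
        by (auto simp: minus_add action_plus action_inverse)
      then show ?thesis
        using act_rkhs_norm[OF rkhs_facts(4)[OF act_in_rkhs[OF FH] FH]] by (simp only: kernel_rep_simps(2))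
    qed
    have "filterlim (\<lambda>r. - s + r) (nhds (- s + s)) (at s)"
      by (intro tendsto_intros)
    then have "filterlim (\<lambda>r. - s + r) (nhds 0) (at s)" by simp
    from filterlim_compose[OF act_rkhs_cont[OF FH] this] show ?thesis by (simp only: eq)
  qed
qed (auto simp: fscale_def action_0)

definition kernel_vec :: "'x \<Rightarrow> 'x \<Rightarrow> complex"
  where "kernel_vec x = k x"

lemma kernel_vec_ev: "kernel_vec x = ev [(1, x)]"
  by (auto simp: kernel_vec_def ev_def kform_singleton)

lemma kernel_vec:
  shows kernel_vec_in: "kernel_vec x \<in> hspace kernel_rep"
    and kernel_vec_ip: "hip kernel_rep (kernel_vec x) (kernel_vec y) = k x y"
    and kernel_vec_act: "act kernel_rep r (kernel_vec x) = kernel_vec (\<alpha> r x)"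
proof -
  show "act kernel_rep r (kernel_vec x) = kernel_vec (\<alpha> r x)"
    unfolding kernel_vec_ev ev_shift[symmetric] by (simp add: shift_def)
qed (simp_all add: kernel_vec_ev ev_in_rkhs rkhs_ip_ev kform_singleton)

end

text \<open>The source of all concrete representations below: an invariant positive kernel
  prescribes the inner products and the action on a family of vectors. It yields tensor products,
  the regular representation and the trivial one.\<close>

theorem kernel_representation:
  fixes k :: "'x \<Rightarrow> 'x \<Rightarrow> complex" and \<alpha> :: "'g::topological_group_add \<Rightarrow> 'x \<Rightarrow> 'x"
  assumes "psd_kernel k"
    and "\<And>x. \<alpha> 0 x = x" "\<And>r s x. \<alpha> (r + s) x = \<alpha> r (\<alpha> s x)"
    and "\<And>r x y. k (\<alpha> r x) (\<alpha> r y) = k x y"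
    and "\<And>x. ((\<lambda>r. k (\<alpha> r x) x) \<longlongrightarrow> k x x) (nhds 0)"
  obtains R :: "('g, 'x) unirep" and \<Phi> where
    "unitary_rep R" "\<And>x. \<Phi> x \<in> hspace R" "\<And>x y. hip R (\<Phi> x) (\<Phi> y) = k x y"
    "\<And>r x. act R r (\<Phi> x) = \<Phi> (\<alpha> r x)"
proof -
  interpret kernel_action k \<alpha> by unfold_locales (use assms in auto)
  show ?thesis by (rule that[OF unitary_kernel_rep kernel_vec])
qed

section \<open>Tensor products of coefficients\<close>

lemma kform_kernel_add:
  "kform (\<lambda>x y. k x y + l x y) xs ys = kform k xs ys + kform l xs ys"
  by (simp add: kform_def case_prod_unfold sum_list_addf distrib_left)

lemma kform_cong:
  assumes "\<And>x y. x \<in> snd ` set xs \<Longrightarrow> y \<in> snd ` set ys \<Longrightarrow> k x y = l x y"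
  shows "kform k xs ys = kform l xs ys"
  unfolding kform_def case_prod_unfold
  by (intro arg_cong[where f=sum_list] map_cong refl) (use assms in auto)

text \<open>Multiplication by a rank one kernel only rescales the coefficients, so positivity is
  inherited.\<close>

lemma kform_rank_one:
  "kform (\<lambda>x y. k x y * (t x * cnj (t y))) xs ys
    = kform k (map (\<lambda>(c, x). (c * t x, x)) xs) (map (\<lambda>(c, x). (c * t x, x)) ys)"
  by (simp add: kform_def case_prod_unfold o_def ac_simps)

text \<open>
  Schur's product theorem. The vectors are made orthogonal to the first one, which
  splits off a rank one term and removes the first entry from the remaining form.
\<close>

lemma psd_kernel_Schur:
  assumes k: "psd_kernel k" and H: "hilbert_space H ip" and g: "\<And>x. g x \<in> H"
  shows "psd_kernel (\<lambda>x y. k x y * ip (g x) (g y))"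
  unfolding psd_kernel_def
proof (intro conjI allI)
  show "k y x * ip (g y) (g x) = cnj (k x y * ip (g x) (g y))" for x y
  proof -
    have "k y x = cnj (k x y)" using k unfolding psd_kernel_def by blast
    then show ?thesis using ip_commute[OF H g g, of x y] by simp
  qed
  fix xs
  show "0 \<le> Re (kform (\<lambda>x y. k x y * ip (g x) (g y)) xs xs)"
    using g
  proof (induction xs arbitrary: g)
    case (Cons p xs)
    define b where "b = g (snd p)"
    define e where "e = fscale (of_real (1 / ip_norm ip b)) b"
    define t where "t x = ip (g x) e" for x
    define g' where "g' x = g x - fscale (t x) e" for x
    have b: "b \<in> H" using Cons.prems by (simp add: b_def)
    have e: "e \<in> H" unfolding e_def by (rule hilbert_scale[OF H b])
    have te: "fscale (t x) e \<in> H" for x by (rule hilbert_scale[OF H e])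
    have g': "g' x \<in> H" for x unfolding g'_def by (intro hilbert_diff[OF H] Cons.prems te)
    \<comment> \<open>\<open>e\<close> is a unit vector, or 0 if \<open>b = 0\<close>; in the latter
      case all \<open>t x\<close> vanish.\<close>
    have unit: "t x * ip e e = t x" for x
    proof (cases "b = 0")
      case True
      then have "e = 0" by (simp add: e_def fscale_def fun_eq_iff)
      then show ?thesis using ip_zero_right[OF H Cons.prems] by (simp add: t_def)
    next
      case False
      then have "ip_norm ip e = 1"
        using ip_norm_eq_0_iff[OF H b] ip_norm_nonneg[OF H b]
        by (simp add: e_def ip_norm_scale[OF H b] norm_divide)
      then have "ip e e = 1"
        using ip_self_real[OF H e] ip_norm_square[OF H e] by simp
      then show ?thesis by simp
    qed
    have split: "ip (g x) (g y) = t x * cnj (t y) + ip (g' x) (g' y)" for x y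
    proof -
      have "ip (g' x) (g' y)
          = ip (g x) (g y) - cnj (t y) * t x - t x * ip e (g y) + t x * ip e e * cnj (t y)"
        using Cons.prems te e
        by (simp add: g'_def ip_diff_left[OF H] ip_diff_right[OF H] hilbert_diff[OF H]
            ip_scale_left[OF H] ip_scale_right[OF H] t_def algebra_simps)
      also have "ip e (g y) = cnj (t y)"
        unfolding t_def by (rule ip_commute[OF H Cons.prems e])
      finally show ?thesis unfolding unit by simp
    qed
    have "g' (snd p) = 0"
    proof (cases "b = 0")
      case True
      then have "e = 0" by (simp add: e_def fscale_def fun_eq_iff)
      then show ?thesis using True by (simp add: g'_def b_def[symmetric] fscale_def fun_eq_iff)
    next
      case False
      then have n: "ip_norm ip b > 0"
        using ip_norm_eq_0_iff[OF H b] ip_norm_nonneg[OF H b] by simp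
      have "ip b b = of_real (ip_norm ip b * ip_norm ip b)"
        by (metis ip_self_real[OF H b] ip_norm_square[OF H b] power2_eq_square)
      then have "t (snd p) = of_real (ip_norm ip b)"
        unfolding t_def b_def[symmetric] e_def ip_scale_right[OF H b b] using n by simp
      then show ?thesis using n by (simp add: g'_def b_def[symmetric] e_def fscale_def fun_eq_iff)
    qed
    then have zero: "ip (g' (snd p)) (g' y) = 0" "ip (g' y) (g' (snd p)) = 0" for y
      using ip_zero_left[OF H g'] ip_zero_right[OF H g'] by auto
    let ?k' = "\<lambda>x y. k x y * ip (g' x) (g' y)"
    have "kform ?k' (p # xs) (p # xs) = kform ?k' xs xs"
    proof -
      have "kform ?k' [p] zs = kform (\<lambda>_ _. 0) [p] zs" "kform ?k' zs [p] = kform (\<lambda>_ _. 0) zs [p]" for zs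
        by (intro kform_cong; use zero in auto)+
      moreover have "kform (\<lambda>_ _. 0) ys zs = 0" for ys zs :: "(complex \<times> 'a) list"
        by (simp add: kform_def case_prod_unfold)
      ultimately show ?thesis
        by (simp add: kform_Cons_left[of ?k' p xs] kform_Cons_right[of ?k' xs p xs])
    qed
    moreover have "0 \<le> Re (kform ?k' xs xs)" using g' by (rule Cons.IH)
    moreover have "0 \<le> Re (kform (\<lambda>x y. k x y * (t x * cnj (t y))) (p # xs) (p # xs))"
      unfolding kform_rank_one using k unfolding psd_kernel_def by blast
    moreover have "kform (\<lambda>x y. k x y * ip (g x) (g y)) (p # xs) (p # xs)
        = kform (\<lambda>x y. k x y * (t x * cnj (t y))) (p # xs) (p # xs) + kform ?k' (p # xs) (p # xs)"
      unfolding split distrib_left by (rule kform_kernel_add)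
    ultimately show ?case by (simp only: plus_complex.sel)
  qed simp
qed

lemma psd_kernel_one: "psd_kernel (\<lambda>_ _. 1)"
proof -
  have "kform (\<lambda>_ _. 1) xs xs = of_real ((cmod (\<Sum>(c, x)\<leftarrow>xs. c))\<^sup>2)" for xs :: "(complex \<times> 'a) list"
  proof -
    have "cnj (\<Sum>(d, y)\<leftarrow>xs. d) = (\<Sum>(d, y)\<leftarrow>xs. cnj d)" by (induction xs) auto
    then show ?thesis
      unfolding complex_norm_square
      by (simp add: kform_def case_prod_unfold sum_list_const_mult flip: sum_list_mult_const)
  qed
  then show ?thesis by (simp add: psd_kernel_def)
qed

lemma psd_kernel_gram:
  assumes "hilbert_space H ip" and "\<And>x. g x \<in> H"
  shows "psd_kernel (\<lambda>x y. ip (g x) (g y))"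
  using psd_kernel_Schur[where k="\<lambda>_ _. 1" and g=g, OF psd_kernel_one assms] by simp

lemma coeff_tendsto:
  assumes R: "unitary_rep R" and v: "v \<in> hspace R" and u: "u \<in> hspace R"
  shows "((\<lambda>r. hip R (act R r v) u) \<longlongrightarrow> hip R (act R s v) u) (nhds s)"
proof -
  have "((\<lambda>r. hip R (act R r v) u) \<longlongrightarrow> hip R (act R s v) u) (at s)"
    by (rule ip_tendsto_left[OF unitary_rep_hilbert[OF R]])
      (use act_in[OF R] act_cont[OF R] v u in auto)
  then show ?thesis
    using tendsto_at_iff_tendsto_nhds[of "\<lambda>r. hip R (act R r v) u" s] by blast
qed

lemma coeff_continuous:
  assumes "unitary_rep R" "v \<in> hspace R" "u \<in> hspace R"
  shows "continuous_on UNIV (\<lambda>r. hip R (act R r v) u)"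
  unfolding continuous_on_def
  by (intro ballI tendsto_mono[OF at_within_le_nhds] coeff_tendsto[OF assms])

text \<open>
  The second vector of the realization is the orthogonal projection of \<open>\<eta>\<close> to the cyclic
  subspace generated by \<open>\<xi>\<close>.
\<close>

lemma coeff_realization:
  fixes R :: "('g::topological_group_add, 'i) unirep"
  assumes R: "unitary_rep R" and \<xi>: "\<xi> \<in> hspace R" and \<eta>: "\<eta> \<in> hspace R"
  obtains S :: "('g, 'g) unirep" and a b where
    "unitary_rep S" "a \<in> hspace S" "b \<in> hspace S"
    "\<And>r. hip S (act S r a) b = hip R (act R r \<xi>) \<eta>"
    "hnorm S a = hnorm R \<xi>" "hnorm S b \<le> hnorm R \<eta>" "\<eta> = \<xi> \<Longrightarrow> b = a"
proof -
  obtain S :: "('g, 'g) unirep" and U where S: "unitary_rep S"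
    and sub: "U ` hspace S \<subseteq> hspace R" and img: "\<xi> \<in> U ` hspace S"
    and Uadd: "\<And>u v. u \<in> hspace S \<Longrightarrow> v \<in> hspace S \<Longrightarrow> U (u + v) = U u + U v"
    and Uscale: "\<And>c v. v \<in> hspace S \<Longrightarrow> U (fscale c v) = fscale c (U v)"
    and Uip: "\<And>u v. u \<in> hspace S \<Longrightarrow> v \<in> hspace S \<Longrightarrow> hip R (U u) (U v) = hip S u v"
    and Uact: "\<And>r v. v \<in> hspace S \<Longrightarrow> U (act S r v) = act R r (U v)"
    using cyclic_subrep_realization[OF R \<xi>] by metis
  note HR = unitary_rep_hilbert[OF R] and HS = unitary_rep_hilbert[OF S]
  obtain a where a: "a \<in> hspace S" "U a = \<xi>" using img by blast
  have UR: "U u \<in> hspace R" if "u \<in> hspace S" for u using sub that by blast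
  have Unorm: "hnorm R (U u) = hnorm S u" if "u \<in> hspace S" for u
    using that by (simp add: ip_norm_def Uip)
  obtain b where b: "b \<in> hspace S" "\<And>u. u \<in> hspace S \<Longrightarrow> hip S b u = hip R \<eta> (U u)"
  proof (rule hilbert_riesz[OF HS, where L="\<lambda>u. hip R \<eta> (U u)" and C="hnorm R \<eta>"])
    show "cmod (hip R \<eta> (U u)) \<le> hnorm R \<eta> * hnorm S u" if "u \<in> hspace S" for u
      using ip_Cauchy_Schwarz[OF HR \<eta> UR[OF that]] Unorm[OF that] by simp
  qed (use UR \<eta> in \<open>auto simp: Uadd Uscale ip_add_right[OF HR] ip_scale_right[OF HR]\<close>)
  show ?thesis
  proof (rule that[OF S a(1) b(1)])
    show "hip S (act S r a) b = hip R (act R r \<xi>) \<eta>" for r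
      using b(2)[OF act_in[OF S a(1)], of r] ip_commute[OF HS b(1) act_in[OF S a(1)], of r]
        ip_commute[OF HR \<eta> act_in[OF R \<xi>], of r] by (simp add: Uact a)
    show "hnorm S a = hnorm R \<xi>" using Unorm[OF a(1)] a(2) by simp
    show "hnorm S b \<le> hnorm R \<eta>"
    proof (rule ip_norm_le_if_ip_le[OF HS b(1) ip_norm_nonneg[OF HR \<eta>]])
      show "cmod (hip S b b) \<le> hnorm R \<eta> * hnorm S b"
        using ip_Cauchy_Schwarz[OF HR \<eta> UR[OF b(1)]] Unorm[OF b(1)] b(2)[OF b(1)] by simp
    qed
    show "b = a" if "\<eta> = \<xi>"
      by (rule ip_extensionality[OF HS b(1) a(1)]) (use b(2) Uip a that in metis)
  qed
qed

text \<open>The points of the kernel are pairs of vectors and its values are products of inner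
  products, positive by Schur's theorem. Bilinear relations between elementary tensors then hold
  automatically in the kernel space.\<close>

lemma tensor_rep:
  fixes R1 :: "('g::topological_group_add, 'i) unirep" and R2 :: "('g, 'j) unirep"
  assumes R1: "unitary_rep R1" and R2: "unitary_rep R2"
  obtains T :: "('g, ('i \<Rightarrow> complex) \<times> ('j \<Rightarrow> complex)) unirep" and \<Phi> where
    "unitary_rep T" "\<And>p. \<Phi> p \<in> hspace T"
    "\<And>u v u' v'. u \<in> hspace R1 \<Longrightarrow> v \<in> hspace R2 \<Longrightarrow> u' \<in> hspace R1 \<Longrightarrow> v' \<in> hspace R2 \<Longrightarrow>
      hip T (\<Phi> (u, v)) (\<Phi> (u', v')) = hip R1 u u' * hip R2 v v'"
    "\<And>r u v. u \<in> hspace R1 \<Longrightarrow> v \<in> hspace R2 \<Longrightarrow> act T r (\<Phi> (u, v)) = \<Phi> (act R1 r u, act R2 r v)"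
proof -
  note H1 = unitary_rep_hilbert[OF R1] and H2 = unitary_rep_hilbert[OF R2]
  \<comment> \<open>The kernel is indexed by all pairs, so components outside the Hilbert spaces
    count as 0; \<open>\<alpha>\<close> leaves them fixed.\<close>
  define f where "f p = (if fst p \<in> hspace R1 then fst p else 0)" for p :: "('i \<Rightarrow> complex) \<times> ('j \<Rightarrow> complex)"
  define g where "g p = (if snd p \<in> hspace R2 then snd p else 0)" for p :: "('i \<Rightarrow> complex) \<times> ('j \<Rightarrow> complex)"
  define k where "k p q = hip R1 (f p) (f q) * hip R2 (g p) (g q)" for p q
  define \<alpha> where "\<alpha> r p = (if fst p \<in> hspace R1 then act R1 r (fst p) else fst p,
    if snd p \<in> hspace R2 then act R2 r (snd p) else snd p)" for r p
  have f: "f p \<in> hspace R1" and g: "g p \<in> hspace R2" for p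
    using hilbert_zero[OF H1] hilbert_zero[OF H2] by (auto simp: f_def g_def)
  have z: "act R1 r 0 = 0" "act R2 r 0 = 0" for r
    using act_scale[OF R1 hilbert_zero[OF H1], of r 0] act_scale[OF R2 hilbert_zero[OF H2], of r 0]
    by (simp_all add: fscale_def zero_fun_def)
  have f\<alpha>: "f (\<alpha> r p) = act R1 r (f p)" and g\<alpha>: "g (\<alpha> r p) = act R2 r (g p)" for r p
    by (auto simp: f_def g_def \<alpha>_def z act_in[OF R1] act_in[OF R2])
  have psd: "psd_kernel k"
    unfolding k_def by (intro psd_kernel_Schur[OF _ H2] psd_kernel_gram[OF H1] f g)
  obtain T :: "('g, ('i \<Rightarrow> complex) \<times> ('j \<Rightarrow> complex)) unirep" and \<Phi> where
    T: "unitary_rep T" "\<And>x. \<Phi> x \<in> hspace T" "\<And>x y. hip T (\<Phi> x) (\<Phi> y) = k x y"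
    "\<And>r x. act T r (\<Phi> x) = \<Phi> (\<alpha> r x)"
  proof (rule kernel_representation[OF psd, of \<alpha>])
    show "\<alpha> 0 x = x" for x by (auto simp: \<alpha>_def act_0[OF R1] act_0[OF R2])
    show "\<alpha> (r + s) x = \<alpha> r (\<alpha> s x)" for r s x
      by (auto simp: \<alpha>_def act_plus[OF R1] act_plus[OF R2] act_in[OF R1] act_in[OF R2])
    show "k (\<alpha> r x) (\<alpha> r y) = k x y" for r x y
      by (simp add: k_def f\<alpha> g\<alpha> f g act_ip[OF R1] act_ip[OF R2])
    show "((\<lambda>r. k (\<alpha> r x) x) \<longlongrightarrow> k x x) (nhds 0)" for x
      using tendsto_mult[OF coeff_tendsto[OF R1 f f, of x x 0] coeff_tendsto[OF R2 g g, of x x 0]]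
      by (simp add: k_def f\<alpha> g\<alpha> act_0[OF R1 f] act_0[OF R2 g])
  qed blast
  show ?thesis
    by (rule that[of T \<Phi>]) (auto simp: T k_def f_def g_def \<alpha>_def)
qed

text \<open>Two elementary tensors have the product as their coefficient, and
  \<open>coeff_realization\<close> returns it to index type \<open>'g\<close>. The second vector is
  projected on the way, hence the inequality for its norm; the last clause keeps positive definite
  functions positive definite.\<close>

theorem tensor_coeff:
  fixes R1 :: "('g::topological_group_add, 'i) unirep" and R2 :: "('g, 'j) unirep"
  assumes R1: "unitary_rep R1" and R2: "unitary_rep R2"
    and v1: "\<xi>1 \<in> hspace R1" "\<eta>1 \<in> hspace R1" and v2: "\<xi>2 \<in> hspace R2" "\<eta>2 \<in> hspace R2"
  obtains S :: "('g, 'g) unirep" and a b where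
    "unitary_rep S" "a \<in> hspace S" "b \<in> hspace S"
    "\<And>r. hip S (act S r a) b = hip R1 (act R1 r \<xi>1) \<eta>1 * hip R2 (act R2 r \<xi>2) \<eta>2"
    "hnorm S a = hnorm R1 \<xi>1 * hnorm R2 \<xi>2" "hnorm S b \<le> hnorm R1 \<eta>1 * hnorm R2 \<eta>2"
    "\<eta>1 = \<xi>1 \<Longrightarrow> \<eta>2 = \<xi>2 \<Longrightarrow> b = a"
proof -
  note H1 = unitary_rep_hilbert[OF R1] and H2 = unitary_rep_hilbert[OF R2]
  obtain T :: "('g, ('i \<Rightarrow> complex) \<times> ('j \<Rightarrow> complex)) unirep" and \<Phi> where
    T: "unitary_rep T" "\<And>p. \<Phi> p \<in> hspace T"
    and Tip: "\<And>u v u' v'. u \<in> hspace R1 \<Longrightarrow> v \<in> hspace R2 \<Longrightarrow> u' \<in> hspace R1 \<Longrightarrow> v' \<in> hspace R2 \<Longrightarrow>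
      hip T (\<Phi> (u, v)) (\<Phi> (u', v')) = hip R1 u u' * hip R2 v v'"
    and Tact: "\<And>r u v. u \<in> hspace R1 \<Longrightarrow> v \<in> hspace R2 \<Longrightarrow> act T r (\<Phi> (u, v)) = \<Phi> (act R1 r u, act R2 r v)"
    using tensor_rep[OF R1 R2] by metis
  have norm: "hnorm T (\<Phi> (u, v)) = hnorm R1 u * hnorm R2 v" if "u \<in> hspace R1" "v \<in> hspace R2" for u v
  proof -
    have "Re (hip R1 u u * hip R2 v v) = Re (hip R1 u u) * Re (hip R2 v v)"
      using ip_self_real[OF H1 that(1)] by (metis Im_complex_of_real diff_zero mult_zero_left times_complex.sel(1))
    then show ?thesis using that by (simp only: ip_norm_def Tip real_sqrt_mult)
  qed
  obtain S :: "('g, 'g) unirep" and a b where S: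
    "unitary_rep S" "a \<in> hspace S" "b \<in> hspace S"
    "\<And>r. hip S (act S r a) b = hip T (act T r (\<Phi> (\<xi>1, \<xi>2))) (\<Phi> (\<eta>1, \<eta>2))"
    "hnorm S a = hnorm T (\<Phi> (\<xi>1, \<xi>2))" "hnorm S b \<le> hnorm T (\<Phi> (\<eta>1, \<eta>2))"
    "\<Phi> (\<eta>1, \<eta>2) = \<Phi> (\<xi>1, \<xi>2) \<Longrightarrow> b = a"
    by (rule coeff_realization[OF T(1) T(2) T(2), of "(\<xi>1, \<xi>2)" "(\<eta>1, \<eta>2)"]) blast
  show ?thesis
    by (rule that[OF S(1-3)])
       (use S(4-7) v1 v2 act_in[OF R1 v1(1)] act_in[OF R2 v2(1)] in \<open>auto simp: norm Tact Tip\<close>)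
qed

section \<open>Products in \<open>P1\<close>, and coefficients in the Fourier-Stieltjes
  algebra\<close>

lemma P1E:
  assumes "\<rho> \<in> P1"
  obtains R :: "('g::topological_group_add, 'g) unirep" and \<xi> where
    "unitary_rep R" "\<xi> \<in> hspace R" "hnorm R \<xi> = 1" "\<And>r. \<rho> r = hip R (act R r \<xi>) \<xi>"
  using assms unfolding P1_def matrix_coeff_def by auto

lemma P1I:
  fixes R :: "('g::topological_group_add, 'g) unirep"
  assumes "unitary_rep R" "\<xi> \<in> hspace R" "hnorm R \<xi> = 1" "\<And>r. \<rho> r = hip R (act R r \<xi>) \<xi>"
  shows "\<rho> \<in> P1"
proof -
  have "\<rho> = matrix_coeff R \<xi> \<xi>" using assms(4) by (auto simp: matrix_coeff_def)
  then show ?thesis unfolding P1_def using assms by blast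
qed

lemma P1_mult:
  assumes "\<rho> \<in> P1" "\<sigma> \<in> P1" shows "(\<lambda>r. \<rho> r * \<sigma> r) \<in> P1"
proof -
  obtain R :: "('a, 'a) unirep" and \<xi> where R: "unitary_rep R" "\<xi> \<in> hspace R" "hnorm R \<xi> = 1"
    "\<And>r. \<rho> r = hip R (act R r \<xi>) \<xi>" using assms(1) P1E by blast
  obtain S :: "('a, 'a) unirep" and \<eta> where S: "unitary_rep S" "\<eta> \<in> hspace S" "hnorm S \<eta> = 1"
    "\<And>r. \<sigma> r = hip S (act S r \<eta>) \<eta>" using assms(2) P1E by blast
  obtain T :: "('a, 'a) unirep" and a b where T: "unitary_rep T" "a \<in> hspace T" "b \<in> hspace T"
    "\<And>r. hip T (act T r a) b = hip R (act R r \<xi>) \<xi> * hip S (act S r \<eta>) \<eta>"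
    "hnorm T a = hnorm R \<xi> * hnorm S \<eta>" "b = a"
    by (rule tensor_coeff[OF R(1) S(1) R(2) R(2) S(2) S(2)]) blast
  show ?thesis by (rule P1I[OF T(1,2)]) (use T R S in auto)
qed

lemma P1_power:
  assumes "\<rho> \<in> P1" "n \<ge> 1" shows "(\<lambda>r. \<rho> r ^ n) \<in> P1"
  using assms(2)
proof (induction n rule: dec_induct)
  case (step n)
  then show ?case using P1_mult[OF assms(1) step.IH] by simp
qed (use assms in simp)

lemma fourier_stieltjesE:
  assumes "\<phi> \<in> fourier_stieltjes"
  obtains R :: "('g::topological_group_add, 'g) unirep" and \<xi> \<eta> where
    "unitary_rep R" "\<xi> \<in> hspace R" "\<eta> \<in> hspace R" "\<phi> = (\<lambda>r. hip R (act R r \<xi>) \<eta>)"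
  using assms unfolding fourier_stieltjes_def matrix_coeff_def by auto

lemma fourier_stieltjesI:
  fixes R :: "('g::topological_group_add, 'g) unirep"
  assumes "unitary_rep R" "\<xi> \<in> hspace R" "\<eta> \<in> hspace R"
  shows "(\<lambda>r. hip R (act R r \<xi>) \<eta>) \<in> fourier_stieltjes"
  using assms unfolding fourier_stieltjes_def matrix_coeff_def by blast

section \<open>The group C*-algebra\<close>

lemma coeff_bound:
  assumes R: "unitary_rep R" and v: "v \<in> hspace R" and u: "u \<in> hspace R"
  shows "cmod (hip R (act R r v) u) \<le> hnorm R v * hnorm R u"
  using ip_Cauchy_Schwarz[OF unitary_rep_hilbert[OF R] act_in[OF R v] u, of r]
  by (simp add: act_norm[OF R v])

locale borel_group =
  fixes \<mu> :: "'g::topological_group_add measure"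
  assumes sets_eq: "sets \<mu> = sets borel"
begin

lemma continuous_measurable:
  fixes f :: "'g \<Rightarrow> complex"
  assumes "continuous_on UNIV f" shows "f \<in> borel_measurable \<mu>"
  using borel_measurable_continuous_onI[OF assms] measurable_cong_sets[OF sets_eq refl, of borel]
  by blast

lemma integrable_mult_bounded:
  fixes f g :: "'g \<Rightarrow> complex"
  assumes f: "integrable \<mu> f" and g: "continuous_on UNIV g" and b: "\<And>r. cmod (g r) \<le> B"
  shows "integrable \<mu> (\<lambda>r. f r * g r)"
    and "cmod (LINT r|\<mu>. f r * g r) \<le> (LINT r|\<mu>. cmod (f r)) * B"
proof -
  have fB: "integrable \<mu> (\<lambda>r. cmod (f r) * B)" using f by simp
  have le: "cmod (f r * g r) \<le> cmod (f r) * B" for r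
    unfolding norm_mult by (intro mult_left_mono b) simp
  then have le': "cmod (f r * g r) \<le> norm (cmod (f r) * B)" for r
    using abs_ge_self order_trans unfolding real_norm_def by blast
  have m: "(\<lambda>r. f r * g r) \<in> borel_measurable \<mu>"
    using f continuous_measurable[OF g] by measurable
  show I: "integrable \<mu> (\<lambda>r. f r * g r)"
    by (rule Bochner_Integration.integrable_bound[OF fB m]) (use le' in auto)
  have "cmod (LINT r|\<mu>. f r * g r) \<le> (LINT r|\<mu>. cmod (f r * g r))"
    by (rule integral_norm_bound)
  also have "\<dots> \<le> (LINT r|\<mu>. cmod (f r) * B)"
    by (rule integral_mono) (use I fB le in auto)
  finally show "cmod (LINT r|\<mu>. f r * g r) \<le> (LINT r|\<mu>. cmod (f r)) * B" by simp
qed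

lemma integrable_coeff:
  assumes "integrable \<mu> f" "unitary_rep R" "v \<in> hspace R" "u \<in> hspace R"
  shows "integrable \<mu> (\<lambda>r. f r * hip R (act R r v) u)"
    and "cmod (LINT r|\<mu>. f r * hip R (act R r v) u) \<le> (LINT r|\<mu>. cmod (f r)) * hnorm R v * hnorm R u"
  using integrable_mult_bounded[OF assms(1) coeff_continuous[OF assms(2-4)] coeff_bound[OF assms(2-4)]]
  by (simp_all add: mult.assoc)

text \<open>Riesz' theorem provides the vector that the definite description in
  \<open>l1_embed\<close> asks for, and inner products determine it.\<close>

lemma l1_embed:
  assumes f: "integrable \<mu> f" and R: "unitary_rep R" and v: "v \<in> hspace R"
  shows l1_embed_in: "l1_embed \<mu> f R v \<in> hspace R"
    and l1_embed_ip: "u \<in> hspace R \<Longrightarrow>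
      hip R (l1_embed \<mu> f R v) u = (LINT r|\<mu>. f r * hip R (act R r v) u)"
proof -
  note H = unitary_rep_hilbert[OF R]
  note int = integrable_coeff[OF f R v]
  obtain w where w: "w \<in> hspace R"
    "\<And>u. u \<in> hspace R \<Longrightarrow> hip R w u = (LINT r|\<mu>. f r * hip R (act R r v) u)"
  proof (rule hilbert_riesz[OF H, where L="\<lambda>u. LINT r|\<mu>. f r * hip R (act R r v) u"])
    show "(LINT r|\<mu>. f r * hip R (act R r v) (u + u')) = (LINT r|\<mu>. f r * hip R (act R r v) u)
        + (LINT r|\<mu>. f r * hip R (act R r v) u')" if "u \<in> hspace R" "u' \<in> hspace R" for u u'
      using that int by (simp add: ip_add_right[OF H] act_in[OF R v] distrib_left)
    show "(LINT r|\<mu>. f r * hip R (act R r v) (fscale c u)) = cnj c * (LINT r|\<mu>. f r * hip R (act R r v) u)"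
      if "u \<in> hspace R" for c u
      using that by (simp add: ip_scale_right[OF H] act_in[OF R v] mult.left_commute)
  qed (use int in auto)
  have "l1_embed \<mu> f R v = w"
    unfolding l1_embed_def
    by (simp add: R v) (rule the_equality; use w ip_extensionality[OF H] in auto)
  then show "l1_embed \<mu> f R v \<in> hspace R" "u \<in> hspace R \<Longrightarrow>
      hip R (l1_embed \<mu> f R v) u = (LINT r|\<mu>. f r * hip R (act R r v) u)"
    using w by auto
qed

lemma l1_embed_eqI:
  assumes "integrable \<mu> f" "unitary_rep R" "v \<in> hspace R" "w \<in> hspace R"
    and "\<And>u. u \<in> hspace R \<Longrightarrow> hip R w u = (LINT r|\<mu>. f r * hip R (act R r v) u)"
  shows "l1_embed \<mu> f R v = w"
  by (rule ip_extensionality[OF unitary_rep_hilbert]) (use assms l1_embed in auto)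

lemma l1_embed_norm:
  assumes f: "integrable \<mu> f" and R: "unitary_rep R" and v: "v \<in> hspace R"
  shows "hnorm R (l1_embed \<mu> f R v) \<le> (LINT r|\<mu>. cmod (f r)) * hnorm R v"
proof -
  note H = unitary_rep_hilbert[OF R]
  have in': "l1_embed \<mu> f R v \<in> hspace R" by (rule l1_embed_in[OF f R v])
  show ?thesis
    by (rule ip_norm_le_if_ip_le[OF H in'])
       (use integrable_coeff(2)[OF f R v in'] l1_embed_ip[OF f R v in'] ip_norm_nonneg[OF H v] in
        \<open>auto intro: mult_nonneg_nonneg\<close>)
qed

lemma l1_embed_diff:
  assumes f: "integrable \<mu> f" and g: "integrable \<mu> g" and R: "unitary_rep R" and v: "v \<in> hspace R"
  shows "l1_embed \<mu> (\<lambda>r. f r - g r) R v = l1_embed \<mu> f R v - l1_embed \<mu> g R v"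
proof -
  note H = unitary_rep_hilbert[OF R]
  show ?thesis
    by (rule l1_embed_eqI[OF _ R v])
       (use f g integrable_coeff[OF f R v] integrable_coeff[OF g R v] in
        \<open>auto simp: l1_embed_in[OF f R v] l1_embed_in[OF g R v] hilbert_diff[OF H]
          ip_diff_left[OF H] l1_embed_ip[OF f R v] l1_embed_ip[OF g R v] left_diff_distrib\<close>)
qed

lemma l1_embed_vec_add:
  assumes f: "integrable \<mu> f" and R: "unitary_rep R" and u: "u \<in> hspace R" and v: "v \<in> hspace R"
  shows "l1_embed \<mu> f R (u + v) = l1_embed \<mu> f R u + l1_embed \<mu> f R v"
proof -
  note H = unitary_rep_hilbert[OF R]
  show ?thesis
    by (rule l1_embed_eqI[OF f R hilbert_add[OF H u v]])
       (use integrable_coeff[OF f R v] integrable_coeff[OF f R u] in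
        \<open>auto simp: l1_embed_in[OF f R v] l1_embed_in[OF f R u] hilbert_add[OF H]
          ip_add_left[OF H] l1_embed_ip[OF f R v] l1_embed_ip[OF f R u] act_add[OF R u v]
          act_in[OF R u] act_in[OF R v] distrib_left\<close>)
qed

lemma l1_embed_vec_scale:
  assumes f: "integrable \<mu> f" and R: "unitary_rep R" and v: "v \<in> hspace R"
  shows "l1_embed \<mu> f R (fscale c v) = fscale c (l1_embed \<mu> f R v)"
proof -
  note H = unitary_rep_hilbert[OF R]
  show ?thesis
    by (rule l1_embed_eqI[OF f R hilbert_scale[OF H v]])
       (auto simp: l1_embed_in[OF f R v] hilbert_scale[OF H] ip_scale_left[OF H]
          l1_embed_ip[OF f R v] act_scale[OF R v] act_in[OF R v] mult.left_commute)
qed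

text \<open>Scaling together with one bound valid in all representations is what makes the supremum
  over unit balls in \<open>cstar_norm\<close> an operator norm.\<close>

definition op_bounded :: "'g op_family \<Rightarrow> bool"
  where "op_bounded x \<longleftrightarrow>
    (\<forall>R v. unitary_rep R \<and> v \<in> hspace R \<longrightarrow> x R v \<in> hspace R) \<and>
    (\<forall>R v c. unitary_rep R \<and> v \<in> hspace R \<longrightarrow> x R (fscale c v) = fscale c (x R v)) \<and>
    (\<exists>C. \<forall>R v. unitary_rep R \<and> v \<in> hspace R \<longrightarrow> hnorm R (x R v) \<le> C * hnorm R v)"

lemma op_bounded_l1: "integrable \<mu> f \<Longrightarrow> op_bounded (l1_embed \<mu> f)"
  unfolding op_bounded_def using l1_embed_in l1_embed_vec_scale l1_embed_norm by metis

lemma op_bounded_diff: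
  assumes x: "op_bounded x" and y: "op_bounded y" shows "op_bounded (x - y)"
proof -
  obtain C D where C: "\<And>R v. unitary_rep R \<Longrightarrow> v \<in> hspace R \<Longrightarrow> hnorm R (x R v) \<le> C * hnorm R v"
    and D: "\<And>R v. unitary_rep R \<Longrightarrow> v \<in> hspace R \<Longrightarrow> hnorm R (y R v) \<le> D * hnorm R v"
    using x y unfolding op_bounded_def by metis
  have in': "x R v \<in> hspace R" "y R v \<in> hspace R" if "unitary_rep R" "v \<in> hspace R" for R v
    using x y that unfolding op_bounded_def by blast+
  have "hnorm R (x R v - y R v) \<le> (C + D) * hnorm R v" if R: "unitary_rep R" and v: "v \<in> hspace R" for R v
  proof -
    note H = unitary_rep_hilbert[OF R]
    have "hnorm R (x R v - y R v) = hnorm R (x R v + fscale (- 1) (y R v))"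
      by (rule arg_cong[where f="hnorm R"]) (auto simp: fscale_def)
    also have "\<dots> \<le> hnorm R (x R v) + hnorm R (y R v)"
      using ip_norm_triangle[OF H in'(1)[OF R v] hilbert_scale[OF H in'(2)[OF R v]], of "- 1"]
        ip_norm_scale[OF H in'(2)[OF R v], of "- 1"] by simp
    finally show ?thesis using C[OF R v] D[OF R v] by (simp add: distrib_right)
  qed
  then have "\<exists>C. \<forall>R v. unitary_rep R \<and> v \<in> hspace R \<longrightarrow> hnorm R (x R v - y R v) \<le> C * hnorm R v"
    by blast
  moreover have "x R v - y R v \<in> hspace R" if "unitary_rep R" "v \<in> hspace R" for R v
    using in'[OF that] hilbert_diff[OF unitary_rep_hilbert[OF that(1)]] by blast
  moreover have "x R (fscale c v) - y R (fscale c v) = fscale c (x R v - y R v)"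
    if "unitary_rep R" "v \<in> hspace R" for R v c
  proof -
    have "x R (fscale c v) = fscale c (x R v)" "y R (fscale c v) = fscale c (y R v)"
      using x y that unfolding op_bounded_def by blast+
    then show ?thesis by (simp add: fscale.scale_right_diff_distrib)
  qed
  ultimately show ?thesis
    unfolding op_bounded_def minus_apply by simp
qed

lemma hnorm_diff_triangle:
  assumes "unitary_rep R" "u \<in> hspace R" "v \<in> hspace R" "w \<in> hspace R"
  shows "hnorm R (u - w) \<le> hnorm R (u - v) + hnorm R (v - w)"
  using ip_norm_triangle[OF unitary_rep_hilbert[OF assms(1)], of "u - v" "v - w"]
    hilbert_diff[OF unitary_rep_hilbert[OF assms(1)]] assms by simp

lemma group_cstarD:
  assumes "x \<in> group_cstar \<mu>"
  shows group_cstar_in: "unitary_rep R \<Longrightarrow> v \<in> hspace R \<Longrightarrow> x R v \<in> hspace R"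
    and group_cstar_outside: "\<not> (unitary_rep R \<and> v \<in> hspace R) \<Longrightarrow> x R v = 0"
    and group_cstar_l1: "e > 0 \<Longrightarrow> \<exists>f. integrable \<mu> f \<and> (\<forall>R v. unitary_rep R \<and> v \<in> hspace R \<longrightarrow>
        hnorm R (x R v - l1_embed \<mu> f R v) \<le> e * hnorm R v)"
  using assms unfolding group_cstar_def by blast+

lemma l1_in_group_cstar:
  assumes f: "integrable \<mu> f" shows "l1_embed \<mu> f \<in> group_cstar \<mu>"
proof -
  have "\<exists>g. integrable \<mu> g \<and> (\<forall>R v. unitary_rep R \<and> v \<in> hspace R \<longrightarrow>
      hnorm R (l1_embed \<mu> f R v - l1_embed \<mu> g R v) \<le> e * hnorm R v)" if "e > 0" for e
    using f that
    by (intro exI[of _ f])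
       (auto simp: ip_norm_zero[OF unitary_rep_hilbert] ip_norm_nonneg[OF unitary_rep_hilbert])
  then show ?thesis
    unfolding group_cstar_def using l1_embed_in[OF f] by (auto simp: l1_embed_def[of \<mu> f])
qed

text \<open>Elements of \<open>group_cstar\<close> are bare families of functions. Boundedness and
  homogeneity are inherited from the approximating integrable functions.\<close>

lemma group_cstar_op_bounded:
  assumes x: "x \<in> group_cstar \<mu>" shows "op_bounded x"
  unfolding op_bounded_def
proof (intro conjI allI impI; (elim conjE)?)
  show "x R v \<in> hspace R" if "unitary_rep R" "v \<in> hspace R" for R v
    using group_cstar_in[OF x] that by blast
  obtain f where f: "integrable \<mu> f" and approx: "\<And>R v. unitary_rep R \<Longrightarrow> v \<in> hspace R \<Longrightarrow>
      hnorm R (x R v - l1_embed \<mu> f R v) \<le> 1 * hnorm R v"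
    using group_cstar_l1[OF x, of 1] by auto
  show "\<exists>C. \<forall>R v. unitary_rep R \<and> v \<in> hspace R \<longrightarrow> hnorm R (x R v) \<le> C * hnorm R v"
  proof (intro exI allI impI; elim conjE)
    fix R :: "('g, 'g) unirep" and v
    assume R: "unitary_rep R" and v: "v \<in> hspace R"
    note H = unitary_rep_hilbert[OF R]
    have "hnorm R (x R v) \<le> hnorm R (x R v - l1_embed \<mu> f R v) + hnorm R (l1_embed \<mu> f R v)"
      using hnorm_diff_triangle[OF R group_cstar_in[OF x R v] l1_embed_in[OF f R v] hilbert_zero[OF H]]
      by simp
    then show "hnorm R (x R v) \<le> (1 + (LINT r|\<mu>. cmod (f r))) * hnorm R v"
      using approx[OF R v] l1_embed_norm[OF f R v] by (simp add: distrib_right)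
  qed
  fix R :: "('g, 'g) unirep" and v c
  assume R: "unitary_rep R" and v: "v \<in> hspace R"
  note H = unitary_rep_hilbert[OF R]
  have cv: "fscale c v \<in> hspace R" by (rule hilbert_scale[OF H v])
  have xs: "x R (fscale c v) \<in> hspace R" "fscale c (x R v) \<in> hspace R"
    using group_cstar_in[OF x R] cv v hilbert_scale[OF H] by auto
  have le: "hnorm R (x R (fscale c v) - fscale c (x R v)) \<le> 0 + e" if e: "e > 0" for e :: real
  proof -
    \<comment> \<open>The scaling defect is at most twice \<open>d\<close> times the norm of
      \<open>fscale c v\<close>; \<open>q\<close> exceeds that norm and is positive, so the total is
      at most \<open>e\<close>.\<close>
    define q where "q = cmod c * hnorm R v + 1"
    define d where "d = e / (2 * q)"
    have q: "q > 0" using ip_norm_nonneg[OF H v] by (simp add: q_def add_nonneg_pos)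
    then have d: "d > 0" using e by (simp add: d_def)
    obtain g where g: "integrable \<mu> g" and approx: "\<And>v. v \<in> hspace R \<Longrightarrow>
        hnorm R (x R v - l1_embed \<mu> g R v) \<le> d * hnorm R v"
      using group_cstar_l1[OF x d] R by blast
    have "hnorm R (fscale c (l1_embed \<mu> g R v) - fscale c (x R v))
        = cmod c * hnorm R (x R v - l1_embed \<mu> g R v)"
      unfolding fscale.scale_right_diff_distrib[symmetric]
      using group_cstar_in[OF x R v] l1_embed_in[OF g R v]
      by (simp add: ip_norm_scale[OF H] hilbert_diff[OF H] ip_norm_minus_commute[OF H])
    also have "\<dots> \<le> cmod c * (d * hnorm R v)" by (intro mult_left_mono approx[OF v]) simp
    finally have "hnorm R (x R (fscale c v) - fscale c (x R v)) \<le> d * (cmod c * hnorm R v) + cmod c * (d * hnorm R v)"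
      using hnorm_diff_triangle[OF R xs(1) l1_embed_in[OF g R cv] xs(2)] approx[OF cv]
        ip_norm_scale[OF H v, of c]
      by (simp add: l1_embed_vec_scale[OF g R v] mult.left_commute[of "cmod c" d])
    also have "\<dots> = 2 * d * (cmod c * hnorm R v)" by (simp add: mult.left_commute[of "cmod c" d])
    also have "\<dots> \<le> 2 * d * q" using d by (intro mult_left_mono) (auto simp: q_def)
    also have "\<dots> = e" using q by (simp add: d_def)
    finally show ?thesis by simp
  qed
  then have "hnorm R (x R (fscale c v) - fscale c (x R v)) \<le> 0" by (rule field_le_epsilon)
  then have "hnorm R (x R (fscale c v) - fscale c (x R v)) = 0"
    using ip_norm_nonneg[OF H hilbert_diff[OF H xs]] by simp
  then show "x R (fscale c v) = fscale c (x R v)"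
    using ip_norm_eq_0_iff[OF H hilbert_diff[OF H xs]] by simp
qed

lemma cstar_norm_ge:
  assumes x: "op_bounded x" and R: "unitary_rep R" and v: "v \<in> hspace R"
  shows "hnorm R (x R v) \<le> cstar_norm x * hnorm R v"
proof -
  note H = unitary_rep_hilbert[OF R]
  let ?A = "{hnorm R (x R v) | R v. unitary_rep R \<and> v \<in> hspace R \<and> hnorm R v \<le> 1}"
  obtain C where C: "\<And>R v. unitary_rep R \<Longrightarrow> v \<in> hspace R \<Longrightarrow> hnorm R (x R v) \<le> C * hnorm R v"
    using x unfolding op_bounded_def by metis
  have bdd: "bdd_above ?A"
  proof (rule bdd_aboveI[of _ "\<bar>C\<bar>"])
    fix a assume "a \<in> ?A"
    then obtain S u where S: "unitary_rep S" "u \<in> hspace S" "hnorm S u \<le> 1" "a = hnorm S (x S u)"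
      by blast
    have "a \<le> \<bar>C\<bar> * hnorm S u"
      using C[OF S(1,2)] S(4) ip_norm_nonneg[OF unitary_rep_hilbert[OF S(1)] S(2)]
        mult_right_mono[OF abs_ge_self[of C]] by fastforce
    also have "\<dots> \<le> \<bar>C\<bar> * 1" by (intro mult_left_mono S) simp
    finally show "a \<le> \<bar>C\<bar>" by simp
  qed
  show ?thesis
  proof (cases "v = 0")
    case True
    then have "hnorm R (x R v) \<le> 0" using C[OF R v] by (simp add: ip_norm_zero[OF H])
    then show ?thesis by (simp add: True ip_norm_zero[OF H])
  next
    case False
    define n where "n = hnorm R v"
    have n: "n > 0"
      using ip_norm_eq_0_iff[OF H v] ip_norm_nonneg[OF H v] False by (simp add: n_def)
    define u where "u = fscale (of_real (1 / n)) v"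
    have u: "u \<in> hspace R" unfolding u_def by (rule hilbert_scale[OF H v])
    have nu: "hnorm R u = 1"
      using n by (simp add: u_def ip_norm_scale[OF H v] n_def norm_divide)
    have xv: "x R v \<in> hspace R" using x R v unfolding op_bounded_def by blast
    have xu: "x R u = fscale (of_real (1 / n)) (x R v)"
      unfolding u_def using x R v unfolding op_bounded_def by blast
    have "hnorm R (x R u) \<le> cstar_norm x"
      unfolding cstar_norm_def by (rule cSup_upper[OF _ bdd]) (use R u order_eq_refl[OF nu] in blast)
    moreover have "hnorm R (x R u) = hnorm R (x R v) / n"
      using n by (simp add: xu ip_norm_scale[OF H xv] norm_divide)
    ultimately show ?thesis using n by (simp add: n_def[symmetric] divide_le_eq)
  qed
qed

text \<open>The representation \<open>R\<close> makes the set under the supremum nonempty; the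
  supremum of an empty set of reals gives no bound.\<close>

lemma cstar_norm_le:
  assumes C: "C \<ge> 0" and le: "\<And>R v. unitary_rep R \<Longrightarrow> v \<in> hspace R \<Longrightarrow> hnorm R (x R v) \<le> C * hnorm R v"
    and R: "unitary_rep (R :: ('g, 'g) unirep)"
  shows "cstar_norm x \<le> C" "op_bounded x \<Longrightarrow> 0 \<le> cstar_norm x"
proof -
  let ?A = "{hnorm R (x R v) | R v. unitary_rep R \<and> v \<in> hspace R \<and> hnorm R v \<le> 1}"
  note H = unitary_rep_hilbert[OF R]
  have "hnorm R (x R 0) \<in> ?A"
    using R hilbert_zero[OF H] ip_norm_zero[OF H] by force
  then have ne: "?A \<noteq> {}" by blast
  have ub: "a \<le> C" if "a \<in> ?A" for a
  proof -
    from that obtain S u where S: "unitary_rep S" "u \<in> hspace S" "hnorm S u \<le> 1" "a = hnorm S (x S u)"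
      by blast
    have "a \<le> C * hnorm S u" using le[OF S(1,2)] S(4) by simp
    also have "\<dots> \<le> C * 1" by (intro mult_left_mono S C)
    finally show "a \<le> C" by simp
  qed
  show "cstar_norm x \<le> C" unfolding cstar_norm_def by (rule cSup_least[OF ne ub])
  have "bdd_above ?A" using ub by (rule bdd_aboveI)
  then have "hnorm R (x R 0) \<le> cstar_norm x"
    unfolding cstar_norm_def using \<open>hnorm R (x R 0) \<in> ?A\<close> by (rule cSup_upper[rotated])
  then show "0 \<le> cstar_norm x" if "op_bounded x"
    using that R hilbert_zero[OF H] ip_norm_nonneg[OF H, of "x R 0"]
    unfolding op_bounded_def by fastforce
qed

lemma group_cstar_sequence:
  assumes x: "x \<in> group_cstar \<mu>"
  obtains F where "\<And>n. integrable \<mu> (F n)"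
    "\<And>n R v. unitary_rep R \<Longrightarrow> v \<in> hspace R \<Longrightarrow>
      hnorm R (x R v - l1_embed \<mu> (F n) R v) \<le> inverse (real (Suc n)) * hnorm R v"
proof -
  have "\<forall>n. \<exists>f. integrable \<mu> f \<and> (\<forall>R v. unitary_rep R \<and> v \<in> hspace R \<longrightarrow>
      hnorm R (x R v - l1_embed \<mu> f R v) \<le> inverse (real (Suc n)) * hnorm R v)"
    using group_cstar_l1[OF x] by simp
  then obtain F where "\<forall>n. integrable \<mu> (F n) \<and> (\<forall>R v. unitary_rep R \<and> v \<in> hspace R \<longrightarrow>
      hnorm R (x R v - l1_embed \<mu> (F n) R v) \<le> inverse (real (Suc n)) * hnorm R v)"
    by metis
  then show ?thesis using that by blast
qed

lemma integral_coeff_tendsto: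
  assumes F: "\<And>n. integrable \<mu> (F n)" and R: "unitary_rep R" and v: "v \<in> hspace R" and u: "u \<in> hspace R"
    and w: "w \<in> hspace R" and lim: "(\<lambda>n. hnorm R (w - l1_embed \<mu> (F n) R v)) \<longlonglongrightarrow> 0"
  shows "(\<lambda>n. LINT r|\<mu>. F n r * hip R (act R r v) u) \<longlonglongrightarrow> hip R w u"
proof -
  note H = unitary_rep_hilbert[OF R]
  have "(\<lambda>n. hnorm R (l1_embed \<mu> (F n) R v - w)) \<longlonglongrightarrow> 0"
    using lim ip_norm_minus_commute[OF H w l1_embed_in[OF F R v]] by simp
  from ip_tendsto_left[OF H l1_embed_in[OF F R v] w u this] show ?thesis
    by (simp add: l1_embed_ip[OF F R v u])
qed

text \<open>Integrals against a coefficient are inner products of \<open>l1_embed\<close>, so norm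
  approximation forces them to converge to the inner product at \<open>x\<close>.\<close>

theorem cstar_pair_coeff:
  fixes R :: "('g, 'g) unirep"
  assumes x: "x \<in> group_cstar \<mu>" and R: "unitary_rep R" and v: "v \<in> hspace R" and u: "u \<in> hspace R"
  shows "cstar_pair \<mu> x (\<lambda>r. hip R (act R r v) u) = hip R (x R v) u"
  unfolding cstar_pair_def
proof (rule the_equality)
  note H = unitary_rep_hilbert[OF R]
  have lim: "(\<lambda>n. LINT r|\<mu>. F n r * hip R (act R r v) u) \<longlonglongrightarrow> hip R (x R v) u"
    if F: "\<And>n. integrable \<mu> (F n)" and l: "(\<lambda>n. cstar_norm (x - l1_embed \<mu> (F n))) \<longlonglongrightarrow> 0" for F
  proof (rule integral_coeff_tendsto[OF F R v u group_cstar_in[OF x R v]])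
    have le: "hnorm R (x R v - l1_embed \<mu> (F n) R v) \<le> cstar_norm (x - l1_embed \<mu> (F n)) * hnorm R v" for n
      using cstar_norm_ge[OF op_bounded_diff[OF group_cstar_op_bounded[OF x] op_bounded_l1[OF F]] R v, of n]
      by simp
    show "(\<lambda>n. hnorm R (x R v - l1_embed \<mu> (F n) R v)) \<longlonglongrightarrow> 0"
      by (rule tendsto_sandwich[OF _ _ tendsto_const tendsto_mult_left_zero[OF l]])
         (use le ip_norm_nonneg[OF H hilbert_diff[OF H group_cstar_in[OF x R v] l1_embed_in[OF F R v]]] in
          \<open>auto intro!: always_eventually\<close>)
  qed
  then show "\<forall>F. (\<forall>n. integrable \<mu> (F n)) \<and> (\<lambda>n. cstar_norm (x - l1_embed \<mu> (F n))) \<longlonglongrightarrow> 0 \<longrightarrow>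
      (\<lambda>n. LINT r|\<mu>. F n r * hip R (act R r v) u) \<longlonglongrightarrow> hip R (x R v) u" by blast
  fix c
  assume c: "\<forall>F. (\<forall>n. integrable \<mu> (F n)) \<and> (\<lambda>n. cstar_norm (x - l1_embed \<mu> (F n))) \<longlonglongrightarrow> 0 \<longrightarrow>
      (\<lambda>n. LINT r|\<mu>. F n r * hip R (act R r v) u) \<longlonglongrightarrow> c"
  \<comment> \<open>Uniqueness needs at least one approximating sequence; otherwise the condition on
    \<open>c\<close> would hold vacuously.\<close>
  obtain F where F: "\<And>n. integrable \<mu> (F n)"
    and approx: "\<And>n R v. unitary_rep R \<Longrightarrow> v \<in> hspace R \<Longrightarrow>
      hnorm R (x R v - l1_embed \<mu> (F n) R v) \<le> inverse (real (Suc n)) * hnorm R v"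
    using group_cstar_sequence[OF x] by blast
  have bd: "op_bounded (x - l1_embed \<mu> (F n))" for n
    by (rule op_bounded_diff[OF group_cstar_op_bounded[OF x] op_bounded_l1[OF F]])
  have "cstar_norm (x - l1_embed \<mu> (F n)) \<le> inverse (real (Suc n))"
    "0 \<le> cstar_norm (x - l1_embed \<mu> (F n))" for n
    using cstar_norm_le[where x="x - l1_embed \<mu> (F n)" and C="inverse (real (Suc n))", OF _ _ R] approx bd
    by simp_all
  then have l: "(\<lambda>n. cstar_norm (x - l1_embed \<mu> (F n))) \<longlonglongrightarrow> 0"
    by (intro tendsto_sandwich[OF _ _ tendsto_const LIMSEQ_inverse_real_of_nat] always_eventually allI)
  then have "(\<lambda>n. LINT r|\<mu>. F n r * hip R (act R r v) u) \<longlonglongrightarrow> c"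
    using c[rule_format, of F] F by simp
  then show "c = hip R (x R v) u" using lim[OF F l] by (rule LIMSEQ_unique)
qed

section \<open>The action of \<open>P1\<close> on the group C*-algebra\<close>

lemma P1_tensor:
  fixes R :: "('g, 'g) unirep"
  assumes "\<rho> \<in> P1" and R: "unitary_rep R" and v: "v \<in> hspace R" and u: "u \<in> hspace R"
  obtains S :: "('g, 'g) unirep" and a b where
    "unitary_rep S" "a \<in> hspace S" "b \<in> hspace S"
    "\<And>r. hip S (act S r a) b = \<rho> r * hip R (act R r v) u"
    "hnorm S a = hnorm R v" "hnorm S b \<le> hnorm R u"
proof -
  obtain T :: "('g, 'g) unirep" and \<xi> where T: "unitary_rep T" "\<xi> \<in> hspace T" "hnorm T \<xi> = 1"
    "\<And>r. \<rho> r = hip T (act T r \<xi>) \<xi>" using P1E[OF assms(1)] by blast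
  show ?thesis
    by (rule tensor_coeff[OF T(1) R T(2) T(2) v u], rule that) (simp_all add: T)
qed

lemma P1_continuous: "\<rho> \<in> P1 \<Longrightarrow> continuous_on UNIV (\<rho> :: 'g \<Rightarrow> complex)"
  and P1_bound: "\<rho> \<in> P1 \<Longrightarrow> cmod (\<rho> r) \<le> 1"
proof -
  assume "\<rho> \<in> P1"
  then obtain R :: "('g, 'g) unirep" and \<xi> where R: "unitary_rep R" "\<xi> \<in> hspace R" "hnorm R \<xi> = 1"
    "\<And>r. \<rho> r = hip R (act R r \<xi>) \<xi>" using P1E by blast
  then have eq: "\<rho> = (\<lambda>r. hip R (act R r \<xi>) \<xi>)" by blast
  show "continuous_on UNIV \<rho>" unfolding eq by (rule coeff_continuous[OF R(1,2,2)])
  show "cmod (\<rho> r) \<le> 1" using coeff_bound[OF R(1,2,2), of r] R(3,4) by simp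
qed

lemma P1_integrable:
  assumes "\<rho> \<in> P1" "integrable \<mu> f" shows "integrable \<mu> (\<lambda>r. \<rho> r * f r)"
  using integrable_mult_bounded(1)[OF assms(2) P1_continuous[OF assms(1)] P1_bound[OF assms(1)]]
  by (simp add: mult.commute)

text \<open>A coefficient of \<open>\<rho> * f\<close> in \<open>R\<close> is a coefficient of
  \<open>f\<close> in the tensor product of \<open>R\<close> with the representation of \<rho>,
  between vectors of no larger norm. This is why the bound on \<open>f\<close> is assumed in all
  representations.\<close>

lemma P1_mult_contractive:
  assumes \<rho>: "\<rho> \<in> P1" and f: "integrable \<mu> f" and C: "0 \<le> C"
    and le: "\<And>R v. unitary_rep R \<Longrightarrow> v \<in> hspace R \<Longrightarrow> hnorm R (l1_embed \<mu> f R v) \<le> C * hnorm R v"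
    and R: "unitary_rep R" and v: "v \<in> hspace R"
  shows "hnorm R (l1_embed \<mu> (\<lambda>r. \<rho> r * f r) R v) \<le> C * hnorm R v"
proof -
  note H = unitary_rep_hilbert[OF R]
  define w where "w = l1_embed \<mu> (\<lambda>r. \<rho> r * f r) R v"
  have w: "w \<in> hspace R" unfolding w_def by (rule l1_embed_in[OF P1_integrable[OF \<rho> f] R v])
  obtain S :: "('g, 'g) unirep" and a b where S: "unitary_rep S" "a \<in> hspace S" "b \<in> hspace S"
    "\<And>r. hip S (act S r a) b = \<rho> r * hip R (act R r v) w"
    "hnorm S a = hnorm R v" "hnorm S b \<le> hnorm R w"
    using P1_tensor[OF \<rho> R v w] by blast
  have "hip R w w = (LINT r|\<mu>. f r * hip S (act S r a) b)"
    unfolding S(4) using l1_embed_ip[OF P1_integrable[OF \<rho> f] R v w, folded w_def]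
    by (simp add: ac_simps)
  also have "\<dots> = hip S (l1_embed \<mu> f S a) b" by (rule l1_embed_ip[OF f S(1-3), symmetric])
  finally have "cmod (hip R w w) \<le> hnorm S (l1_embed \<mu> f S a) * hnorm S b"
    using ip_Cauchy_Schwarz[OF unitary_rep_hilbert[OF S(1)] l1_embed_in[OF f S(1,2)] S(3)] by simp
  also have "\<dots> \<le> (C * hnorm R v) * hnorm R w"
    using le[OF S(1,2)] S(5,6) C ip_norm_nonneg[OF H v] ip_norm_nonneg[OF unitary_rep_hilbert[OF S(1)] S(3)]
    by (intro mult_mono) auto
  finally show ?thesis
    unfolding w_def[symmetric]
    by (intro ip_norm_le_if_ip_le[OF H w]) (use C ip_norm_nonneg[OF H v] in auto)
qed

text \<open>Approximate \<open>x\<close> by integrable functions and multiply these by \<rho>. By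
  contractivity the products converge uniformly over all representations; their limit has the
  required pairings, and coefficients separate the elements, so the definite description in
  \<open>cstar_act\<close> denotes it.\<close>

theorem cstar_act_approx:
  assumes \<rho>: "\<rho> \<in> P1" and x: "x \<in> group_cstar \<mu>"
  shows cstar_act_in: "cstar_act \<mu> \<rho> x \<in> group_cstar \<mu>"
    and cstar_act_norm: "integrable \<mu> f \<Longrightarrow> 0 \<le> C \<Longrightarrow>
      (\<And>R v. unitary_rep R \<Longrightarrow> v \<in> hspace R \<Longrightarrow> hnorm R (x R v - l1_embed \<mu> f R v) \<le> C * hnorm R v) \<Longrightarrow>
      unitary_rep R \<Longrightarrow> v \<in> hspace R \<Longrightarrow>
      hnorm R (cstar_act \<mu> \<rho> x R v - l1_embed \<mu> (\<lambda>r. \<rho> r * f r) R v) \<le> C * hnorm R v" (is "PROP ?norm f C R v")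
proof -
  obtain F where F: "\<And>n. integrable \<mu> (F n)"
    and approx: "\<And>n R v. unitary_rep R \<Longrightarrow> v \<in> hspace R \<Longrightarrow>
      hnorm R (x R v - l1_embed \<mu> (F n) R v) \<le> inverse (real (Suc n)) * hnorm R v"
    using group_cstar_sequence[OF x] by blast
  define L where "L f = l1_embed \<mu> (\<lambda>r. \<rho> r * f r)" for f
  have Lin: "L f R v \<in> hspace R" if "integrable \<mu> f" "unitary_rep R" "v \<in> hspace R" for f R v
    unfolding L_def by (rule l1_embed_in[OF P1_integrable[OF \<rho> that(1)] that(2,3)])
  \<comment> \<open>The difference is \<rho> times \<open>F n - f\<close>, to which contractivity
    applies.\<close>
  have near: "hnorm R (L (F n) R v - L f R v) \<le> (inverse (real (Suc n)) + C) * hnorm R v"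
    if f: "integrable \<mu> f" and C: "0 \<le> C" and le: "\<And>R v. unitary_rep R \<Longrightarrow> v \<in> hspace R \<Longrightarrow>
        hnorm R (x R v - l1_embed \<mu> f R v) \<le> C * hnorm R v"
      and R: "unitary_rep R" and v: "v \<in> hspace R" for f C R v n
  proof -
    have "L (F n) R v - L f R v = l1_embed \<mu> (\<lambda>r. \<rho> r * (F n r - f r)) R v"
      unfolding L_def
      using l1_embed_diff[OF P1_integrable[OF \<rho> F] P1_integrable[OF \<rho> f] R v, of n]
      by (simp add: right_diff_distrib)
    moreover have "hnorm R (l1_embed \<mu> (\<lambda>r. \<rho> r * (F n r - f r)) R v) \<le> (inverse (real (Suc n)) + C) * hnorm R v"
    proof (rule P1_mult_contractive[OF \<rho> _ _ _ R v])
      fix S :: "('g, 'g) unirep" and a assume S: "unitary_rep S" and a: "a \<in> hspace S"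
      note in' = l1_embed_in[OF F S a, of n] group_cstar_in[OF x S a] l1_embed_in[OF f S a]
      have "hnorm S (l1_embed \<mu> (\<lambda>r. F n r - f r) S a) \<le> hnorm S (l1_embed \<mu> (F n) S a - x S a)
          + hnorm S (x S a - l1_embed \<mu> f S a)"
        unfolding l1_embed_diff[OF F f S a] by (rule hnorm_diff_triangle[OF S in'])
      then show "hnorm S (l1_embed \<mu> (\<lambda>r. F n r - f r) S a) \<le> (inverse (real (Suc n)) + C) * hnorm S a"
        using approx[OF S a, of n] le[OF S a]
          ip_norm_minus_commute[OF unitary_rep_hilbert[OF S] in'(1,2)] by (simp add: distrib_right)
    qed (use F f C in auto)
    ultimately show ?thesis by simp
  qed
  \<comment> \<open>The limit is taken vector by vector; 0 is the normalisation that
    \<open>group_cstar\<close> prescribes elsewhere.\<close>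
  define y where "y R v = (if unitary_rep R \<and> v \<in> hspace R
      then SOME w. w \<in> hspace R \<and> (\<lambda>n. hnorm R (L (F n) R v - w)) \<longlonglongrightarrow> 0 else 0)" for R v
  have y: "y R v \<in> hspace R" "(\<lambda>n. hnorm R (L (F n) R v - y R v)) \<longlonglongrightarrow> 0"
    if R: "unitary_rep R" and v: "v \<in> hspace R" for R v
  proof -
    note H = unitary_rep_hilbert[OF R]
    have "\<exists>N. \<forall>m\<ge>N. \<forall>n\<ge>N. hnorm R (L (F m) R v - L (F n) R v) < e" if e: "e > 0" for e
    proof -
      define q where "q = hnorm R v + 1"
      have q: "q > 0" "hnorm R v \<le> q" using ip_norm_nonneg[OF H v] by (auto simp: q_def add_nonneg_pos)
      obtain N where N: "inverse (real (Suc N)) < e / (2 * q)"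
        using reals_Archimedean[of "e / (2 * q)"] e q by auto
      have "hnorm R (L (F m) R v - L (F n) R v) < e" if mn: "m \<ge> N" "n \<ge> N" for m n
      proof -
        have "inverse (real (Suc m)) \<le> inverse (real (Suc N))" "inverse (real (Suc n)) \<le> inverse (real (Suc N))"
          using mn by (auto intro!: le_imp_inverse_le)
        then have "inverse (real (Suc m)) + inverse (real (Suc n))
            \<le> inverse (real (Suc N)) + inverse (real (Suc N))" by (rule add_mono)
        also have "\<dots> < e / (2 * q) + e / (2 * q)" by (rule add_strict_mono[OF N N])
        finally have s: "inverse (real (Suc m)) + inverse (real (Suc n)) < e / q" by simp
        have "hnorm R (L (F m) R v - L (F n) R v) \<le> (inverse (real (Suc m)) + inverse (real (Suc n))) * hnorm R v"
          by (rule near[OF F _ approx R v]) auto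
        also have "\<dots> \<le> (inverse (real (Suc m)) + inverse (real (Suc n))) * q"
          using q by (intro mult_left_mono) auto
        also have "\<dots> < e" using s q by (simp add: pos_less_divide_eq)
        finally show ?thesis .
      qed
      then show ?thesis by blast
    qed
    then have "\<exists>w\<in>hspace R. (\<lambda>n. hnorm R (L (F n) R v - w)) \<longlonglongrightarrow> 0"
      using hilbert_complete[OF H Lin[OF F R v]] by simp
    then have "\<exists>w. w \<in> hspace R \<and> (\<lambda>n. hnorm R (L (F n) R v - w)) \<longlonglongrightarrow> 0" by blast
    from someI_ex[OF this] show "y R v \<in> hspace R" "(\<lambda>n. hnorm R (L (F n) R v - y R v)) \<longlonglongrightarrow> 0"
      by (auto simp: y_def R v)
  qed
  have ynorm: "hnorm R (y R v - L f R v) \<le> C * hnorm R v"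
    if f: "integrable \<mu> f" and C: "0 \<le> C" and le: "\<And>R v. unitary_rep R \<Longrightarrow> v \<in> hspace R \<Longrightarrow>
        hnorm R (x R v - l1_embed \<mu> f R v) \<le> C * hnorm R v"
      and R: "unitary_rep R" and v: "v \<in> hspace R" for f C R v
  proof (rule LIMSEQ_le_const)
    note H = unitary_rep_hilbert[OF R]
    have "(\<lambda>n. hnorm R (L (F n) R v - y R v) + (inverse (real (Suc n)) + C) * hnorm R v)
        \<longlonglongrightarrow> 0 + (0 + C) * hnorm R v"
      by (intro tendsto_intros y(2)[OF R v] LIMSEQ_inverse_real_of_nat)
    then show "(\<lambda>n. hnorm R (L (F n) R v - y R v) + (inverse (real (Suc n)) + C) * hnorm R v)
        \<longlonglongrightarrow> C * hnorm R v" by simp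
    have "hnorm R (y R v - L f R v) \<le> hnorm R (L (F n) R v - y R v) + (inverse (real (Suc n)) + C) * hnorm R v" for n
      using near[OF f C le R v, of n] hnorm_diff_triangle[OF R y(1)[OF R v] Lin[OF F R v] Lin[OF f R v], of n]
        ip_norm_minus_commute[OF H y(1)[OF R v] Lin[OF F R v], of n] by simp
    then show "\<exists>N. \<forall>n\<ge>N. hnorm R (y R v - L f R v)
        \<le> hnorm R (L (F n) R v - y R v) + (inverse (real (Suc n)) + C) * hnorm R v" by blast
  qed
  have ycstar: "y \<in> group_cstar \<mu>"
  proof -
    have "\<exists>g. integrable \<mu> g \<and> (\<forall>R v. unitary_rep R \<and> v \<in> hspace R \<longrightarrow>
        hnorm R (y R v - l1_embed \<mu> g R v) \<le> e * hnorm R v)" if e: "e > 0" for e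
    proof -
      obtain f where f: "integrable \<mu> f" "\<And>R v. unitary_rep R \<Longrightarrow> v \<in> hspace R \<Longrightarrow>
          hnorm R (x R v - l1_embed \<mu> f R v) \<le> e * hnorm R v"
        using group_cstar_l1[OF x e] by blast
      show ?thesis
        using ynorm[OF f(1) less_imp_le[OF e] f(2)] P1_integrable[OF \<rho> f(1)]
        unfolding L_def by (intro exI[of _ "\<lambda>r. \<rho> r * f r"]) simp
    qed
    moreover have "y R v = 0" if "\<not> (unitary_rep R \<and> v \<in> hspace R)" for R v
      unfolding y_def using that by auto
    ultimately show ?thesis unfolding group_cstar_def using y(1) by blast
  qed
  \<comment> \<open>Both sides are limits of the same integrals, read as coefficients of
    \<open>F n\<close> in the tensor product \<open>S\<close> and as coefficients of
    \<open>\<rho> * F n\<close> in \<open>R\<close>.\<close>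
  have ypair: "cstar_pair \<mu> y \<sigma> = cstar_pair \<mu> x (\<lambda>r. \<rho> r * \<sigma> r)" if FS: "\<sigma> \<in> fourier_stieltjes" for \<sigma>
  proof -
    obtain R :: "('g, 'g) unirep" and v u where R: "unitary_rep R" and v: "v \<in> hspace R"
      and u: "u \<in> hspace R" and \<sigma>: "\<sigma> = (\<lambda>r. hip R (act R r v) u)"
      by (rule fourier_stieltjesE[OF FS])
    obtain S :: "('g, 'g) unirep" and a b where S: "unitary_rep S" "a \<in> hspace S" "b \<in> hspace S"
      "\<And>r. hip S (act S r a) b = \<rho> r * hip R (act R r v) u"
      by (rule P1_tensor[OF \<rho> R v u], rule that)
    have "(\<lambda>n. hnorm S (x S a - l1_embed \<mu> (F n) S a)) \<longlonglongrightarrow> 0"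
    proof (rule tendsto_sandwich[OF _ _ tendsto_const tendsto_mult_left_zero[OF LIMSEQ_inverse_real_of_nat]])
      show "\<forall>\<^sub>F n in sequentially. hnorm S (x S a - l1_embed \<mu> (F n) S a) \<le> inverse (real (Suc n)) * hnorm S a"
        by (intro always_eventually allI approx[OF S(1,2)])
      show "\<forall>\<^sub>F n in sequentially. 0 \<le> hnorm S (x S a - l1_embed \<mu> (F n) S a)"
        by (intro always_eventually allI ip_norm_nonneg[OF unitary_rep_hilbert[OF S(1)]]
            hilbert_diff[OF unitary_rep_hilbert[OF S(1)]] group_cstar_in[OF x S(1,2)] l1_embed_in[OF F S(1,2)])
    qed
    from integral_coeff_tendsto[OF F S(1,2,3) group_cstar_in[OF x S(1,2)] this]
    have "(\<lambda>n. LINT r|\<mu>. F n r * (\<rho> r * hip R (act R r v) u)) \<longlonglongrightarrow> hip S (x S a) b"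
      unfolding S(4) .
    moreover have "(\<lambda>n. hip R (L (F n) R v) u) \<longlonglongrightarrow> hip R (y R v) u"
      by (rule ip_tendsto_left[OF unitary_rep_hilbert[OF R] Lin[OF F R v] y(1)[OF R v] u y(2)[OF R v]])
    then have "(\<lambda>n. LINT r|\<mu>. F n r * (\<rho> r * hip R (act R r v) u)) \<longlonglongrightarrow> hip R (y R v) u"
      unfolding L_def l1_embed_ip[OF P1_integrable[OF \<rho> F] R v u] by (simp add: ac_simps)
    ultimately have "hip S (x S a) b = hip R (y R v) u" by (rule LIMSEQ_unique)
    moreover have "cstar_pair \<mu> x (\<lambda>r. \<rho> r * \<sigma> r) = hip S (x S a) b"
      using cstar_pair_coeff[OF x S(1-3)] unfolding S(4) \<sigma> .
    ultimately show ?thesis using cstar_pair_coeff[OF ycstar R v u] by (simp add: \<sigma>)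
  qed
  have y_eq: "cstar_act \<mu> \<rho> x = y"
    unfolding cstar_act_def
  proof (rule the_equality)
    show "y \<in> group_cstar \<mu> \<and> (\<forall>\<sigma>\<in>fourier_stieltjes. cstar_pair \<mu> y \<sigma> = cstar_pair \<mu> x (\<lambda>r. \<rho> r * \<sigma> r))"
      using ycstar ypair by blast
    fix z assume z: "z \<in> group_cstar \<mu> \<and> (\<forall>\<sigma>\<in>fourier_stieltjes. cstar_pair \<mu> z \<sigma> = cstar_pair \<mu> x (\<lambda>r. \<rho> r * \<sigma> r))"
    show "z = y"
    proof (intro ext)
      fix R :: "('g, 'g) unirep" and v
      have "z R v = y R v"
      proof (cases "unitary_rep R \<and> v \<in> hspace R")
        case True
        then have R: "unitary_rep R" and v: "v \<in> hspace R" by auto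
        show ?thesis
        proof (rule ip_extensionality[OF unitary_rep_hilbert[OF R]])
          show "z R v \<in> hspace R" "y R v \<in> hspace R" using group_cstar_in z ycstar R v by blast+
          fix u assume u: "u \<in> hspace R"
          have "cstar_pair \<mu> z (\<lambda>r. hip R (act R r v) u) = cstar_pair \<mu> y (\<lambda>r. hip R (act R r v) u)"
            using z ypair fourier_stieltjesI[OF R v u] by simp
          then show "hip R (z R v) u = hip R (y R v) u"
            using cstar_pair_coeff[OF _ R v u] z ycstar by simp
        qed
      next
        case False
        then show ?thesis using group_cstar_outside z ycstar by metis
      qed
      then show "z R v i = y R v i" for i by simp
    qed
  qed
  show "cstar_act \<mu> \<rho> x \<in> group_cstar \<mu>" unfolding y_eq by (rule ycstar)
  show "PROP ?norm f C R v" unfolding y_eq by (rule ynorm[unfolded L_def])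
qed

text \<open>Every power acts contractively, so the error of replacing \<open>x\<close> by an
  integrable \<open>f\<close> does not grow, and the norm of \<open>\<rho> ^ n * f\<close> is at
  most its $L^1$ norm.\<close>

theorem cstar_act_power_tendsto_0:
  assumes \<rho>: "\<rho> \<in> P1" and x: "x \<in> group_cstar \<mu>"
    and lim: "\<And>f. integrable \<mu> f \<Longrightarrow> (\<lambda>n. LINT r|\<mu>. cmod (\<rho> r ^ n * f r)) \<longlonglongrightarrow> 0"
  shows "(\<lambda>n. cstar_norm (cstar_act \<mu> (\<lambda>r. \<rho> r ^ n) x)) \<longlonglongrightarrow> 0"
proof (rule LIMSEQ_I)
  fix e :: real assume "e > 0"
  then have e: "e / 3 > 0" by simp
  obtain f where f: "integrable \<mu> f" and approx: "\<And>R v. unitary_rep R \<Longrightarrow> v \<in> hspace R \<Longrightarrow>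
      hnorm R (x R v - l1_embed \<mu> f R v) \<le> e / 3 * hnorm R v"
    using group_cstar_l1[OF x e] by blast
  obtain T :: "('g, 'g) unirep" where T: "unitary_rep T" using P1E[OF \<rho>] by blast
  obtain N where N: "\<And>n. n \<ge> N \<Longrightarrow> (LINT r|\<mu>. cmod (\<rho> r ^ n * f r)) < e / 3"
    using order_tendstoD(2)[OF lim[OF f] e] unfolding eventually_sequentially by blast
  \<comment> \<open>The index starts at 1 because \<open>P1_power\<close> covers positive exponents.
    Two errors of \<open>e / 3\<close> leave room for strict inequality.\<close>
  have "norm (cstar_norm (cstar_act \<mu> (\<lambda>r. \<rho> r ^ n) x) - 0) < e" if n: "n \<ge> max 1 N" for n
  proof -
    define y where "y = cstar_act \<mu> (\<lambda>r. \<rho> r ^ n) x"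
    have \<rho>n: "(\<lambda>r. \<rho> r ^ n) \<in> P1" using P1_power[OF \<rho>] n by simp
    note fn = P1_integrable[OF \<rho>n f]
    have yc: "y \<in> group_cstar \<mu>" unfolding y_def by (rule cstar_act_in[OF \<rho>n x])
    have le: "hnorm R (y R v) \<le> (e / 3 + e / 3) * hnorm R v"
      if R: "unitary_rep R" and v: "v \<in> hspace R" for R v
    proof -
      note H = unitary_rep_hilbert[OF R]
      have "hnorm R (y R v) \<le> hnorm R (y R v - l1_embed \<mu> (\<lambda>r. \<rho> r ^ n * f r) R v)
          + hnorm R (l1_embed \<mu> (\<lambda>r. \<rho> r ^ n * f r) R v)"
        using hnorm_diff_triangle[OF R group_cstar_in[OF yc R v] l1_embed_in[OF fn R v] hilbert_zero[OF H]]
        by simp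
      also have "\<dots> \<le> e / 3 * hnorm R v + (LINT r|\<mu>. cmod (\<rho> r ^ n * f r)) * hnorm R v"
        unfolding y_def
        by (intro add_mono cstar_act_norm[OF \<rho>n x f less_imp_le[OF e] approx R v] l1_embed_norm[OF fn R v])
      also have "\<dots> \<le> e / 3 * hnorm R v + e / 3 * hnorm R v"
        using N[of n] n ip_norm_nonneg[OF H v] by (intro add_left_mono mult_right_mono) auto
      finally show ?thesis by (simp add: distrib_right)
    qed
    have "cstar_norm y \<le> e / 3 + e / 3" "0 \<le> cstar_norm y"
      using cstar_norm_le[OF _ le T] e group_cstar_op_bounded[OF yc] by auto
    then show ?thesis using e unfolding y_def by simp
  qed
  then show "\<exists>no. \<forall>n\<ge>no. norm (cstar_norm (cstar_act \<mu> (\<lambda>r. \<rho> r ^ n) x) - 0) < e" by blast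
qed

end

section \<open>Haar measure\<close>

lemma continuous_add_left: "continuous_on UNIV ((+) (g :: 'g::topological_group_add))"
  by (intro continuous_intros)

lemma add_image_eq_vimage: "(+) (g :: 'g::group_add) ` A = (+) (- g) -` A"
proof (intro equalityI subsetI)
  fix x assume "x \<in> (+) (- g) -` A"
  then have "- g + x \<in> A" "x = g + (- g + x)" by (auto simp flip: add.assoc)
  then show "x \<in> (+) g ` A" by blast
qed (auto simp flip: add.assoc)

lemma mem_add_image_iff: "x \<in> (+) (g :: 'g::group_add) ` A \<longleftrightarrow> - g + x \<in> A"
  by (simp add: add_image_eq_vimage)

lemma open_add_image: "open A \<Longrightarrow> open ((+) (g :: 'g::topological_group_add) ` A)"
  unfolding add_image_eq_vimage by (rule open_vimage[OF _ continuous_add_left])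

lemma compact_add_image: "compact A \<Longrightarrow> compact ((+) (g :: 'g::topological_group_add) ` A)"
  by (rule compact_continuous_image[OF continuous_on_subset[OF continuous_add_left]]) auto

lemma compact_add_nhd:
  fixes A U :: "'g::topological_group_add set"
  assumes "compact A" "open U" "A \<subseteq> U"
  obtains O' where "open O'" "0 \<in> O'" "\<And>g. g \<in> O' \<Longrightarrow> (+) g ` A \<subseteq> U"
proof -
  have "open ((\<lambda>p. fst p + snd p :: 'g) -` U)"
    by (intro open_vimage assms continuous_intros)
  moreover have "{0} \<times> A \<subseteq> (\<lambda>p. fst p + snd p :: 'g) -` U" using assms by auto
  ultimately have "\<exists>X0. 0 \<in> X0 \<and> open X0 \<and> X0 \<times> A \<subseteq> (\<lambda>p. fst p + snd p :: 'g) -` U"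
    by (rule Elementary_Topology.tube_lemma[OF assms(1)])
  then obtain X0 where "0 \<in> X0" "open X0" "X0 \<times> A \<subseteq> (\<lambda>p. fst p + snd p :: 'g) -` U"
    by blast
  then show ?thesis by (intro that[of X0]) auto
qed

lemma group_nhd_add:
  fixes U :: "'g::topological_group_add set"
  assumes "open U" "0 \<in> U"
  obtains V where "open V" "0 \<in> V" "\<And>g. g \<in> V \<Longrightarrow> - g \<in> V" "\<And>g h. g \<in> V \<Longrightarrow> h \<in> V \<Longrightarrow> g + h \<in> U"
proof -
  have "open ((\<lambda>p. fst p + snd p :: 'g) -` U)"
    by (intro open_vimage assms continuous_intros)
  moreover have "(0, 0) \<in> (\<lambda>p. fst p + snd p :: 'g) -` U" using assms by auto
  ultimately have "\<exists>A B. open A \<and> open B \<and> (0, 0) \<in> A \<times> B \<and> A \<times> B \<subseteq> (\<lambda>p. fst p + snd p :: 'g) -` U"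
    unfolding open_prod_def by blast
  then obtain A B where AB: "open A" "open B" "0 \<in> A" "0 \<in> B"
      "A \<times> B \<subseteq> (\<lambda>p. fst p + snd p :: 'g) -` U" by blast
  define V where "V = (A \<inter> B) \<inter> uminus -` (A \<inter> B)"
  have "open (uminus -` (A \<inter> B))" using AB by (intro open_vimage continuous_intros) auto
  then have "open V" using AB by (auto simp: V_def)
  then show ?thesis using AB by (intro that[of V]) (auto simp: V_def)
qed

locale haar_group = borel_group \<mu> for \<mu> :: "'g::{topological_group_add,t2_space} measure" +
  assumes haar: "left_haar_measure \<mu>"
    and locally_compact: "locally_compact_space (euclidean :: 'g topology)"
begin

lemma haar_facts:
  shows haar_UNIV: "emeasure \<mu> UNIV \<noteq> 0"
    and haar_compact: "compact K \<Longrightarrow> emeasure \<mu> K < \<infinity>"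
    and haar_outer: "A \<in> sets borel \<Longrightarrow> emeasure \<mu> A = (INF U\<in>{U. open U \<and> A \<subseteq> U}. emeasure \<mu> U)"
    and haar_inner: "open U \<Longrightarrow> emeasure \<mu> U = (SUP K\<in>{K. compact K \<and> K \<subseteq> U}. emeasure \<mu> K)"
    and haar_translate: "A \<in> sets borel \<Longrightarrow> emeasure \<mu> ((+) g ` A) = emeasure \<mu> A"
  using haar unfolding left_haar_measure_def by blast+

lemma space_eq [simp]: "space \<mu> = UNIV"
  using sets_eq_imp_space_eq[OF sets_eq] by simp

lemma compact_sets [measurable]: "compact K \<Longrightarrow> K \<in> sets \<mu>"
  using compact_imp_closed[of K] by (simp add: sets_eq)

lemma open_sets [measurable]: "open K \<Longrightarrow> K \<in> sets \<mu>"
  by (simp add: sets_eq)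

lemma measure_translate: "A \<in> sets \<mu> \<Longrightarrow> measure \<mu> ((+) g ` A) = measure \<mu> A"
  using haar_translate by (simp add: measure_def sets_eq)

lemma fmeasurable_compact: "compact K \<Longrightarrow> K \<in> fmeasurable \<mu>"
  using haar_compact by (intro fmeasurableI compact_sets) auto

lemma measurable_translate: "(+) g \<in> \<mu> \<rightarrow>\<^sub>M \<mu>"
  using borel_measurable_continuous_onI[OF continuous_add_left[of g]]
    measurable_cong_sets[OF sets_eq sets_eq] by blast

lemma distr_translate: "distr \<mu> \<mu> ((+) g) = \<mu>"
proof (rule measure_eqI)
  fix A assume "A \<in> sets (distr \<mu> \<mu> ((+) g))"
  then have A: "A \<in> sets \<mu>" by simp
  have "emeasure (distr \<mu> \<mu> ((+) g)) A = emeasure \<mu> ((+) (- g) ` A)"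
    using A measurable_translate[of g] by (simp add: emeasure_distr add_image_eq_vimage)
  then show "emeasure (distr \<mu> \<mu> ((+) g)) A = emeasure \<mu> A"
    using haar_translate A by (simp add: sets_eq)
qed simp

lemma integrable_translate:
  fixes f :: "'g \<Rightarrow> 'b::{banach,second_countable_topology}"
  assumes "integrable \<mu> f" shows "integrable \<mu> (\<lambda>r. f (g + r))"
  using integrable_distr[OF measurable_translate, of g f] assms by (simp add: distr_translate)

lemma integral_translate:
  fixes f :: "'g \<Rightarrow> 'b::{banach,second_countable_topology}"
  assumes "f \<in> borel_measurable \<mu>" shows "(LINT r|\<mu>. f (g + r)) = (LINT r|\<mu>. f r)"
  using integral_distr[OF measurable_translate assms, of g] by (simp add: distr_translate)

text \<open>Finitely many translates of an open null set would cover any compact set, and inner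
  regularity would make the whole group null.\<close>

lemma open_measure_pos:
  assumes U: "open U" "U \<noteq> {}" shows "emeasure \<mu> U > 0"
proof (rule ccontr)
  assume "\<not> emeasure \<mu> U > 0"
  then have 0: "emeasure \<mu> U = 0" by simp
  obtain u where u: "u \<in> U" using U by blast
  have "emeasure \<mu> K = 0" if K: "compact K" for K
  proof -
    have cover: "K \<subseteq> (\<Union>k\<in>K. (+) (k - u) ` U)"
    proof
      fix k assume "k \<in> K"
      moreover have "k \<in> (+) (k - u) ` U" using u by (force simp: image_iff)
      ultimately show "k \<in> (\<Union>k\<in>K. (+) (k - u) ` U)" by blast
    qed
    have op: "open ((+) (k - u) ` U)" for k by (rule open_add_image[OF U(1)])
    from compactE_image[OF K op cover] obtain D where
      "D \<subseteq> K" and D: "finite D" "K \<subseteq> (\<Union>k\<in>D. (+) (k - u) ` U)" .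
    have "emeasure \<mu> K \<le> emeasure \<mu> (\<Union>k\<in>D. (+) (k - u) ` U)"
      by (rule emeasure_mono[OF D(2)]) (use D(1) U in \<open>auto intro: open_sets open_add_image\<close>)
    also have "\<dots> \<le> (\<Sum>k\<in>D. emeasure \<mu> ((+) (k - u) ` U))"
      by (rule emeasure_subadditive_finite[OF D(1)]) (use U in \<open>auto intro: open_sets open_add_image\<close>)
    also have "\<dots> = 0" using 0 U by (simp add: haar_translate)
    finally show ?thesis by simp
  qed
  then have "emeasure \<mu> UNIV \<le> 0"
    unfolding haar_inner[OF open_UNIV] by (intro SUP_least) auto
  then show False using haar_UNIV by simp
qed

lemma outer_open:
  assumes A: "A \<in> sets \<mu>" "emeasure \<mu> A < \<infinity>" and e: "e > 0"
  obtains U where "open U" "A \<subseteq> U" "emeasure \<mu> (U - A) < e"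
proof -
  have "emeasure \<mu> A < emeasure \<mu> A + e"
    using A e ennreal_add_left_cancel_less[of "emeasure \<mu> A" 0 e] by auto
  then have "(INF U\<in>{U. open U \<and> A \<subseteq> U}. emeasure \<mu> U) < emeasure \<mu> A + e"
    by (subst haar_outer[symmetric]) (use A in \<open>simp_all add: sets_eq\<close>)
  then obtain U where U: "open U" "A \<subseteq> U" "emeasure \<mu> U < emeasure \<mu> A + e"
    unfolding INF_less_iff by blast
  have "emeasure \<mu> A + emeasure \<mu> (U - A) = emeasure \<mu> U"
    using plus_emeasure[of A \<mu> "U - A"] A open_sets[OF U(1)] Un_Diff_cancel[of A U] U(2)
    by (simp add: Un_absorb1)
  then have "emeasure \<mu> A + emeasure \<mu> (U - A) < emeasure \<mu> A + e" using U(3) by (simp only:)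
  then have "emeasure \<mu> (U - A) < e" unfolding ennreal_add_left_cancel_less by (rule conjunct2)
  then show ?thesis using that U by blast
qed

text \<open>The measure is inner regular on open sets only. So enclose \<open>A\<close> in an open
  \<open>U\<close>, cover the excess \<open>U - A\<close> by a small open \<open>V\<close>, and
  remove \<open>V\<close> from a large compact subset of \<open>U\<close>.\<close>

lemma inner_compact:
  assumes A: "A \<in> sets \<mu>" "emeasure \<mu> A < \<infinity>" "emeasure \<mu> A > 0"
  obtains K where "compact K" "K \<subseteq> A" "measure \<mu> K > 0"
proof -
  \<comment> \<open>The removed \<open>V\<close> has measure below \<open>a\<close> and the compact
    set measure above \<open>a\<close>; any value strictly between 0 and the measure of
    \<open>A\<close> would serve.\<close>
  define a where "a = emeasure \<mu> A / 2"
  have "a > 0" using A by (simp add: a_def ennreal_zero_less_divide)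
  have "a < emeasure \<mu> A"
  proof -
    obtain r where r: "emeasure \<mu> A = ennreal r" "r > 0"
      using A by (cases "emeasure \<mu> A") auto
    then show ?thesis unfolding a_def by (simp add: divide_ennreal[of r 2, simplified] ennreal_less_iff)
  qed
  obtain U where U: "open U" "A \<subseteq> U" "emeasure \<mu> (U - A) < a"
    using outer_open[OF A(1,2) \<open>a > 0\<close>] by blast
  have "(INF V\<in>{V. open V \<and> U - A \<subseteq> V}. emeasure \<mu> V) < a"
    by (subst haar_outer[symmetric]) (use U A in \<open>simp_all add: sets_eq\<close>)
  then obtain V where V: "open V" "U - A \<subseteq> V" "emeasure \<mu> V < a"
    unfolding INF_less_iff by blast
  have "a < emeasure \<mu> U"
    using \<open>a < emeasure \<mu> A\<close> emeasure_mono[OF U(2), of \<mu>] U(1) by (auto intro: open_sets less_le_trans)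
  then obtain K where K: "compact K" "K \<subseteq> U" "a < emeasure \<mu> K"
    unfolding haar_inner[OF U(1)] less_SUP_iff by blast
  have KV: "compact (K - V)" by (rule compact_diff[OF K(1) V(1)])
  have "emeasure \<mu> (K - V) \<noteq> 0"
  proof
    assume 0: "emeasure \<mu> (K - V) = 0"
    have "emeasure \<mu> K \<le> emeasure \<mu> ((K - V) \<union> V)"
      by (rule emeasure_mono) (use KV V K in \<open>auto intro: compact_sets open_sets\<close>)
    also have "\<dots> \<le> emeasure \<mu> (K - V) + emeasure \<mu> V"
      by (rule emeasure_subadditive) (use KV V K in \<open>auto intro: compact_sets open_sets\<close>)
    finally show False using 0 K V by simp
  qed
  then have "measure \<mu> (K - V) > 0"
    using haar_compact[OF KV] by (simp add: measure_def enn2real_positive_iff zero_less_iff_neq_zero)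
  moreover have "K - V \<subseteq> A" using K V by blast
  ultimately show ?thesis using that KV by blast
qed

lemma measure_diff_Int:
  assumes "A \<in> fmeasurable \<mu>" "B \<in> sets \<mu>"
  shows "measure \<mu> (A - B) = measure \<mu> A - measure \<mu> (A \<inter> B)"
proof -
  have eq: "A - B = A - (A \<inter> B)" by blast
  have "A \<inter> B \<in> sets \<mu>" by (intro sets.Int fmeasurableD[OF assms(1)] assms(2))
  then show ?thesis
    by (subst eq) (rule measurable_measure_Diff[OF assms(1) _ Int_lower1])
qed

text \<open>Small translations keep \<open>K\<close> inside an open set of barely larger measure, by
  the tube lemma. The opposite difference has the same measure because \<open>K\<close> and its
  translate do.\<close>

lemma measure_translate_diff:
  assumes K: "compact K" and e: "e > 0"
  obtains O' where "open O'" "0 \<in> O'" "\<And>g. g \<in> O' \<Longrightarrow> measure \<mu> ((+) g ` K - K) < e"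
    "\<And>g. g \<in> O' \<Longrightarrow> measure \<mu> (K - (+) g ` K) < e"
proof -
  have "ennreal e > 0" using e by simp
  from outer_open[OF compact_sets[OF K] haar_compact[OF K] this]
  obtain U where U: "open U" "K \<subseteq> U" "emeasure \<mu> (U - K) < ennreal e" .
  obtain O' where O': "open O'" "0 \<in> O'" "\<And>g. g \<in> O' \<Longrightarrow> (+) g ` K \<subseteq> U"
    using compact_add_nhd[OF K U(1,2)] by blast
  have le: "measure \<mu> ((+) g ` K - K) < e" if "g \<in> O'" for g
  proof -
    have "emeasure \<mu> ((+) g ` K - K) \<le> emeasure \<mu> (U - K)"
      by (rule emeasure_mono) (use O'(3)[OF that] U K in \<open>auto intro: compact_sets open_sets\<close>)
    also have "\<dots> < ennreal e" by (rule U)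
    finally have "emeasure \<mu> ((+) g ` K - K) < ennreal e" .
    moreover have "(+) g ` K - K \<in> fmeasurable \<mu>"
      using K compact_add_image by (intro fmeasurable.Diff fmeasurable_compact) auto
    ultimately show ?thesis by (simp add: emeasure_eq_measure2 ennreal_less_iff)
  qed
  have eq: "measure \<mu> (K - (+) g ` K) = measure \<mu> ((+) g ` K - K)" for g
  proof -
    have gK: "compact ((+) g ` K)" by (rule compact_add_image[OF K])
    have "measure \<mu> (K - (+) g ` K) = measure \<mu> K - measure \<mu> (K \<inter> (+) g ` K)"
      by (rule measure_diff_Int[OF fmeasurable_compact[OF K] compact_sets[OF gK]])
    moreover have "measure \<mu> ((+) g ` K - K) = measure \<mu> ((+) g ` K) - measure \<mu> (K \<inter> (+) g ` K)"
      using measure_diff_Int[OF fmeasurable_compact[OF gK] compact_sets[OF K]] by (simp add: Int_commute)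
    ultimately show ?thesis using measure_translate[OF compact_sets[OF K], of g] by simp
  qed
  show ?thesis by (rule that[OF O'(1,2) le]) (simp_all add: eq le)
qed

text \<open>Choose a symmetric \<open>V\<close> with \<open>V + V\<close> inside \<open>U\<close>.
  If \<open>x\<close> is in the closure of \<open>V\<close> then \<open>x + V\<close> meets
  \<open>V\<close>, so \<open>x\<close> lies in \<open>U\<close>; intersecting this closure with
  some compact neighbourhood suffices.\<close>

lemma compact_nhd:
  fixes U :: "'g set"
  assumes U: "open U" "0 \<in> U"
  obtains V W where "open W" "0 \<in> W" "W \<subseteq> V" "compact V" "V \<subseteq> U"
proof -
  have "\<forall>x :: 'g. \<exists>W K. open W \<and> compact K \<and> x \<in> W \<and> W \<subseteq> K"
    using locally_compact unfolding locally_compact_space_def by simp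
  then obtain W K :: "'g set" where W: "open W" "compact K" "0 \<in> W" "W \<subseteq> K" by blast
  obtain V where V: "open V" "0 \<in> V" "\<And>g. g \<in> V \<Longrightarrow> - g \<in> V" "\<And>g h. g \<in> V \<Longrightarrow> h \<in> V \<Longrightarrow> g + h \<in> U"
    using group_nhd_add[OF U] by blast
  have "closure V \<subseteq> U"
  proof
    fix x assume x: "x \<in> closure V"
    have "open ((+) x ` V)" "x \<in> (+) x ` V" using V by (auto intro: open_add_image simp: mem_add_image_iff)
    then have "V \<inter> (+) x ` V \<noteq> {}" using x closure_iff_nhds_not_empty[of x V] by (metis inf_commute subset_refl)
    then obtain v where v: "v \<in> V" "x + v \<in> V" by blast
    then have "x + v + (- v) \<in> U" using V by blast
    then show "x \<in> U" by (simp add: add.assoc)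
  qed
  moreover have "compact (K \<inter> closure V)" using W by (intro compact_Int_closed) auto
  ultimately show ?thesis
    using W V closure_subset[of V] by (intro that[of "W \<inter> V" "K \<inter> closure V"]) auto
qed

end

section \<open>Points at which a function in \<open>P1\<close> has modulus 1\<close>

text \<open>The equality case of Cauchy-Schwarz: with \<open>z\<close> the coefficient, the squared
  distance from \<open>act R r a\<close> to \<open>fscale z a\<close> is 1 - 2 |z|^2 + |z|^2 =
  0.\<close>

lemma act_eigenvector:
  assumes R: "unitary_rep R" and a: "a \<in> hspace R" "hnorm R a = 1"
    and c: "cmod (hip R (act R r a) a) = 1"
  shows "act R r a = fscale (hip R (act R r a) a) a"
proof -
  note H = unitary_rep_hilbert[OF R]
  define z where "z = hip R (act R r a) a"
  have in': "act R r a \<in> hspace R" by (rule act_in[OF R a(1)])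
  have "Re (cnj (- z) * z) = - 1"
    using complex_norm_square[of z] c by (simp add: z_def mult.commute)
  then have "(hnorm R (act R r a + fscale (- z) a))\<^sup>2 = 0"
    unfolding ip_norm_add_scale_square[OF H in' a(1)] z_def[symmetric]
    using a(2) c by (simp add: act_norm[OF R a(1)] z_def)
  then have "act R r a - fscale z a = 0"
    using ip_norm_eq_0_iff[OF H hilbert_diff[OF H in' hilbert_scale[OF H a(1)]]] by simp
  then show ?thesis by (simp add: z_def)
qed

lemma P1_zero: "\<rho> \<in> P1 \<Longrightarrow> \<rho> 0 = 1"
proof -
  assume "\<rho> \<in> P1"
  then obtain R :: "('a, 'a) unirep" and \<xi> where R: "unitary_rep R" "\<xi> \<in> hspace R" "hnorm R \<xi> = 1"
    "\<And>r. \<rho> r = hip R (act R r \<xi>) \<xi>" using P1E by blast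
  then show "\<rho> 0 = 1"
    using ip_self_real[OF unitary_rep_hilbert[OF R(1)] R(2)] ip_norm_square[OF unitary_rep_hilbert[OF R(1)] R(2)]
    by (simp add: act_0)
qed

text \<open>The right summand acts first on the defining vector, as a scalar; so the left one may be
  arbitrary.\<close>

lemma P1_multiplicative:
  assumes \<rho>: "\<rho> \<in> P1" and r: "cmod (\<rho> r) = 1"
  shows "\<rho> (s + r) = \<rho> s * \<rho> r"
proof -
  obtain R :: "('a, 'a) unirep" and \<xi> where R: "unitary_rep R" "\<xi> \<in> hspace R" "hnorm R \<xi> = 1"
    "\<And>r. \<rho> r = hip R (act R r \<xi>) \<xi>" using P1E[OF \<rho>] by blast
  have "act R r \<xi> = fscale (\<rho> r) \<xi>"
    using act_eigenvector[OF R(1-3), of r] r R(4) by simp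
  then have "act R (s + r) \<xi> = fscale (\<rho> r) (act R s \<xi>)"
    using act_plus[OF R(1,2)] act_scale[OF R(1,2)] by simp
  then show ?thesis
    using ip_scale_left[OF unitary_rep_hilbert[OF R(1)] act_in[OF R(1,2)] R(2)]
    by (simp add: R(4))
qed

lemma P1_uminus:
  assumes \<rho>: "\<rho> \<in> P1" and r: "cmod (\<rho> r) = 1"
  shows "\<rho> (- r) * \<rho> r = 1" "cmod (\<rho> (- r)) = 1"
proof -
  show "\<rho> (- r) * \<rho> r = 1" using P1_multiplicative[OF \<rho> r, of "- r"] P1_zero[OF \<rho>] by simp
  then have "cmod (\<rho> (- r)) * cmod (\<rho> r) = 1" by (metis norm_mult norm_one)
  then show "cmod (\<rho> (- r)) = 1" using r by simp
qed

context haar_group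
begin

text \<open>
  If \<open>|\<rho>| = 1\<close> on a set of positive measure then, by Steinhaus' argument, the subgroup
  \<open>{|\<rho>| = 1}\<close> is open. Otherwise dominated convergence applies.
\<close>

lemma P1_dichotomy:
  fixes f :: "'g \<Rightarrow> complex"
  assumes \<rho>: "\<rho> \<in> P1" and not_open: "\<not> (\<exists>U. open U \<and> 0 \<in> U \<and> (\<forall>r\<in>U. cmod (\<rho> r) = 1))"
    and f: "integrable \<mu> f"
  shows "(\<lambda>n. LINT r|\<mu>. cmod (\<rho> r ^ n * f r)) \<longlonglongrightarrow> 0"
proof -
  have \<rho>m [measurable]: "\<rho> \<in> borel_measurable \<mu>"
    by (rule continuous_measurable[OF P1_continuous[OF \<rho>]])
  have fm [measurable]: "f \<in> borel_measurable \<mu>" using f by simp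
  \<comment> \<open>Bounding \<open>f\<close> below makes the measure finite by Markov's inequality,
    as the choice of a compact subset requires; the union over \<open>k\<close> covers all points
    with \<open>f r \<noteq> 0\<close> and \<open>cmod (\<rho> r) = 1\<close>.\<close>
  define A where "A k = {r. cmod (f r) \<ge> inverse (real (Suc k)) \<and> cmod (\<rho> r) = 1}" for k
  have Am: "A k \<in> sets \<mu>" for k
  proof -
    have "{r \<in> space \<mu>. cmod (f r) \<ge> inverse (real (Suc k)) \<and> cmod (\<rho> r) = 1} \<in> sets \<mu>"
      by measurable
    then show ?thesis by (simp add: A_def)
  qed
  have "A k \<in> null_sets \<mu>" for k
  proof (rule ccontr)
    assume "A k \<notin> null_sets \<mu>"
    then have pos: "emeasure \<mu> (A k) > 0" using Am by (auto simp: null_sets_def zero_less_iff_neq_zero)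
    have "{r \<in> space \<mu>. cmod (f r) \<ge> inverse (real (Suc k))} \<in> sets \<mu>" by measurable
    then have "emeasure \<mu> (A k) \<le> emeasure \<mu> {r \<in> space \<mu>. cmod (f r) \<ge> inverse (real (Suc k))}"
      by (intro emeasure_mono) (auto simp: A_def)
    also have "\<dots> \<le> ennreal (1 / inverse (real (Suc k)) * (LINT r|\<mu>. cmod (f r)))"
      by (rule integral_Markov_inequality) (use f in auto)
    also have "\<dots> < \<infinity>" by simp
    finally have "emeasure \<mu> (A k) < \<infinity>" .
    from inner_compact[OF Am this pos] obtain K where K: "compact K" "K \<subseteq> A k" "measure \<mu> K > 0"
      by blast
    \<comment> \<open>The tolerance is the measure of \<open>K\<close> itself: a translate disjoint
      from \<open>K\<close> would differ from it by exactly that much.\<close>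
    obtain U where U: "open U" "0 \<in> U" "\<And>g. g \<in> U \<Longrightarrow> measure \<mu> ((+) g ` K - K) < measure \<mu> K"
      by (rule measure_translate_diff[OF K(1,3)], rule that)
    have "cmod (\<rho> g) = 1" if g: "g \<in> U" for g
    proof -
      have "(+) g ` K \<inter> K \<noteq> {}"
      proof
        assume "(+) g ` K \<inter> K = {}"
        then have "(+) g ` K - K = (+) g ` K" by blast
        then show False using U(3)[OF g] measure_translate[OF compact_sets[OF K(1)], of g] by simp
      qed
      then obtain h where h: "h \<in> K" "g + h \<in> K" by blast
      then have 1: "cmod (\<rho> h) = 1" "cmod (\<rho> (g + h)) = 1" using K(2) by (auto simp: A_def)
      have "\<rho> (g + h) = \<rho> g * \<rho> h" by (rule P1_multiplicative[OF \<rho> 1(1)])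
      then show ?thesis using 1 by (simp add: norm_mult)
    qed
    then show False using not_open U by blast
  qed
  then have "(\<Union>k. A k) \<in> null_sets \<mu>" by (rule null_sets_UN)
  then have "AE r in \<mu>. r \<notin> (\<Union>k. A k)" by (rule AE_not_in)
  then have AE: "AE r in \<mu>. f r = 0 \<or> cmod (\<rho> r) < 1"
  proof eventually_elim
    case (elim r)
    show ?case
    proof (rule disjCI)
      assume "\<not> cmod (\<rho> r) < 1"
      then have 1: "cmod (\<rho> r) = 1" using P1_bound[OF \<rho>, of r] by simp
      show "f r = 0"
      proof (rule ccontr)
        assume "f r \<noteq> 0"
        then obtain k where "inverse (real (Suc k)) < cmod (f r)"
          using reals_Archimedean[of "cmod (f r)"] by auto
        then have "r \<in> A k" using 1 by (simp add: A_def)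
        then show False using elim by blast
      qed
    qed
  qed
  have "(\<lambda>n. LINT r|\<mu>. cmod (\<rho> r ^ n * f r)) \<longlonglongrightarrow> (LINT r|\<mu>. (0::real))"
  proof (rule integral_dominated_convergence[where w="\<lambda>r. cmod (f r)"])
    show "AE r in \<mu>. (\<lambda>n. cmod (\<rho> r ^ n * f r)) \<longlonglongrightarrow> 0"
      using AE
    proof eventually_elim
      case (elim r)
      show ?case
      proof (cases "f r = 0")
        case False
        then have "(\<lambda>n. cmod (\<rho> r) ^ n * cmod (f r)) \<longlonglongrightarrow> 0"
          using elim by (intro tendsto_mult_left_zero LIMSEQ_realpow_zero) auto
        then show ?thesis by (simp add: norm_mult norm_power)
      qed simp
    qed
    show "AE r in \<mu>. norm (cmod (\<rho> r ^ n * f r)) \<le> cmod (f r)" for n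
      using P1_bound[OF \<rho>] by (auto simp: norm_mult norm_power power_le_one mult_left_le_one_le)
  qed (use f in auto)
  then show ?thesis by simp
qed

end

section \<open>Squares of integrable functions\<close>

context haar_group
begin

text \<open>Continuity of left translation in $L^1$ at the identity. It is established for
  indicators of compact sets and for differences, which cover both test functions.\<close>

definition l1_continuous :: "('g \<Rightarrow> complex) \<Rightarrow> bool"
  where "l1_continuous f \<longleftrightarrow>
    (\<forall>e>0. \<exists>U. open U \<and> 0 \<in> U \<and> (\<forall>g\<in>U. (LINT r|\<mu>. cmod (f (g + r) - f r)) < e))"

lemma integrable_indicator_compact:
  assumes "compact K" shows "integrable \<mu> (indicator K :: 'g \<Rightarrow> complex)"
proof -
  have "(indicator K :: 'g \<Rightarrow> complex) = (\<lambda>r. of_real (indicator K r))"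
    by (auto simp: indicator_def)
  then show ?thesis
    using integrable_real_indicator[OF compact_sets[OF assms] haar_compact[OF assms]]
    by simp
qed

lemma integrable_translate_minus:
  fixes f :: "'g \<Rightarrow> complex"
  assumes "integrable \<mu> f" shows "integrable \<mu> (\<lambda>r. f (g + r) - f r)"
  by (rule Bochner_Integration.integrable_diff[OF integrable_translate[OF assms] assms])

lemma l1_continuous_indicator:
  assumes K: "compact K" shows "l1_continuous (indicator K)"
  unfolding l1_continuous_def
proof (intro allI impI)
  fix e :: real assume "e > 0"
  then have e: "e / 2 > 0" by simp
  obtain U where U: "open U" "0 \<in> U" "\<And>g. g \<in> U \<Longrightarrow> measure \<mu> ((+) g ` K - K) < e / 2"
    "\<And>g. g \<in> U \<Longrightarrow> measure \<mu> (K - (+) g ` K) < e / 2"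
    by (rule measure_translate_diff[OF K e], rule that)
  \<comment> \<open>The function \<open>indicator K (g + r)\<close> of \<open>r\<close> is the
    indicator of the translate of \<open>K\<close> by \<open>- g\<close>, hence the
    negation.\<close>
  have "open (uminus -` U)" "0 \<in> uminus -` U"
    using U(2) by (auto intro!: open_vimage[OF U(1)] continuous_intros)
  moreover have "(LINT r|\<mu>. cmod (indicator K (g + r) - indicator K r)) < e" if g: "g \<in> uminus -` U" for g
  proof -
    have gK: "compact ((+) (- g) ` K)" by (rule compact_add_image[OF K])
    have fm: "(+) (- g) ` K - K \<in> fmeasurable \<mu>" "K - (+) (- g) ` K \<in> fmeasurable \<mu>"
      using fmeasurable_compact[OF K] fmeasurable_compact[OF gK] by (auto intro: fmeasurable.Diff)
    have "cmod (indicator K (g + r) - indicator K r)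
        = indicator ((+) (- g) ` K - K) r + indicator (K - (+) (- g) ` K) r" for r
      by (auto simp: indicator_def mem_add_image_iff)
    then have "(LINT r|\<mu>. cmod (indicator K (g + r) - indicator K r))
        = measure \<mu> ((+) (- g) ` K - K) + measure \<mu> (K - (+) (- g) ` K)"
      using fm by (simp add: fmeasurable_def)
    also have "\<dots> < e / 2 + e / 2" using U(3,4)[of "- g"] g by (intro add_strict_mono) auto
    finally show ?thesis by simp
  qed
  ultimately show "\<exists>U. open U \<and> 0 \<in> U \<and> (\<forall>g\<in>U. (LINT r|\<mu>. cmod (indicator K (g + r) - indicator K r)) < e)"
    by blast
qed

lemma l1_continuous_diff:
  assumes f: "integrable \<mu> f" "l1_continuous f" and h: "integrable \<mu> h" "l1_continuous h"
  shows "l1_continuous (\<lambda>r. f r - h r)"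
  unfolding l1_continuous_def
proof (intro allI impI)
  fix e :: real assume "e > 0"
  then have e: "e / 2 > 0" by simp
  obtain U where U: "open U" "0 \<in> U" "\<forall>g\<in>U. (LINT r|\<mu>. cmod (f (g + r) - f r)) < e / 2"
    using f(2) e unfolding l1_continuous_def by blast
  obtain V where V: "open V" "0 \<in> V" "\<forall>g\<in>V. (LINT r|\<mu>. cmod (h (g + r) - h r)) < e / 2"
    using h(2) e unfolding l1_continuous_def by blast
  have "(LINT r|\<mu>. cmod (f (g + r) - h (g + r) - (f r - h r))) < e" if g: "g \<in> U \<inter> V" for g
  proof -
    note int = integrable_translate_minus[OF f(1), of g] integrable_translate_minus[OF h(1), of g]
    have le: "cmod (f (g + r) - h (g + r) - (f r - h r)) \<le> cmod (f (g + r) - f r) + cmod (h (g + r) - h r)" for r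
      using norm_triangle_ineq4[of "f (g + r) - f r" "h (g + r) - h r"] by (simp add: algebra_simps)
    have "(LINT r|\<mu>. cmod (f (g + r) - h (g + r) - (f r - h r)))
        \<le> (LINT r|\<mu>. cmod (f (g + r) - f r) + cmod (h (g + r) - h r))"
      by (rule integral_mono[OF _ _ le])
         (use integrable_translate_minus[OF Bochner_Integration.integrable_diff[OF f(1) h(1)], of g] int in auto)
    also have "\<dots> = (LINT r|\<mu>. cmod (f (g + r) - f r)) + (LINT r|\<mu>. cmod (h (g + r) - h r))"
      using int by simp
    also have "\<dots> < e / 2 + e / 2" using U V g by (intro add_strict_mono) auto
    finally show ?thesis by simp
  qed
  then show "\<exists>U. open U \<and> 0 \<in> U \<and> (\<forall>g\<in>U. (LINT r|\<mu>. cmod (f (g + r) - h (g + r) - (f r - h r))) < e)"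
    using U V by (intro exI[of _ "U \<inter> V"]) auto
qed

section \<open>The element \<open>f\<^sup>* * f\<close>\<close>

text \<open>Left invariance moves the translation from \<open>f\<close> to the group element, and
  unitarity moves it to the other vector.\<close>

lemma l1_embed_translate:
  assumes f: "integrable \<mu> f" and R: "unitary_rep R" and v: "v \<in> hspace R" and u: "u \<in> hspace R"
  shows "hip R (l1_embed \<mu> (\<lambda>r. f (s + r)) R v) u = hip R (l1_embed \<mu> f R v) (act R s u)"
proof -
  have su: "act R s u \<in> hspace R" by (rule act_in[OF R u])
  have eq: "hip R (act R (- s + r) v) u = hip R (act R r v) (act R s u)" for r
    using act_adjoint[OF R act_in[OF R v, of r] u, of "- s"] act_plus[OF R v, of "- s" r] by simp
  have m: "(\<lambda>r. f r * hip R (act R (- s + r) v) u) \<in> borel_measurable \<mu>"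
    unfolding eq using integrable_coeff(1)[OF f R v su] by simp
  have "hip R (l1_embed \<mu> (\<lambda>r. f (s + r)) R v) u
      = (LINT r|\<mu>. f (s + r) * hip R (act R (- s + (s + r)) v) u)"
    using l1_embed_ip[OF integrable_translate[OF f] R v u] by (simp flip: add.assoc)
  also have "\<dots> = (LINT r|\<mu>. f r * hip R (act R (- s + r) v) u)"
    by (rule integral_translate[OF m])
  also have "\<dots> = hip R (l1_embed \<mu> f R v) (act R s u)"
    unfolding eq by (rule l1_embed_ip[OF f R v su, symmetric])
  finally show ?thesis .
qed

text \<open>A common translation by \<open>t\<close> preserves the integral, so the bound depends on
  \<open>s - t\<close> alone. This uniformity lets one neighbourhood of 0 serve for all points of
  the Riemann sum.\<close>

lemma l1_embed_translate_near:
  assumes f: "integrable \<mu> f" and R: "unitary_rep R" and v: "v \<in> hspace R" and u: "u \<in> hspace R"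
  shows "cmod (hip R (l1_embed \<mu> f R v) (act R s u) - hip R (l1_embed \<mu> f R v) (act R t u))
    \<le> (LINT r|\<mu>. cmod (f (s - t + r) - f r)) * hnorm R v * hnorm R u"
proof -
  note H = unitary_rep_hilbert[OF R]
  let ?d = "\<lambda>r. f (s + r) - f (t + r)"
  have d: "integrable \<mu> ?d" by (intro Bochner_Integration.integrable_diff integrable_translate f)
  have "hip R (l1_embed \<mu> f R v) (act R s u) - hip R (l1_embed \<mu> f R v) (act R t u)
      = hip R (l1_embed \<mu> ?d R v) u"
    unfolding l1_embed_translate[OF f R v u, symmetric]
      l1_embed_diff[OF integrable_translate[OF f] integrable_translate[OF f] R v]
    by (rule ip_diff_left[OF H, symmetric]) (use l1_embed_in[OF integrable_translate[OF f] R v] u in auto)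
  moreover have "cmod (hip R (l1_embed \<mu> ?d R v) u) \<le> (LINT r|\<mu>. cmod (?d r)) * hnorm R v * hnorm R u"
    unfolding l1_embed_ip[OF d R v u] by (rule integrable_coeff(2)[OF d R v u])
  moreover have "(LINT r|\<mu>. cmod (?d r)) = (LINT r|\<mu>. cmod (f (s - t + r) - f r))"
  proof -
    have "(\<lambda>r. cmod (f (s - t + r) - f r)) \<in> borel_measurable \<mu>"
      by (rule borel_measurable_integrable[OF integrable_norm[OF integrable_translate_minus[OF f]]])
    from integral_translate[OF this, of t] show ?thesis by (simp flip: add.assoc)
  qed
  ultimately show ?thesis by simp
qed

lemma cstar_adj_l1:
  assumes f: "integrable \<mu> f" and R: "unitary_rep R" and v: "v \<in> hspace R"
  shows cstar_adj_in: "cstar_adj (l1_embed \<mu> f) R v \<in> hspace R"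
    and cstar_adj_ip: "u \<in> hspace R \<Longrightarrow>
      hip R (cstar_adj (l1_embed \<mu> f) R v) u = hip R v (l1_embed \<mu> f R u)"
proof -
  note H = unitary_rep_hilbert[OF R]
  obtain w where w: "w \<in> hspace R" "\<And>u. u \<in> hspace R \<Longrightarrow> hip R w u = hip R v (l1_embed \<mu> f R u)"
  proof (rule hilbert_riesz[OF H, where L="\<lambda>u. hip R v (l1_embed \<mu> f R u)"
        and C="hnorm R v * (LINT r|\<mu>. cmod (f r))"])
    show "cmod (hip R v (l1_embed \<mu> f R u)) \<le> hnorm R v * (LINT r|\<mu>. cmod (f r)) * hnorm R u"
      if u: "u \<in> hspace R" for u
    proof -
      have "cmod (hip R v (l1_embed \<mu> f R u)) \<le> hnorm R v * hnorm R (l1_embed \<mu> f R u)"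
        by (rule ip_Cauchy_Schwarz[OF H v l1_embed_in[OF f R u]])
      also have "\<dots> \<le> hnorm R v * ((LINT r|\<mu>. cmod (f r)) * hnorm R u)"
        by (intro mult_left_mono l1_embed_norm[OF f R u] ip_norm_nonneg[OF H v])
      finally show ?thesis by (simp add: mult.assoc)
    qed
  qed (auto simp: l1_embed_vec_add[OF f R] l1_embed_vec_scale[OF f R] ip_add_right[OF H]
      ip_scale_right[OF H] l1_embed_in[OF f R] v)
  have "cstar_adj (l1_embed \<mu> f) R v = w"
    unfolding cstar_adj_def
    by (simp add: R v) (rule the_equality; use w ip_extensionality[OF H] in auto)
  then show "cstar_adj (l1_embed \<mu> f) R v \<in> hspace R" "u \<in> hspace R \<Longrightarrow>
      hip R (cstar_adj (l1_embed \<mu> f) R v) u = hip R v (l1_embed \<mu> f R u)"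
    using w by auto
qed

abbreviation l1_star_square :: "('g \<Rightarrow> complex) \<Rightarrow> 'g op_family"
  where "l1_star_square f \<equiv> cstar_mult (cstar_adj (l1_embed \<mu> f)) (l1_embed \<mu> f)"

lemma l1_square:
  assumes f: "integrable \<mu> f" and R: "unitary_rep R" and v: "v \<in> hspace R"
  defines "X \<equiv> l1_star_square f"
  shows l1_square_in: "X R v \<in> hspace R"
    and l1_square_ip: "u \<in> hspace R \<Longrightarrow> hip R (X R v) u = hip R (l1_embed \<mu> f R v) (l1_embed \<mu> f R u)"
  using cstar_adj_l1[OF f R l1_embed_in[OF f R v]] by (auto simp: X_def cstar_mult_def)

text \<open>
  The product \<open>f\<^sup>* * f\<close> is the integral of \<open>cnj (f s)\<close> times the translate of \<open>f\<close> by \<open>s\<close>. It is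
  approximated by Riemann sums, so neither the modular function nor Fubini's theorem is needed;
  the latter would require \<open>\<sigma>\<close>-finiteness and joint measurability of the group operation.
\<close>

theorem l1_square_in_group_cstar:
  assumes f: "integrable \<mu> f" and K: "compact K" and supp: "\<And>r. r \<notin> K \<Longrightarrow> f r = 0"
    and cont: "l1_continuous f"
  shows "l1_star_square f \<in> group_cstar \<mu>"
proof -
  define X where "X = l1_star_square f"
  note Xin = l1_square_in[OF f, folded X_def] and Xip = l1_square_ip[OF f, folded X_def]
  define N where "N = (LINT r|\<mu>. cmod (f r))"
  have N: "N \<ge> 0" by (simp add: N_def)
  have "\<exists>g. integrable \<mu> g \<and> (\<forall>R v. unitary_rep R \<and> v \<in> hspace R \<longrightarrow>
      hnorm R (X R v - l1_embed \<mu> g R v) \<le> e * hnorm R v)" if e: "e > 0" for e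
  proof -
    \<comment> \<open>The final error is \<open>d * N\<close>; the added 1 allows
      \<open>N = 0\<close>.\<close>
    define d where "d = e / (N + 1)"
    have d: "d > 0" "d * N \<le> e" using e N by (auto simp: d_def field_simps)
    from cont[unfolded l1_continuous_def, rule_format, OF d(1)]
    obtain U where U: "open U" "0 \<in> U" "\<forall>g\<in>U. (LINT r|\<mu>. cmod (f (g + r) - f r)) < d" by blast
    define B where "B t = {s. s - t \<in> U}" for t
    have Bopen: "open (B t)" for t
    proof -
      have "open ((\<lambda>s. s - t) -` U)" by (intro open_vimage[OF U(1)] continuous_intros)
      then show ?thesis by (simp add: B_def vimage_def)
    qed
    have cover: "K \<subseteq> (\<Union>t\<in>K. B t)" using U(2) by (auto simp: B_def)
    from compactE_image[OF K Bopen cover] obtain D where "D \<subseteq> K" and D: "finite D" "K \<subseteq> (\<Union>t\<in>D. B t)" .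
    obtain ts :: "nat \<Rightarrow> 'g" and n where ts: "D = ts ` {i. i < n}"
      using finite_imp_nat_seg_image_inj_on[OF D(1)] by blast
    \<comment> \<open>Each \<open>s\<close> is put into the first neighbourhood that contains it, so
      these sets are disjoint, and every point of the support of \<open>f\<close> lies in one with
      index below \<open>n\<close>.\<close>
    define A where "A i = B (ts i) - (\<Union>j<i. B (ts j))" for i
    have Am: "A i \<in> sets \<mu>" for i
      unfolding A_def by (intro sets.Diff sets.finite_UN open_sets Bopen) auto
    have part: "\<exists>i<n. \<forall>j. s \<in> A j \<longleftrightarrow> j = i" if "f s \<noteq> 0" for s
    proof -
      have "s \<in> K" using supp that by blast
      then have ex: "\<exists>i. i < n \<and> s \<in> B (ts i)" using D ts by auto
      define i where "i = (LEAST i. i < n \<and> s \<in> B (ts i))"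
      have i: "i < n" "s \<in> B (ts i)" using LeastI_ex[OF ex] by (auto simp: i_def)
      have least: "s \<notin> B (ts j)" if "j < i" for j
        using not_less_Least[of j "\<lambda>i. i < n \<and> s \<in> B (ts i)"] that i(1) by (auto simp: i_def)
      have "s \<in> A j \<longleftrightarrow> j = i" for j
        using i least by (cases j i rule: linorder_cases) (auto simp: A_def)
      then show ?thesis using i(1) by blast
    qed
    have partC: "(\<Sum>j<n. cnj (f s) * indicator (A j) s * y) = cnj (f s) * y" for s y
    proof (cases "f s = 0")
      case False
      then obtain i where "i < n" "\<forall>j. s \<in> A j \<longleftrightarrow> j = i" using part by blast
      then have "cnj (f s) * indicator (A j) s * y = (if j = i then cnj (f s) * y else 0)" for j
        by auto
      then show ?thesis using \<open>i < n\<close> by simp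
    qed simp
    have partR: "(\<Sum>j<n. cmod (f s * indicator (A j) s)) = cmod (f s)" for s
    proof (cases "f s = 0")
      case False
      then obtain i where "i < n" "\<forall>j. s \<in> A j \<longleftrightarrow> j = i" using part by blast
      then have "cmod (f s * indicator (A j) s) = (if j = i then cmod (f s) else 0)" for j
        by auto
      then show ?thesis using \<open>i < n\<close> by simp
    qed simp
    \<comment> \<open>On the piece \<open>A i\<close> the translate by \<open>s\<close> is replaced
      by the translate by \<open>ts i\<close>, so the weight of the latter is the integral of
      \<open>cnj (f s)\<close> over the piece.\<close>
    define c where "c i = (LINT s|\<mu>. cnj (f s) * indicator (A i) s)" for i
    define g where "g r = (\<Sum>i<n. c i * f (ts i + r))" for r
    have fc: "integrable \<mu> (\<lambda>s. cnj (f s))" using f by simp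
    have fA: "integrable \<mu> (\<lambda>s. cnj (f s) * indicator (A i) s)" for i
    proof -
      have "(\<lambda>s. cnj (f s) * indicator (A i) s) = (\<lambda>s. indicator (A i) s *\<^sub>R cnj (f s))"
        by (auto simp: indicator_def)
      then show ?thesis using integrable_mult_indicator[OF Am fc, of i] by simp
    qed
    have g: "integrable \<mu> g"
      unfolding g_def by (intro Bochner_Integration.integrable_sum integrable_mult_right integrable_translate f)
    have "hnorm R (X R v - l1_embed \<mu> g R v) \<le> e * hnorm R v" if R: "unitary_rep R" and v: "v \<in> hspace R" for R v
    proof -
      note H = unitary_rep_hilbert[OF R]
      define w where "w = l1_embed \<mu> f R v"
      have w: "w \<in> hspace R" unfolding w_def by (rule l1_embed_in[OF f R v])
      define z where "z = X R v - l1_embed \<mu> g R v"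
      have z: "z \<in> hspace R"
        unfolding z_def by (intro hilbert_diff[OF H] Xin[OF R v] l1_embed_in[OF g R v])
      \<comment> \<open>Pairing \<open>X R v\<close> with \<open>z\<close> integrates
        \<open>cnj (f s) * M s\<close>; for the Riemann sum \<open>M (ts i)\<close> stands in place
        of \<open>M s\<close> on each piece.\<close>
      define M where "M s = hip R w (act R s z)" for s
      have Mcnj: "M s = cnj (hip R (act R s z) w)" for s
        unfolding M_def by (rule ip_commute[OF H act_in[OF R z] w])
      have Mcont: "continuous_on UNIV M"
        unfolding Mcnj by (intro continuous_intros coeff_continuous[OF R z w])
      have Mbound: "cmod (M s) \<le> hnorm R z * hnorm R w" for s
        unfolding Mcnj using coeff_bound[OF R z w] by simp
      note AM = integrable_mult_bounded(1)[OF fA Mcont Mbound]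
      have 1: "hip R (X R v) z = (\<Sum>i<n. LINT s|\<mu>. cnj (f s) * indicator (A i) s * M s)"
      proof -
        have "hip R (X R v) z = cnj (hip R (l1_embed \<mu> f R z) w)"
          unfolding Xip[OF R v z] w_def[symmetric] by (rule ip_commute[OF H l1_embed_in[OF f R z] w])
        also have "\<dots> = (LINT s|\<mu>. cnj (f s) * M s)"
          unfolding l1_embed_ip[OF f R z w] by (simp add: Mcnj flip: Bochner_Integration.integral_cnj)
        also have "\<dots> = (LINT s|\<mu>. (\<Sum>i<n. cnj (f s) * indicator (A i) s * M s))"
          by (simp only: partC)
        also have "\<dots> = (\<Sum>i<n. LINT s|\<mu>. cnj (f s) * indicator (A i) s * M s)"
          by (rule Bochner_Integration.integral_sum) (rule AM)
        finally show ?thesis .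
      qed
      have 2: "hip R (l1_embed \<mu> g R v) z = (\<Sum>i<n. LINT s|\<mu>. cnj (f s) * indicator (A i) s * M (ts i))"
      proof -
        have "hip R (l1_embed \<mu> g R v) z = (LINT r|\<mu>. (\<Sum>i<n. c i * (f (ts i + r) * hip R (act R r v) z)))"
          unfolding l1_embed_ip[OF g R v z] g_def by (simp add: sum_distrib_right mult.assoc)
        also have "\<dots> = (\<Sum>i<n. c i * (LINT r|\<mu>. f (ts i + r) * hip R (act R r v) z))"
          by (subst Bochner_Integration.integral_sum)
             (auto intro!: integrable_mult_right integrable_coeff(1)[OF integrable_translate[OF f] R v z])
        also have "\<dots> = (\<Sum>i<n. c i * M (ts i))"
          unfolding l1_embed_ip[OF integrable_translate[OF f] R v z, symmetric]
            l1_embed_translate[OF f R v z] M_def w_def ..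
        finally show ?thesis by (simp add: c_def)
      qed
      have near: "cmod (cnj (f s) * indicator (A i) s * (M s - M (ts i)))
          \<le> cmod (f s * indicator (A i) s) * (d * hnorm R v * hnorm R z)" for i s
      proof (cases "s \<in> A i")
        case True
        then have "s - ts i \<in> U" by (auto simp: A_def B_def)
        have "cmod (M s - M (ts i)) \<le> (LINT r|\<mu>. cmod (f (s - ts i + r) - f r)) * hnorm R v * hnorm R z"
          unfolding M_def w_def by (rule l1_embed_translate_near[OF f R v z])
        also have "\<dots> \<le> d * hnorm R v * hnorm R z"
          using bspec[OF U(3) \<open>s - ts i \<in> U\<close>] ip_norm_nonneg[OF H v] ip_norm_nonneg[OF H z]
          by (intro mult_right_mono) auto
        finally show ?thesis using True by (simp add: norm_mult mult_left_mono)
      qed simp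
      have "hip R z z = (\<Sum>i<n. LINT s|\<mu>. cnj (f s) * indicator (A i) s * (M s - M (ts i)))"
      proof -
        have "hip R z z = hip R (X R v) z - hip R (l1_embed \<mu> g R v) z"
          unfolding z_def by (rule ip_diff_left[OF H Xin[OF R v] l1_embed_in[OF g R v] z[unfolded z_def]])
        then show ?thesis
          unfolding 1 2 sum_subtractf[symmetric] right_diff_distrib
          using AM fA by simp
      qed
      then have "cmod (hip R z z) \<le> (\<Sum>i<n. cmod (LINT s|\<mu>. cnj (f s) * indicator (A i) s * (M s - M (ts i))))"
        by (simp add: norm_sum)
      also have "\<dots> \<le> (\<Sum>i<n. LINT s|\<mu>. cmod (f s * indicator (A i) s) * (d * hnorm R v * hnorm R z))"
      proof (rule sum_mono)
        fix i
        have I: "integrable \<mu> (\<lambda>s. cnj (f s) * indicator (A i) s * (M s - M (ts i)))"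
          unfolding right_diff_distrib using AM[of i] fA[of i] by simp
        have J: "integrable \<mu> (\<lambda>s. cmod (f s * indicator (A i) s) * (d * hnorm R v * hnorm R z))"
          using integrable_norm[OF fA[of i]] by (simp add: norm_mult)
        have "cmod (LINT s|\<mu>. cnj (f s) * indicator (A i) s * (M s - M (ts i)))
            \<le> (LINT s|\<mu>. cmod (cnj (f s) * indicator (A i) s * (M s - M (ts i))))"
          by (rule integral_norm_bound)
        also have "\<dots> \<le> (LINT s|\<mu>. cmod (f s * indicator (A i) s) * (d * hnorm R v * hnorm R z))"
          by (rule integral_mono[OF integrable_norm[OF I] J near])
        finally show "cmod (LINT s|\<mu>. cnj (f s) * indicator (A i) s * (M s - M (ts i)))
            \<le> (LINT s|\<mu>. cmod (f s * indicator (A i) s) * (d * hnorm R v * hnorm R z))" .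
      qed
      also have "\<dots> = N * (d * hnorm R v * hnorm R z)"
      proof -
        have int: "integrable \<mu> (\<lambda>s. cmod (f s * indicator (A i) s))" for i
          using integrable_norm[OF fA[of i]] by (simp add: norm_mult)
        have "(\<Sum>i<n. LINT s|\<mu>. cmod (f s * indicator (A i) s)) = N"
          unfolding N_def by (subst Bochner_Integration.integral_sum[symmetric]) (auto intro: int simp: partR)
        then show ?thesis by (simp flip: sum_distrib_right)
      qed
      also have "\<dots> = (d * N) * hnorm R v * hnorm R z" by (simp add: ac_simps)
      also have "\<dots> \<le> e * hnorm R v * hnorm R z"
        using d(2) ip_norm_nonneg[OF H v] ip_norm_nonneg[OF H z] by (intro mult_right_mono)
      finally show ?thesis
        unfolding z_def[symmetric]
        by (intro ip_norm_le_if_ip_le[OF H z]) (use e ip_norm_nonneg[OF H v] in auto)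
    qed
    then show ?thesis using g by blast
  qed
  \<comment> \<open>For a vector outside the space the inner factor returns its default 0, which
    does lie in the space, so the outer factor has to be evaluated there.\<close>
  moreover have "X R v = 0" if nv: "\<not> (unitary_rep R \<and> v \<in> hspace R)" for R v
  proof (cases "unitary_rep R")
    case True
    note H = unitary_rep_hilbert[OF True]
    have 0: "l1_embed \<mu> f R v = 0" using nv by (auto simp: l1_embed_def)
    have "cstar_adj (l1_embed \<mu> f) R 0 = 0"
      by (rule ip_extensionality[OF H cstar_adj_in[OF f True hilbert_zero[OF H]] hilbert_zero[OF H]])
         (simp add: cstar_adj_ip[OF f True hilbert_zero[OF H]] ip_zero_left[OF H] l1_embed_in[OF f True])
    then show ?thesis by (simp add: X_def cstar_mult_def 0)
  qed (simp add: X_def cstar_mult_def cstar_adj_def)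
  ultimately show ?thesis
    unfolding X_def[symmetric] group_cstar_def using Xin by blast
qed

end

section \<open>Irreducibility\<close>

text \<open>The constant kernel on a single point. Its coefficient shows \<open>f\<close> to be
  nonzero in the C*-algebra whenever the integral of \<open>f\<close> is nonzero.\<close>

lemma trivial_coeff:
  obtains S :: "('g::topological_group_add, 'g) unirep" and a b where
    "unitary_rep S" "a \<in> hspace S" "b \<in> hspace S" "\<And>r. hip S (act S r a) b = 1"
proof -
  obtain R :: "('g, unit) unirep" and \<Phi> :: "unit \<Rightarrow> unit \<Rightarrow> complex" where R: "unitary_rep R" "\<And>x. \<Phi> x \<in> hspace R"
    "\<And>x y. hip R (\<Phi> x) (\<Phi> y) = 1" "\<And>r x. act R r (\<Phi> x) = \<Phi> x"
    by (rule kernel_representation[OF psd_kernel_one, where \<alpha>="\<lambda>r x. x"]) (simp, simp, simp, simp, blast)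
  obtain S :: "('g, 'g) unirep" and a b where S: "unitary_rep S" "a \<in> hspace S" "b \<in> hspace S"
    "\<And>r. hip S (act S r a) b = hip R (act R r (\<Phi> ())) (\<Phi> ())"
    by (rule coeff_realization[OF R(1) R(2) R(2), of "()" "()"]) blast
  show ?thesis by (rule that[OF S(1-3)]) (simp add: S(4) R)
qed

context haar_group
begin

text \<open>The form of a list is the squared $L^2$ norm of the step function
  \<open>F\<close>.\<close>

lemma psd_kernel_measure_Int:
  fixes P :: "'b \<Rightarrow> 'g set"
  assumes P: "\<And>A. P A \<in> fmeasurable \<mu>"
  shows "psd_kernel (\<lambda>A B. of_real (measure \<mu> (P A \<inter> P B)))"
  unfolding psd_kernel_def
proof (intro conjI allI)
  let ?k = "\<lambda>A B. complex_of_real (measure \<mu> (P A \<inter> P B))"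
  show "?k B A = cnj (?k A B)" for A B by (simp add: Int_commute)
  define F where "F xs r = (\<Sum>(c, A)\<leftarrow>xs. c * indicator (P A) r)" for xs :: "(complex \<times> 'b) list" and r
  have ind: "integrable \<mu> (\<lambda>r. c * indicator (P A) r * cnj (d * indicator (P B) r))"
    "(LINT r|\<mu>. c * indicator (P A) r * cnj (d * indicator (P B) r)) = c * cnj d * ?k A B" for c d A B
  proof -
    have eq: "(\<lambda>r. c * indicator (P A) r * cnj (d * indicator (P B) r))
        = (\<lambda>r. c * cnj d * of_real (indicator (P A \<inter> P B) r))"
      by (auto simp: indicator_def)
    have fm: "P A \<inter> P B \<in> fmeasurable \<mu>" using P by (intro fmeasurable.Int)
    show "integrable \<mu> (\<lambda>r. c * indicator (P A) r * cnj (d * indicator (P B) r))"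
      unfolding eq using fm by (auto simp: fmeasurable_def)
    show "(LINT r|\<mu>. c * indicator (P A) r * cnj (d * indicator (P B) r)) = c * cnj d * ?k A B"
      unfolding eq using fm by (simp add: fmeasurable_def)
  qed
  have 1: "integrable \<mu> (\<lambda>r. c * indicator (P A) r * cnj (F ys r)) \<and>
      (LINT r|\<mu>. c * indicator (P A) r * cnj (F ys r)) = kform ?k [(c, A)] ys" for c A ys
  proof (induction ys)
    case (Cons q ys)
    obtain d B where q: "q = (d, B)" by (cases q)
    have "c * indicator (P A) r * cnj (F (q # ys) r)
        = c * indicator (P A) r * cnj (d * indicator (P B) r) + c * indicator (P A) r * cnj (F ys r)" for r
      by (simp add: F_def q distrib_left)
    then show ?case
      using Cons ind[of c A d B] kform_Cons_right[of ?k "[(c, A)]" q ys]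
      by (simp add: q kform_singleton)
  qed (simp add: F_def)
  have 2: "integrable \<mu> (\<lambda>r. F xs r * cnj (F ys r)) \<and>
      (LINT r|\<mu>. F xs r * cnj (F ys r)) = kform ?k xs ys" for xs ys
  proof (induction xs)
    case (Cons p xs)
    obtain c A where p: "p = (c, A)" by (cases p)
    have "F (p # xs) r * cnj (F ys r) = c * indicator (P A) r * cnj (F ys r) + F xs r * cnj (F ys r)" for r
      by (simp add: F_def p distrib_right)
    then show ?case
      using Cons 1[of c A ys] kform_Cons_left[of ?k p xs ys] by (simp add: p)
  qed (simp add: F_def)
  fix xs
  have "kform ?k xs xs = (LINT r|\<mu>. of_real ((cmod (F xs r))\<^sup>2))"
    using 2[of xs xs] by (simp only: complex_norm_square)
  also have "\<dots> = of_real (LINT r|\<mu>. (cmod (F xs r))\<^sup>2)" by (rule integral_complex_of_real)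
  finally show "0 \<le> Re (kform ?k xs xs)" by simp
qed

text \<open>A coefficient of the left regular representation between two indicators. The points of
  the kernel are the sets themselves, moved by translation.\<close>

lemma regular_coeff:
  fixes A B :: "'g set"
  assumes A: "compact A" and B: "compact B"
  obtains S :: "('g, 'g) unirep" and a b where
    "unitary_rep S" "a \<in> hspace S" "b \<in> hspace S"
    "\<And>r. hip S (act S r a) b = of_real (measure \<mu> ((+) r ` A \<inter> B))"
proof -
  \<comment> \<open>Only compact sets are sure to have finite measure; the others count as empty.
    Translation preserves compactness, so \<open>P\<close> commutes with it.\<close>
  define P where "P A = (if compact A then A else {})" for A :: "'g set"
  define k where "k A B = complex_of_real (measure \<mu> (P A \<inter> P B))" for A B
  define \<alpha> where "\<alpha> r A = (+) r ` A" for r and A :: "'g set"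
  have Pc: "compact (P A)" for A by (simp add: P_def)
  have P\<alpha>: "P (\<alpha> r A) = (+) r ` P A" for r A
  proof -
    have "compact ((+) r ` A) \<longleftrightarrow> compact A"
    proof
      assume "compact ((+) r ` A)"
      then have "compact ((+) (- r) ` (+) r ` A)" by (rule compact_add_image)
      then show "compact A" by (simp add: image_image flip: add.assoc)
    qed (rule compact_add_image)
    then show ?thesis by (auto simp: P_def \<alpha>_def)
  qed
  have psd: "psd_kernel k"
    unfolding k_def by (rule psd_kernel_measure_Int[OF fmeasurable_compact[OF Pc]])
  obtain R :: "('g, 'g set) unirep" and \<Phi> where R: "unitary_rep R" "\<And>x. \<Phi> x \<in> hspace R"
    "\<And>x y. hip R (\<Phi> x) (\<Phi> y) = k x y" "\<And>r x. act R r (\<Phi> x) = \<Phi> (\<alpha> r x)"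
  proof (rule kernel_representation[OF psd, of \<alpha>])
    show "\<alpha> 0 x = x" for x by (simp add: \<alpha>_def)
    show "\<alpha> (r + s) x = \<alpha> r (\<alpha> s x)" for r s x by (simp add: \<alpha>_def image_image add.assoc)
    show "k (\<alpha> r x) (\<alpha> r y) = k x y" for r x y
    proof -
      have "P (\<alpha> r x) \<inter> P (\<alpha> r y) = (+) r ` (P x \<inter> P y)"
        unfolding P\<alpha> by (auto simp: mem_add_image_iff)
      then show ?thesis
        using measure_translate[OF sets.Int[OF compact_sets[OF Pc] compact_sets[OF Pc]], of r x y]
        by (simp add: k_def)
    qed
    show "((\<lambda>r. k (\<alpha> r x) x) \<longlongrightarrow> k x x) (nhds 0)" for x
      unfolding k_def
    proof (intro tendsto_of_real tendstoI)
      fix e :: real assume "e > 0"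
      obtain U where U: "open U" "0 \<in> U" "\<And>g. g \<in> U \<Longrightarrow> measure \<mu> ((+) g ` P x - P x) < e"
        "\<And>g. g \<in> U \<Longrightarrow> measure \<mu> (P x - (+) g ` P x) < e"
        by (rule measure_translate_diff[OF Pc \<open>e > 0\<close>, of x], rule that)
      have "dist (measure \<mu> (P (\<alpha> g x) \<inter> P x)) (measure \<mu> (P x \<inter> P x)) < e" if g: "g \<in> U" for g
      proof -
        have gc: "compact ((+) g ` P x)" by (rule compact_add_image[OF Pc])
        have "measure \<mu> (P x - (+) g ` P x) = measure \<mu> (P x) - measure \<mu> (P x \<inter> (+) g ` P x)"
          by (rule measure_diff_Int[OF fmeasurable_compact[OF Pc] compact_sets[OF gc]])
        then show ?thesis
          using U(4)[OF g] measure_nonneg[of \<mu> "P x - (+) g ` P x"]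
          unfolding dist_real_def P\<alpha> by (simp add: Int_commute)
      qed
      then show "\<forall>\<^sub>F g in nhds 0. dist (measure \<mu> (P (\<alpha> g x) \<inter> P x)) (measure \<mu> (P x \<inter> P x)) < e"
        unfolding eventually_nhds using U by blast
    qed
  qed blast
  obtain S :: "('g, 'g) unirep" and a b where S: "unitary_rep S" "a \<in> hspace S" "b \<in> hspace S"
    "\<And>r. hip S (act S r a) b = hip R (act R r (\<Phi> A)) (\<Phi> B)"
    by (rule coeff_realization[OF R(1) R(2) R(2), of A B]) blast
  have "P A = A" "P B = B" using A B by (simp_all add: P_def)
  then show ?thesis by (intro that[OF S(1-3)]) (simp add: S(4) R k_def P\<alpha>)
qed

text \<open>
  If \<open>f\<close> annihilates all powers of \<open>\<rho>\<close> then \<open>f\<^sup>* * f\<close> witnesses that \<open>\<rho>\<close> is not irreducible: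
  \<open>\<rho> ^ n\<close> is multiplicative on the support of \<open>f\<close>, so the cyclic vector of its representation
  is an eigenvector there.
\<close>

lemma pd_irreducible_contradiction:
  fixes S :: "('g, 'g) unirep"
  assumes \<rho>: "\<rho> \<in> P1" and irr: "pd_irreducible \<mu> \<rho>"
    and f: "integrable \<mu> f" and K: "compact K" and supp: "\<And>r. r \<notin> K \<Longrightarrow> f r = 0"
    and cont: "l1_continuous f" and one: "\<And>r. f r \<noteq> 0 \<Longrightarrow> cmod (\<rho> r) = 1"
    and zero: "\<And>n. n \<ge> 1 \<Longrightarrow> (LINT r|\<mu>. f r * \<rho> r ^ n) = 0"
    and S: "unitary_rep S" "a \<in> hspace S" "b \<in> hspace S"
    and nz: "(LINT r|\<mu>. f r * hip S (act S r a) b) \<noteq> 0"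
  shows False
proof -
  define X where "X = l1_star_square f"
  have X: "X \<in> group_cstar \<mu>"
    unfolding X_def by (rule l1_square_in_group_cstar[OF f K supp cont])
  have pos: "cstar_positive \<mu> X"
    unfolding cstar_positive_def X_def using l1_in_group_cstar[OF f] by blast
  \<comment> \<open>Pairing \<open>X S a\<close> with \<open>a\<close> gives the squared norm of
    \<open>l1_embed \<mu> f S a\<close>, which has a nonzero inner product with \<open>b\<close> by
    \<open>nz\<close>.\<close>
  have "X \<noteq> 0"
  proof
    assume "X = 0"
    then have "X S a = 0" by simp
    moreover have w: "l1_embed \<mu> f S a \<in> hspace S" by (rule l1_embed_in[OF f S(1,2)])
    ultimately have "hip S (l1_embed \<mu> f S a) (l1_embed \<mu> f S a) = 0"
      using l1_square_ip[OF f S(1,2,2), folded X_def] ip_zero_left[OF unitary_rep_hilbert[OF S(1)] S(2)] by simp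
    then have "l1_embed \<mu> f S a = 0"
      using ip_norm_eq_0_iff[OF unitary_rep_hilbert[OF S(1)] w] by (simp add: ip_norm_def)
    then show False
      using nz l1_embed_ip[OF f S] ip_zero_left[OF unitary_rep_hilbert[OF S(1)] S(3)] by simp
  qed
  then obtain n where n: "n \<ge> 1" "cstar_pair \<mu> X (\<lambda>r. \<rho> r ^ n) \<noteq> 0"
    using irr X pos unfolding pd_irreducible_def by blast
  obtain R :: "('g, 'g) unirep" and \<xi> where R: "unitary_rep R" "\<xi> \<in> hspace R" "hnorm R \<xi> = 1"
    "\<And>r. \<rho> r ^ n = hip R (act R r \<xi>) \<xi>"
    by (rule P1E[OF P1_power[OF \<rho> n(1)]], rule that)
  note H = unitary_rep_hilbert[OF R(1)]
  \<comment> \<open>On the support of \<open>f\<close> the vector \<open>\<xi>\<close> is an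
    eigenvector with eigenvalue \<open>\<rho> r ^ n\<close>, so this inner product is the vanishing
    integral times \<open>hip R \<xi> u\<close>.\<close>
  have "hip R (l1_embed \<mu> f R \<xi>) u = 0" if u: "u \<in> hspace R" for u
  proof -
    have eq: "f r * hip R (act R r \<xi>) u = f r * \<rho> r ^ n * hip R \<xi> u" for r
    proof (cases "f r = 0")
      case False
      then have "cmod (hip R (act R r \<xi>) \<xi>) = 1"
        using one[OF False] by (simp add: norm_power flip: R(4))
      then have "act R r \<xi> = fscale (\<rho> r ^ n) \<xi>"
        using act_eigenvector[OF R(1-3), of r] by (simp add: R(4))
      then show ?thesis using ip_scale_left[OF H R(2) u] by simp
    qed simp
    then show ?thesis
      unfolding l1_embed_ip[OF f R(1,2) u] eq using zero[OF n(1)] by simp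
  qed
  then have "l1_embed \<mu> f R \<xi> = 0"
    by (intro ip_extensionality[OF H l1_embed_in[OF f R(1,2)] hilbert_zero[OF H]])
       (simp add: ip_zero_left[OF H])
  then have "hip R (X R \<xi>) \<xi> = 0"
    using l1_square_ip[OF f R(1,2,2), folded X_def] ip_zero_left[OF H hilbert_zero[OF H]] by simp
  then show False
    using n(2) cstar_pair_coeff[OF X R(1,2,2)] by (simp add: R(4))
qed

lemma not_pd_irreducible_if_kernel:
  assumes \<rho>: "\<rho> \<in> P1" and U: "open U" "0 \<in> U" "\<And>r. r \<in> U \<Longrightarrow> cmod (\<rho> r) = 1"
    and s: "s \<noteq> 0" "\<rho> s = 1"
  shows "\<not> pd_irreducible \<mu> \<rho>"
proof
  assume irr: "pd_irreducible \<mu> \<rho>"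
  have s1: "cmod (\<rho> s) = 1" using s by simp
  \<comment> \<open>Two halvings: \<open>V0 + V0\<close> lies in \<open>V1\<close>, and
    \<open>V1 + V1\<close> in \<open>U0 \<inter> U\<close>. Hence \<open>s\<close> is not a sum of
    three elements of \<open>V0\<close>, as \<open>m0\<close> requires, and |\<rho>| = 1 on
    \<open>V\<close>.\<close>
  obtain U0 where U0: "open U0" "0 \<in> U0" "s \<notin> U0" using s(1) t1_space[of 0 s] by auto
  obtain V1 where V1: "open V1" "0 \<in> V1" "\<And>g. g \<in> V1 \<Longrightarrow> - g \<in> V1"
      "\<And>g h. g \<in> V1 \<Longrightarrow> h \<in> V1 \<Longrightarrow> g + h \<in> U0 \<inter> U"
    by (rule group_nhd_add[of "U0 \<inter> U"], (use U0 U in auto)[2], rule that)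
  obtain V0 where V0: "open V0" "0 \<in> V0" "\<And>g. g \<in> V0 \<Longrightarrow> - g \<in> V0"
      "\<And>g h. g \<in> V0 \<Longrightarrow> h \<in> V0 \<Longrightarrow> g + h \<in> V1"
    by (rule group_nhd_add[OF V1(1,2)], rule that)
  obtain V W where VW: "open W" "0 \<in> W" "W \<subseteq> V" "compact V" "V \<subseteq> V0"
    by (rule compact_nhd[OF V0(1,2)], rule that)
  have sV: "compact ((+) s ` V)" by (rule compact_add_image[OF VW(4)])
  have V0V1: "g \<in> V1" if "g \<in> V0" for g using V0(4)[OF that V0(2)] by simp
  have V1U: "g \<in> U" if "g \<in> V1" for g using V1(4)[OF that V1(2)] by simp
  have one: "cmod (\<rho> r) = 1" if "r \<in> V" for r using U(3) V1U V0V1 VW(5) that by blast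
  have \<rho>s: "\<rho> (s + r) = \<rho> r" if "r \<in> V" for r
    using P1_multiplicative[OF \<rho> one[OF that], of s] s(2) by simp
  define f :: "'g \<Rightarrow> complex" where "f r = indicator V r - indicator ((+) s ` V) r" for r
  note iV = integrable_indicator_compact[OF VW(4)] and isV = integrable_indicator_compact[OF sV]
  have shift: "(LINT r|\<mu>. indicator ((+) s ` V) r * h r) = (LINT r|\<mu>. indicator V r * h (s + r))"
    if "continuous_on UNIV h" for h :: "'g \<Rightarrow> complex"
  proof -
    have "(\<lambda>r. indicator ((+) s ` V) r * h r) \<in> borel_measurable \<mu>"
      using borel_measurable_integrable[OF isV] continuous_measurable[OF that] by measurable
    from integral_translate[OF this, of s] show ?thesis
      by (simp add: indicator_def mem_add_image_iff flip: add.assoc)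
  qed
  \<comment> \<open>This coefficient separates the two halves of \<open>f\<close>: it vanishes on
    the translate of \<open>V\<close> by \<open>s\<close> and is positive near 0.\<close>
  define m where "m r = measure \<mu> ((+) r ` V \<inter> V)" for r
  obtain S :: "('g, 'g) unirep" and a b where S: "unitary_rep S" "a \<in> hspace S" "b \<in> hspace S"
    "\<And>r. hip S (act S r a) b = of_real (m r)"
    unfolding m_def by (rule regular_coeff[OF VW(4) VW(4)]) blast
  show False
  proof (rule pd_irreducible_contradiction[OF \<rho> irr _ _ _ _ _ _ S(1-3)])
    show "integrable \<mu> f" unfolding f_def by (rule Bochner_Integration.integrable_diff[OF iV isV])
    show "compact (V \<union> (+) s ` V)" by (rule compact_Un[OF VW(4) sV])
    show "f r = 0" if "r \<notin> V \<union> (+) s ` V" for r using that by (simp add: f_def)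
    show "l1_continuous f"
      unfolding f_def by (intro l1_continuous_diff iV isV l1_continuous_indicator VW sV)
    show "cmod (\<rho> r) = 1" if "f r \<noteq> 0" for r
    proof -
      have "r \<in> V \<or> r \<in> (+) s ` V" using that by (auto simp: f_def indicator_def split: if_splits)
      then show ?thesis using one \<rho>s by auto
    qed
    show "(LINT r|\<mu>. f r * \<rho> r ^ n) = 0" if "n \<ge> 1" for n
    proof -
      have c: "continuous_on UNIV (\<lambda>r. \<rho> r ^ n)" by (intro continuous_intros P1_continuous[OF \<rho>])
      have b: "cmod (\<rho> r ^ n) \<le> 1" for r
        using P1_bound[OF \<rho>, of r] by (simp add: norm_power power_le_one)
      have eq: "indicator V r * \<rho> (s + r) ^ n = indicator V r * \<rho> r ^ n" for r
        using \<rho>s by (cases "r \<in> V") auto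
      show ?thesis
        unfolding f_def left_diff_distrib
        using integrable_mult_bounded(1)[OF iV c b] integrable_mult_bounded(1)[OF isV c b] shift[OF c]
        by (simp add: eq)
    qed
    have mc: "continuous_on UNIV (\<lambda>r. complex_of_real (m r))"
      using coeff_continuous[OF S(1-3)] by (simp only: S(4))
    have mb: "cmod (complex_of_real (m r)) \<le> measure \<mu> V" for r
      unfolding m_def using measure_mono_fmeasurable[OF Int_lower2 _ fmeasurable_compact[OF VW(4)], of "(+) r ` V"]
        compact_sets[OF VW(4)] compact_sets[OF compact_add_image[OF VW(4)]] by simp
    have m0: "m (s + r) = 0" if r: "r \<in> V" for r
    proof -
      have "(+) (s + r) ` V \<inter> V = {}"
      proof (rule ccontr)
        assume "(+) (s + r) ` V \<inter> V \<noteq> {}"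
        then obtain v where v: "v \<in> V" "s + r + v \<in> V" by blast
        have "s = (s + r + v) + (- v) + (- r)"
          by (simp only: add.assoc add_minus_cancel right_minus add.right_neutral)
        moreover have "(s + r + v) + (- v) \<in> V1" using v VW(5) V0(3,4) by blast
        moreover have "- r \<in> V1" using r VW(5) V0(3) V0V1 by blast
        ultimately have "s \<in> U0" using V1(4) by (metis IntD1)
        then show False using U0 by blast
      qed
      then show ?thesis by (simp add: m_def)
    qed
    have sz: "(LINT r|\<mu>. indicator ((+) s ` V) r * complex_of_real (m r)) = 0"
    proof -
      have "indicator V r * complex_of_real (m (s + r)) = 0" for r using m0 by (cases "r \<in> V") auto
      then show ?thesis unfolding shift[OF mc] by (simp only: Bochner_Integration.integral_zero)
    qed
    have "(LINT r|\<mu>. f r * hip S (act S r a) b) = (LINT r|\<mu>. indicator V r * complex_of_real (m r))"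
      unfolding S(4) f_def left_diff_distrib
      using integrable_mult_bounded(1)[OF iV mc mb] integrable_mult_bounded(1)[OF isV mc mb] sz
      by simp
    also have "\<dots> = of_real (LINT r|\<mu>. indicator V r * m r)"
      unfolding integral_complex_of_real[symmetric]
      by (intro Bochner_Integration.integral_cong refl) (auto simp: indicator_def)
    finally have eq: "(LINT r|\<mu>. f r * hip S (act S r a) b) = of_real (LINT r|\<mu>. indicator V r * m r)" .
    have int: "integrable \<mu> (\<lambda>r. indicator V r * m r)"
    proof -
      have "(\<lambda>r. Re (indicator V r * complex_of_real (m r))) = (\<lambda>r. indicator V r * m r)"
        by (auto simp: indicator_def)
      then show ?thesis using integrable_Re[OF integrable_mult_bounded(1)[OF iV mc mb]] by simp
    qed
    have mV: "measure \<mu> V > 0"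
    proof -
      have "0 < emeasure \<mu> W" using open_measure_pos VW by blast
      also have "\<dots> \<le> emeasure \<mu> V" by (rule emeasure_mono[OF VW(3) compact_sets[OF VW(4)]])
      finally show ?thesis using haar_compact[OF VW(4)] by (simp add: measure_def enn2real_positive_iff)
    qed
    show "(LINT r|\<mu>. f r * hip S (act S r a) b) \<noteq> 0"
    proof
      assume "(LINT r|\<mu>. f r * hip S (act S r a) b) = 0"
      then have "(LINT r|\<mu>. indicator V r * m r) = 0" using eq by simp
      then have AE: "AE r in \<mu>. indicator V r * m r = 0"
        by (subst (asm) integral_nonneg_eq_0_iff_AE[OF int]) (auto simp: m_def)
      \<comment> \<open>For these \<open>r\<close> the translate of \<open>V\<close> overlaps
        \<open>V\<close> in positive measure, so a product that vanishes almost everywhere would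
        make the open set \<open>W \<inter> O'\<close> null.\<close>
      obtain O' where O': "open O'" "0 \<in> O'" "\<And>g. g \<in> O' \<Longrightarrow> measure \<mu> ((+) g ` V - V) < measure \<mu> V"
        by (rule measure_translate_diff[OF VW(4) mV], rule that)
      have "m r \<noteq> 0" if "r \<in> O'" for r
      proof -
        have rV: "compact ((+) r ` V)" by (rule compact_add_image[OF VW(4)])
        have "measure \<mu> ((+) r ` V - V) = measure \<mu> ((+) r ` V) - m r"
          unfolding m_def by (rule measure_diff_Int[OF fmeasurable_compact[OF rV] compact_sets[OF VW(4)]])
        then show ?thesis using O'(3)[OF that] measure_translate[OF compact_sets[OF VW(4)], of r] by simp
      qed
      then have "AE r in \<mu>. r \<notin> W \<inter> O'"
        using AE VW(3) by (auto elim!: eventually_mono)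
      then have "emeasure \<mu> (W \<inter> O') = 0"
        using VW O' by (subst (asm) AE_iff_measurable[of "W \<inter> O'"]) (auto intro: open_sets)
      moreover have "emeasure \<mu> (W \<inter> O') > 0"
        using VW O' by (intro open_measure_pos) auto
      ultimately show False by simp
    qed
  qed
qed

end

section \<open>The case in which \<rho> takes the value 1 only at 0\<close>

lemma norm_cis_diff: "cmod (cis a - cis b) \<le> \<bar>a - b\<bar>"
proof -
  have "cis a - cis b = cis b * (cis (a - b) - 1)"
    by (simp add: right_diff_distrib cis_mult)
  then have "cmod (cis a - cis b) = cmod (cis (a - b) - 1)" by (simp add: norm_mult)
  also have "\<dots> = 2 * \<bar>sin ((a - b) / 2)\<bar>"
    using dist_exp_i_1[of "a - b"] by (simp add: cis_conv_exp dist_norm)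
  also have "\<dots> \<le> 2 * \<bar>(a - b) / 2\<bar>" using abs_sin_x_le_abs_x[of "(a - b) / 2"] by simp
  finally show ?thesis by simp
qed

definition mult_nat :: "nat \<Rightarrow> 'g::monoid_add \<Rightarrow> 'g"
  where "mult_nat n t = ((+) t ^^ n) 0"

lemma mult_nat_simps [simp]: "mult_nat 0 t = 0" "mult_nat (Suc n) t = t + mult_nat n t"
  by (simp_all add: mult_nat_def)

lemma continuous_mult_nat: "continuous_on UNIV (mult_nat n :: 'g::topological_group_add \<Rightarrow> 'g)"
proof (induction n)
  case (Suc n)
  have "continuous_on UNIV (\<lambda>t :: 'g. t + mult_nat n t)" using Suc by (intro continuous_intros)
  then show ?case by simp
qed simp

context haar_group
begin

text \<open>
  If \<open>\<rho>\<close> is injective on the open subgroup \<open>{|\<rho>| = 1}\<close> and \<open>G\<close> is not discrete, then \<open>\<rho>\<close> maps a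
  compact neighbourhood of \<open>0\<close> homeomorphically to a local subgroup of the circle with arbitrarily
  small elements, hence onto an arc. So the subgroup is a circle.
\<close>

lemma P1_circle:
  fixes \<rho> :: "'g \<Rightarrow> complex"
  assumes \<rho>: "\<rho> \<in> P1" and U: "open U" "0 \<in> U" "\<And>r. r \<in> U \<Longrightarrow> cmod (\<rho> r) = 1"
    and inj: "\<And>s. \<rho> s = 1 \<Longrightarrow> s = 0" and nd: "\<not> open {0 :: 'g}"
  shows "\<exists>h. \<rho> h = cis \<beta>" and "compact {r. cmod (\<rho> r) = 1}"
proof -
  have \<rho>0: "\<rho> 0 = 1" by (rule P1_zero[OF \<rho>])
  have c\<rho>: "continuous_on UNIV \<rho>" by (rule P1_continuous[OF \<rho>])
  have mult: "\<rho> (s + r) = \<rho> s * \<rho> r" if "cmod (\<rho> r) = 1" for s r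
    by (rule P1_multiplicative[OF \<rho> that])
  obtain K W where KW: "open W" "0 \<in> W" "W \<subseteq> K" "compact K" "K \<subseteq> U"
    by (rule compact_nhd[OF U(1,2)], rule that)
  have K1: "cmod (\<rho> r) = 1" if "r \<in> K" for r using KW U that by blast
  obtain V where V: "open V" "0 \<in> V" "\<And>g. g \<in> V \<Longrightarrow> - g \<in> V" "\<And>g h. g \<in> V \<Longrightarrow> h \<in> V \<Longrightarrow> g + h \<in> W"
    by (rule group_nhd_add[OF KW(1,2)], rule that)
  have VK: "r \<in> K" if "r \<in> V" for r using V(4)[OF that V(2)] KW(3) by auto
  \<comment> \<open>\<rho> omits the value 1 on the compact set \<open>K - V\<close>, so a point of
    \<open>K\<close> with value close to 1 must lie in \<open>V\<close>. This is continuity of the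
    inverse of \<rho> near 1.\<close>
  have "\<exists>d>0. \<forall>r\<in>K - V. d \<le> cmod (\<rho> r - 1)"
  proof (cases "K - V = {}")
    case False
    have "compact (K - V)" by (rule compact_diff[OF KW(4) V(1)])
    moreover have "continuous_on (K - V) (\<lambda>r. cmod (\<rho> r - 1))"
      by (intro continuous_intros continuous_on_subset[OF c\<rho>]) auto
    ultimately have "\<exists>r0\<in>K - V. \<forall>r\<in>K - V. cmod (\<rho> r0 - 1) \<le> cmod (\<rho> r - 1)"
      using False by (intro continuous_attains_inf)
    then obtain r0 where r0: "r0 \<in> K - V" "\<forall>r\<in>K - V. cmod (\<rho> r0 - 1) \<le> cmod (\<rho> r - 1)" by blast
    have "\<rho> r0 \<noteq> 1" using inj[of r0] r0(1) V(2) by auto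
    then show ?thesis using r0(2) by (intro exI[of _ "cmod (\<rho> r0 - 1)"]) auto
  qed (auto intro: exI[of _ 1])
  then obtain d where d0: "d > 0" "\<forall>r\<in>K - V. d \<le> cmod (\<rho> r - 1)" by blast
  have d: "d > 0" "\<And>r. r \<in> K \<Longrightarrow> cmod (\<rho> r - 1) < d \<Longrightarrow> r \<in> V"
    using d0 by (auto simp: not_le[symmetric])
  \<comment> \<open>A chord is no longer than its arc, so an angle of at most
    \<open>\<delta>\<close>, strictly below \<open>d\<close>, forces the point into
    \<open>V\<close>.\<close>
  define \<delta> where "\<delta> = d / 2"
  have \<delta>: "\<delta> > 0" "\<delta> < d" using d(1) by (auto simp: \<delta>_def)
  have inV: "r \<in> V" if "r \<in> K" "\<rho> r = cis \<theta>" "\<bar>\<theta>\<bar> \<le> \<delta>" for r \<theta>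
  proof (rule d(2)[OF that(1)])
    show "cmod (\<rho> r - 1) < d" using norm_cis_diff[of \<theta> 0] that \<delta> by simp
  qed
  \<comment> \<open>Non-discreteness gives a nonzero \<open>s\<close> near 0, injectivity makes its
    angle nonzero, and passing to \<open>- s\<close> makes the angle positive if necessary.\<close>
  have small: "\<exists>s\<in>V. \<exists>\<theta>. 0 < \<theta> \<and> \<theta> < \<kappa> \<and> \<rho> s = cis \<theta>" if \<kappa>: "\<kappa> > 0" for \<kappa>
  proof -
    have "isCont \<rho> 0" using c\<rho> by (simp add: continuous_on_eq_continuous_at)
    then have "isCont (\<lambda>s. Arg (\<rho> s)) 0"
      by (rule isCont_o2) (rule continuous_at_Arg, simp add: \<rho>0)
    then have "((\<lambda>s. Arg (\<rho> s)) \<longlongrightarrow> 0) (nhds 0)"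
      using tendsto_at_iff_tendsto_nhds[of "\<lambda>s. Arg (\<rho> s)" 0] by (simp add: isCont_def \<rho>0)
    then have "\<forall>\<^sub>F s in nhds 0. \<bar>Arg (\<rho> s)\<bar> < \<kappa>"
      using tendstoD[of "\<lambda>s. Arg (\<rho> s)" 0 "nhds 0" \<kappa>] \<kappa> by (simp add: dist_real_def)
    then obtain O' where O': "open O'" "0 \<in> O'" "\<forall>s\<in>O'. \<bar>Arg (\<rho> s)\<bar> < \<kappa>"
      unfolding eventually_nhds by blast
    have "O' \<inter> V \<noteq> {0}" using nd O'(1) V(1) by (metis open_Int)
    then obtain s where s: "s \<in> O'" "s \<in> V" "s \<noteq> 0" using O' V by blast
    define \<theta> where "\<theta> = Arg (\<rho> s)"
    have n1: "cmod (\<rho> s) = 1" using K1[OF VK[OF s(2)]] .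
    then have "\<rho> s \<noteq> 0" by auto
    then have \<theta>: "\<rho> s = cis \<theta>" using cis_Arg[of "\<rho> s"] n1 by (simp add: \<theta>_def sgn_div_norm)
    have "\<theta> \<noteq> 0" using \<theta> inj[of s] s(3) by auto
    have "\<bar>\<theta>\<bar> < \<kappa>" using O'(3) s(1) by (simp add: \<theta>_def)
    show ?thesis
    proof (cases "\<theta> > 0")
      case True
      have "\<theta> < \<kappa>" using \<open>\<bar>\<theta>\<bar> < \<kappa>\<close> by linarith
      show ?thesis by (intro bexI[OF _ s(2)] exI[of _ \<theta>] conjI True \<open>\<theta> < \<kappa>\<close> \<theta>)
    next
      case False
      have "\<rho> (- s) = (\<rho> (- s) * \<rho> s) * cis (- \<theta>)" unfolding \<theta> mult.assoc cis_mult by simp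
      then have "\<rho> (- s) = cis (- \<theta>)" unfolding P1_uminus(1)[OF \<rho> n1] by simp
      moreover have "0 < - \<theta>" "- \<theta> < \<kappa>" using False \<open>\<theta> \<noteq> 0\<close> \<open>\<bar>\<theta>\<bar> < \<kappa>\<close> by linarith+
      ultimately show ?thesis by (intro bexI[OF _ V(3)[OF s(2)]] exI[of _ "- \<theta>"] conjI)
    qed
  qed
  \<comment> \<open>As long as the angle is at most \<open>\<delta>\<close> the partial sum lies in
    \<open>V\<close> and not just in \<open>K\<close>, so one more summand \<open>s\<close> from
    \<open>V\<close> stays in \<open>W\<close>, hence in \<open>K\<close>.\<close>
  have multiples: "\<exists>t\<in>K. \<rho> t = cis (real j * \<theta>)"
    if s: "s \<in> V" "\<rho> s = cis \<theta>" "0 < \<theta>" and j: "real j * \<theta> \<le> \<delta>" for s \<theta> j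
    using j
  proof (induction j)
    case 0
    then show ?case using KW \<rho>0 by (intro bexI[of _ 0]) auto
  next
    case (Suc j)
    have le: "real j * \<theta> \<le> \<delta>" using Suc.prems s(3) by (simp add: distrib_right)
    then obtain t where t: "t \<in> K" "\<rho> t = cis (real j * \<theta>)" using Suc.IH by blast
    have "t \<in> V" by (rule inV[OF t]) (use le s(3) in simp)
    then have "t + s \<in> K" using V(4)[OF _ s(1)] KW(3) by blast
    moreover have "\<rho> (t + s) = cis (real (Suc j) * \<theta>)"
      using mult[OF K1[OF VK[OF s(1)]], of t] t(2) s(2) by (simp add: cis_mult algebra_simps)
    ultimately show ?case by blast
  qed
  \<comment> \<open>Multiples of arbitrarily small angles are dense in the arc, and the image of the
    compact set \<open>K\<close> is closed.\<close>
  have arc: "\<exists>t\<in>K. \<rho> t = cis \<alpha>" if \<alpha>: "0 \<le> \<alpha>" "\<alpha> \<le> \<delta>" for \<alpha>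
  proof -
    have "compact (\<rho> ` K)" by (rule compact_continuous_image[OF continuous_on_subset[OF c\<rho>] KW(4)]) simp
    then have cl: "closure (\<rho> ` K) = \<rho> ` K" by (intro closure_closed compact_imp_closed)
    have "\<exists>y\<in>\<rho> ` K. dist y (cis \<alpha>) < e" if e: "e > 0" for e
    proof -
      obtain s \<theta> where s: "s \<in> V" "0 < \<theta>" "\<theta> < e" "\<rho> s = cis \<theta>" using small[OF e] by blast
      define j where "j = nat \<lfloor>\<alpha> / \<theta>\<rfloor>"
      have fl: "real j = of_int \<lfloor>\<alpha> / \<theta>\<rfloor>" using \<alpha> s(2) by (simp add: j_def)
      have "real j \<le> \<alpha> / \<theta>" "\<alpha> / \<theta> < real j + 1" unfolding fl by linarith+
      then have j: "real j * \<theta> \<le> \<alpha>" "\<alpha> < real j * \<theta> + \<theta>" using s(2) by (simp_all add: field_simps)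
      then obtain t where t: "t \<in> K" "\<rho> t = cis (real j * \<theta>)" using multiples[OF s(1,4,2), of j] \<alpha> by force
      have "dist (\<rho> t) (cis \<alpha>) < e"
        using norm_cis_diff[of "real j * \<theta>" \<alpha>] j s(3) by (simp add: dist_norm t(2))
      then show ?thesis using t(1) by blast
    qed
    then have "cis \<alpha> \<in> closure (\<rho> ` K)" by (simp add: closure_approachable)
    then show ?thesis unfolding cl by force
  qed
  \<comment> \<open>\<open>M\<close> is the number of arcs of length \<open>\<delta>\<close> that
    suffices to go once around the circle.\<close>
  obtain M where M: "2 * pi / \<delta> < real M" using reals_Archimedean2 by blast
  have "0 < 2 * pi / \<delta>" using \<delta> by simp
  then have Mpos: "real M > 0" using M by linarith
  have M2: "2 * pi / real M \<le> \<delta>" using M Mpos \<delta> by (simp add: field_simps)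
  have power: "\<rho> (mult_nat n t) = \<rho> t ^ n \<and> cmod (\<rho> (mult_nat n t)) = 1" if t: "t \<in> K" for t n
  proof (induction n)
    case (Suc n)
    have "\<rho> (mult_nat (Suc n) t) = \<rho> t * \<rho> (mult_nat n t)"
      using mult[OF conjunct2[OF Suc.IH], of t] by simp
    then show ?case using Suc K1[OF t] by (simp add: norm_mult norm_power)
  qed (simp add: \<rho>0)
  have surj: "\<exists>t\<in>K. \<rho> (mult_nat M t) = z" if z: "cmod z = 1" for z
  proof -
    obtain \<beta> where \<beta>: "0 \<le> \<beta>" "\<beta> < 2 * pi" "z = cis \<beta>"
    proof -
      have "is_Arg z (Arg2pi z)" using Arg2pi[of z] by blast
      then have "z = cis (Arg2pi z)" unfolding is_Arg_def z cis_conv_exp of_real_1 mult_1_left .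
      then show ?thesis using that[of "Arg2pi z"] Arg2pi[of z] by simp
    qed
    have "\<beta> / real M \<le> 2 * pi / real M" using \<beta> Mpos by (intro divide_right_mono) auto
    then obtain t where t: "t \<in> K" "\<rho> t = cis (\<beta> / real M)"
      using arc[of "\<beta> / real M"] M2 \<beta>(1) Mpos by auto
    have "\<rho> (mult_nat M t) = cis (real M * (\<beta> / real M))"
      using power[OF t(1), of M] unfolding t(2) Complex.DeMoivre by (rule conjunct1)
    moreover have "real M * (\<beta> / real M) = \<beta>" using Mpos by simp
    ultimately show ?thesis using t(1) \<beta>(3) by (intro bexI[of _ t]) (simp_all only:)
  qed
  show "\<exists>h. \<rho> h = cis \<beta>" using surj[of "cis \<beta>"] by auto
  \<comment> \<open>Every element of modulus 1 has the same value as some \<open>M\<close>-fold sum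
    from \<open>K\<close>; their difference has value 1, so they coincide.\<close>
  have "{r. cmod (\<rho> r) = 1} = mult_nat M ` K"
  proof (intro equalityI subsetI)
    fix h assume "h \<in> {r. cmod (\<rho> r) = 1}"
    then have h: "cmod (\<rho> h) = 1" by simp
    obtain t where t: "t \<in> K" "\<rho> (mult_nat M t) = \<rho> h" using surj[OF h] by blast
    have "\<rho> (mult_nat M t + - h) = 1"
      using mult[OF P1_uminus(2)[OF \<rho> h], of "mult_nat M t"] P1_uminus(1)[OF \<rho> h] t(2)
      by (simp add: mult.commute)
    then have "mult_nat M t + - h = 0" by (rule inj)
    then have "h = mult_nat M t" by (simp add: eq_neg_iff_add_eq_0)
    then show "h \<in> mult_nat M ` K" using t(1) by blast
  qed (use power in auto)
  then show "compact {r. cmod (\<rho> r) = 1}"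
    using compact_continuous_image[OF continuous_on_subset[OF continuous_mult_nat] KW(4)] by simp
qed

lemma not_pd_irreducible_if_circle:
  fixes \<rho> :: "'g \<Rightarrow> complex"
  assumes \<rho>: "\<rho> \<in> P1" and U: "open U" "0 \<in> U" "\<And>r. r \<in> U \<Longrightarrow> cmod (\<rho> r) = 1"
    and inj: "\<And>s. \<rho> s = 1 \<Longrightarrow> s = 0" and nd: "\<not> open {0 :: 'g}"
  shows "\<not> pd_irreducible \<mu> \<rho>"
proof
  assume irr: "pd_irreducible \<mu> \<rho>"
  define H where "H = {r. cmod (\<rho> r) = 1}"
  note circle = P1_circle[OF \<rho> U inj nd]
  have H: "compact H" using circle(2) by (simp add: H_def)
  note iH = integrable_indicator_compact[OF H]
  \<comment> \<open>In the trivial representation the coefficient of the indicator is the measure of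
    \<open>H\<close>, positive since \<open>H\<close> contains \<open>U\<close>.\<close>
  obtain S :: "('g, 'g) unirep" and a b where S: "unitary_rep S" "a \<in> hspace S" "b \<in> hspace S"
    "\<And>r. hip S (act S r a) b = 1"
    by (rule trivial_coeff) blast
  show False
  proof (rule pd_irreducible_contradiction[OF \<rho> irr iH H _ l1_continuous_indicator[OF H] _ _ S(1-3)])
    show "(indicator H r :: complex) = 0" if "r \<notin> H" for r using that by simp
    show "cmod (\<rho> r) = 1" if "(indicator H r :: complex) \<noteq> 0" for r
      using that by (auto simp: H_def indicator_def split: if_splits)
    show "(LINT r|\<mu>. indicator H r * \<rho> r ^ n) = 0" if n: "n \<ge> 1" for n
    proof -
      \<comment> \<open>Translation by \<open>h\<close> maps \<open>H\<close> onto itself and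
        multiplies \<open>\<rho> r ^ n\<close> by -1, so the integral equals its own
        negative.\<close>
      obtain h where h: "\<rho> h = cis (pi / real n)" using circle(1) by blast
      have "real n * (pi / real n) = pi" using n by simp
      then have hn: "\<rho> h ^ n = - 1" unfolding h Complex.DeMoivre by (simp only: cis_pi)
      have h1: "cmod (\<rho> h) = 1" by (simp add: h)
      have eq: "indicator H (h + r) * \<rho> (h + r) ^ n = - (indicator H r * \<rho> r ^ n)" for r
      proof -
        have "cmod (\<rho> (h + r)) = 1 \<longleftrightarrow> cmod (\<rho> r) = 1"
        proof
          assume 1: "cmod (\<rho> (h + r)) = 1"
          have "\<rho> (- h + (h + r)) = \<rho> (- h) * \<rho> (h + r)" by (rule P1_multiplicative[OF \<rho> 1])
          then show "cmod (\<rho> r) = 1" using 1 P1_uminus(2)[OF \<rho> h1] by (simp add: norm_mult flip: add.assoc)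
        qed (use P1_multiplicative[OF \<rho>, of r h] h1 in \<open>simp add: norm_mult\<close>)
        then have iff: "h + r \<in> H \<longleftrightarrow> r \<in> H" by (simp add: H_def)
        show ?thesis
        proof (cases "r \<in> H")
          case True
          then have "\<rho> (h + r) = \<rho> h * \<rho> r" by (intro P1_multiplicative[OF \<rho>]) (simp add: H_def)
          then show ?thesis using True iff hn by (simp add: power_mult_distrib)
        qed (simp add: iff)
      qed
      have "(\<lambda>r. indicator H r * \<rho> r ^ n) \<in> borel_measurable \<mu>"
        using borel_measurable_integrable[OF iH] continuous_measurable[OF P1_continuous[OF \<rho>]] by measurable
      from integral_translate[OF this, of h] have "- (LINT r|\<mu>. indicator H r * \<rho> r ^ n) = (LINT r|\<mu>. indicator H r * \<rho> r ^ n)"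
        unfolding eq by simp
      then show ?thesis by (simp add: equal_neg_zero)
    qed
    have "emeasure \<mu> U > 0" using open_measure_pos U by blast
    also have "emeasure \<mu> U \<le> emeasure \<mu> H"
      by (rule emeasure_mono[OF _ compact_sets[OF H]]) (use U in \<open>auto simp: H_def\<close>)
    finally have "measure \<mu> H > 0"
      using haar_compact[OF H] by (simp add: measure_def enn2real_positive_iff)
    moreover have "(LINT r|\<mu>. (indicator H r :: complex)) = of_real (measure \<mu> H)"
    proof -
      have "(indicator H r :: complex) = of_real (indicator H r)" for r by (simp add: indicator_def)
      then show ?thesis by simp
    qed
    ultimately show "(LINT r|\<mu>. indicator H r * hip S (act S r a) b) \<noteq> 0"
      by (simp add: S(4))
  qed
qed

end

theorem theorem7:
  fixes \<mu> :: "'g::{topological_group_add,t2_space} measure"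
    and \<rho> :: "'g \<Rightarrow> complex"
    and x :: "'g op_family"
  assumes "locally_compact_space (euclidean :: 'g topology)"
    and "(euclidean :: 'g topology) \<noteq> discrete_topology UNIV"
    and "left_haar_measure \<mu>"
    and "\<rho> \<in> P1"
    and "pd_irreducible \<mu> \<rho>"
    and "x \<in> group_cstar \<mu>"
  shows "(\<lambda>n. cstar_norm (cstar_act \<mu> (\<lambda>r. \<rho> r ^ n) x)) \<longlonglongrightarrow> 0"
proof -
  interpret haar_group \<mu>
    by unfold_locales (use assms(1,3) in \<open>auto simp: left_haar_measure_def\<close>)
  have nd: "\<not> open {0 :: 'g}"
  proof
    assume 0: "open {0 :: 'g}"
    have "open {g}" for g :: 'g using open_add_image[OF 0, of g] by simp
    then have "open (\<Union>g\<in>A. {g})" for A :: "'g set" by (intro open_UN) auto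
    then have "open A" for A :: "'g set" by simp
    then have "(euclidean :: 'g topology) = discrete_topology UNIV"
      by (simp add: topology_eq)
    then show False using assms(2) by blast
  qed
  have "\<not> (\<exists>U. open U \<and> 0 \<in> U \<and> (\<forall>r\<in>U. cmod (\<rho> r) = 1))"
  proof
    assume "\<exists>U. open U \<and> 0 \<in> U \<and> (\<forall>r\<in>U. cmod (\<rho> r) = 1)"
    then obtain U where U: "open U" "0 \<in> U" "\<And>r. r \<in> U \<Longrightarrow> cmod (\<rho> r) = 1" by blast
    show False
    proof (cases "\<exists>s. s \<noteq> 0 \<and> \<rho> s = 1")
      case True
      then show False using not_pd_irreducible_if_kernel[OF assms(4) U] assms(5) by blast
    next
      case False
      then show False using not_pd_irreducible_if_circle[OF assms(4) U _ nd] assms(5) by blast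
    qed
  qed
  then show ?thesis
    by (intro cstar_act_power_tendsto_0[OF assms(4,6)] P1_dichotomy[OF assms(4)])
qed

end
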